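(* Let $(\xi_n)_{n\in\mathbb{Z}}$ be a stationary, ergodic and reversible Markov chain (i.e. its Markov operator satisfies $Q=Q^*$ on $\mathbb{L}^2(\mu)$) with values in a measurable space $(S,\mathcal{A})$ and marginal distribution $\mu$, and let $X_k=h(\xi_k)$ where $h:S\to\mathbb{R}$ is measurable with $\int h^2\,\mathrm{d}\mu<\infty$ and $\int h\,\mathrm{d}\mu=0$. Let $S_n(t)=\sum_{k=1}^n\mathrm{e}^{\mathrm{i}kt}X_k$ and $\mathbf{V}_n(t)=\frac1{\sqrt n}[\operatorname{Re}S_n(t),\operatorname{Im}S_n(t)]$. Let $t\in(0,2\pi)\setminus\{\pi,\pi/2,3\pi/2\}$. Then there is a set $S'\subset S$ with $\mu(S')=1$ such that for every $x\in S'$, $\mathbf{V}_n(t)$ converges in distribution under $\mathbb{P}^x$ to $(N_1(t),N_2(t))$, where $N_1(t),N_2(t)$ are independent identically distributed normal random variables with mean $0$ and variance $\sigma_t^2/2$, with $\sigma_t^2=\lim_{n\to\infty}\frac1n\mathbb{E}|S_n(t)|^2$.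
   Context: $\mathcal{A}$ is countably generated and the chain has a regular transition probability $Q(x,A)=\mathbb{P}(\xi_1\in A|\xi_0=x)$; $Q$ also denotes the Markov operator $(Qh)(x)=\int_S h(s)Q(x,\mathrm{d}s)$. The chain is constructed canonically on a product space of copies of $S$ with $\xi_n$ the $n$-th coordinate; $T$ is the shift, and ergodicity of the chain means ergodicity of the shift under $\mathbb{P}$. $\mathbb{P}$ (with expectation $\mathbb{E}$) is the law of the stationary chain; $\mathbb{P}^x$ is the law of the Markov chain with transition operator $Q$ started at $\xi_0=x$. *)

theory Defs
  imports "HOL-Probability.Probability"
begin

text \<open>Throughout, a measure \<open>\<mu>\<close> of type \<open>'a measure\<close> carries the state space
  \<open>(S, \<A>) = (space \<mu>, sets \<mu>)\<close> together with the marginal distribution on it.\<close>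

definition countably_generated_sigma :: "'a measure \<Rightarrow> bool" where
  "countably_generated_sigma M \<longleftrightarrow>
     (\<exists>G. countable G \<and> G \<subseteq> Pow (space M) \<and> sets M = sigma_sets (space M) G)"

definition markov_operator :: "('a \<Rightarrow> 'a measure) \<Rightarrow> ('a \<Rightarrow> real) \<Rightarrow> 'a \<Rightarrow> real" where
  "markov_operator Q h x = (\<integral>s. h s \<partial>Q x)"

definition square_integrable :: "'a measure \<Rightarrow> ('a \<Rightarrow> real) \<Rightarrow> bool" where
  "square_integrable \<mu> f \<longleftrightarrow> f \<in> borel_measurable \<mu> \<and> integrable \<mu> (\<lambda>x. (f x)\<^sup>2)"

text \<open>\<open>Q = Q\<^sup>*\<close> on \<open>L\<^sup>2(\<mu>)\<close>, i.e. \<open>\<langle>Q f, g\<rangle> = \<langle>f, Q g\<rangle>\<close>.\<close>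

definition reversible :: "'a measure \<Rightarrow> ('a \<Rightarrow> 'a measure) \<Rightarrow> bool" where
  "reversible \<mu> Q \<longleftrightarrow>
     (\<forall>f g. square_integrable \<mu> f \<longrightarrow> square_integrable \<mu> g \<longrightarrow>
        (\<integral>x. markov_operator Q f x * g x \<partial>\<mu>) = (\<integral>x. f x * markov_operator Q g x \<partial>\<mu>))"

definition shift :: "(int \<Rightarrow> 'a) \<Rightarrow> int \<Rightarrow> 'a" where
  "shift \<omega> = (\<lambda>n. \<omega> (n + 1))"

text \<open>The \<open>\<sigma>\<close>-algebra on the path space generated by the coordinates \<open>\<xi>\<^sub>i\<close>, \<open>i \<le> n\<close>.\<close>

definition past :: "'a measure \<Rightarrow> int \<Rightarrow> (int \<Rightarrow> 'a) measure" where
  "past \<mu> n = vimage_algebra (space (\<Pi>\<^sub>M i\<in>UNIV. \<mu>)) (\<lambda>\<omega>. restrict \<omega> {..n}) (\<Pi>\<^sub>M i\<in>{..n}. \<mu>)"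

text \<open>\<open>P\<close> is the law, on the space of two-sided paths, of a stationary Markov chain with marginal
  distribution \<open>\<mu>\<close> and regular transition probability \<open>Q\<close>; the chain itself is the
  coordinate process.\<close>

definition stationary_markov_law ::
  "'a measure \<Rightarrow> ('a \<Rightarrow> 'a measure) \<Rightarrow> (int \<Rightarrow> 'a) measure \<Rightarrow> bool" where
  "stationary_markov_law \<mu> Q P \<longleftrightarrow>
     prob_space P \<and>
     sets P = sets (\<Pi>\<^sub>M i\<in>UNIV. \<mu>) \<and>
     distr P P shift = P \<and>
     distr P \<mu> (\<lambda>\<omega>. \<omega> 0) = \<mu> \<and>
     (\<forall>n. \<forall>A\<in>sets \<mu>. AE \<omega> in P.
        real_cond_exp P (past \<mu> n) (\<lambda>\<omega>. indicat_real A (\<omega> (n + 1))) \<omega> = measure (Q (\<omega> n)) A)"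

definition shift_ergodic :: "(int \<Rightarrow> 'a) measure \<Rightarrow> bool" where
  "shift_ergodic P \<longleftrightarrow>
     (\<forall>A\<in>sets P. shift -` A \<inter> space P = A \<longrightarrow> measure P A = 0 \<or> measure P A = 1)"

text \<open>The law \<open>P\<^sup>x\<close> of the chain \<open>(\<xi>\<^sub>n)\<^bsub>n \<ge> 0\<^esub>\<close> started at \<open>\<xi>\<^sub>0 = x\<close>, obtained from the
  Ionescu-Tulcea theorem: the conditional law of \<open>\<xi>\<^sub>n\<close> given \<open>\<xi>\<^sub>0, \<dots>, \<xi>\<^bsub>n-1\<^esub>\<close> is
  \<open>chain_step \<mu> Q x n\<close>. Only the space and the \<open>\<sigma>\<close>-algebra of \<open>\<mu>\<close> are used.\<close>

definition chain_step ::
  "'a measure \<Rightarrow> ('a \<Rightarrow> 'a measure) \<Rightarrow> 'a \<Rightarrow> nat \<Rightarrow> (nat \<Rightarrow> 'a) \<Rightarrow> 'a measure" where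
  "chain_step \<mu> Q x n \<omega> = (if n = 0 then return \<mu> x else Q (\<omega> (n - 1)))"

definition chain_from :: "'a measure \<Rightarrow> ('a \<Rightarrow> 'a measure) \<Rightarrow> 'a \<Rightarrow> (nat \<Rightarrow> 'a) measure" where
  "chain_from \<mu> Q x =
     projective_family.lim UNIV (Ionescu_Tulcea.CI (chain_step \<mu> Q x) (\<lambda>_. \<mu>)) (\<lambda>_. \<mu>)"

lemma Ionescu_Tulcea_chain_step:
  assumes Q: "Q \<in> \<mu> \<rightarrow>\<^sub>M prob_algebra \<mu>" and x: "x \<in> space \<mu>"
  shows "Ionescu_Tulcea (chain_step \<mu> Q x) (\<lambda>_. \<mu>)"
proof (unfold Ionescu_Tulcea_def, intro conjI allI impI, goal_cases)
  case (1 i)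
  have Q': "Q \<in> \<mu> \<rightarrow>\<^sub>M subprob_algebra \<mu>"
    using Q by (rule measurable_prob_algebraD)
  show ?case
  proof (cases i)
    case 0
    have "return \<mu> x \<in> space (subprob_algebra \<mu>)"
      using x by (intro measurable_space[OF return_measurable])
    then show ?thesis
      using 0 by (simp add: chain_step_def[abs_def])
  next
    case (Suc j)
    have "(\<lambda>\<omega>. \<omega> j) \<in> Pi\<^sub>M {0..<i} (\<lambda>_. \<mu>) \<rightarrow>\<^sub>M \<mu>"
      using Suc by (intro measurable_component_singleton) auto
    from measurable_compose[OF this Q'] show ?thesis
      using Suc by (simp add: chain_step_def[abs_def])
  qed
next
  case \<omega>: (2 i \<omega>)
  show ?case
  proof (cases i)
    case 0
    then show ?thesis
      using x by (simp add: chain_step_def prob_space_return)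
  next
    case (Suc j)
    have "\<omega> j \<in> space \<mu>"
      using \<omega> Suc by (auto simp: space_PiM PiE_iff)
    from measurable_space[OF Q this] show ?thesis
      using Suc by (simp add: chain_step_def space_prob_algebra)
  qed
qed

definition fourier_sum :: "(nat \<Rightarrow> real) \<Rightarrow> nat \<Rightarrow> real \<Rightarrow> complex" where
  "fourier_sum X n t = (\<Sum>k=1..n. exp (\<i> * of_real (real k * t)) * of_real (X k))"

definition fourier_vec :: "(nat \<Rightarrow> real) \<Rightarrow> nat \<Rightarrow> real \<Rightarrow> real \<times> real" where
  "fourier_vec X n t =
     (1 / sqrt (real n)) *\<^sub>R (Re (fourier_sum X n t), Im (fourier_sum X n t))"

text \<open>The normal law with mean \<open>m\<close> and variance \<open>v \<ge> 0\<close>; \<open>v = 0\<close> gives the point mass at \<open>m\<close>,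
  which has no density.\<close>

definition normal_law :: "real \<Rightarrow> real \<Rightarrow> real measure" where
  "normal_law m v =
     (if v = 0 then return borel m else density lborel (normal_density m (sqrt v)))"

text \<open>The library's \<open>weak_conv_m\<close> is stated through distribution functions and is restricted to
  the real line.\<close>

definition weakly_converges ::
  "(nat \<Rightarrow> 'b::topological_space measure) \<Rightarrow> 'b measure \<Rightarrow> bool" where
  "weakly_converges \<nu> N \<longleftrightarrow>
     (\<forall>f::'b \<Rightarrow> real. continuous_on UNIV f \<longrightarrow> bounded (range f) \<longrightarrow>
        (\<lambda>n. \<integral>y. f y \<partial>\<nu> n) \<longlonglongrightarrow> (\<integral>y. f y \<partial>N))"

end

theory Submission
  imports Defs
begin

text \<open>Write \<open>\<xi>\<^sub>k\<close> for the coordinates of a path and \<open>D\<^sub>k = G(\<xi>\<^sub>k) - (Q G)(\<xi>\<^bsub>k-1\<^esub>)\<close> for the martingale differences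
  that a function \<open>G\<close> on the state space produces.

  The operator \<open>Q\<close> is a self-adjoint contraction of \<open>L\<^sup>2(\<mu>)\<close>, so its spectrum is real. For \<open>sin t \<noteq> 0\<close>
  the number \<open>e\<^sup>i\<^sup>t\<close> is not real, hence \<open>I - e\<^sup>i\<^sup>t Q\<close> is invertible and there is a complex \<open>G\<close> in \<open>L\<^sup>2(\<mu>)\<close>
  with \<open>h = G - e\<^sup>i\<^sup>t Q G\<close> (\<open>resolvent_equation\<close>). Summation by parts then turns the Fourier sum into the
  martingale \<open>\<Sum>k. e\<^sup>i\<^sup>k\<^sup>t D\<^sub>k\<close> up to two boundary terms (\<open>fourier_sum_decomposition\<close>). The boundary terms
  are \<open>o(\<surd>n)\<close> almost surely by the ergodic theorem, and orthogonality of the differences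
  gives \<open>\<sigma>\<^sub>t\<^sup>2 = E|D\<^sub>1|\<^sup>2\<close> (\<open>fourier_variance_limit\<close>).

  The martingale is treated under the law started at a point, with a central limit theorem for arrays along
  a Markov chain whose hypotheses are almost sure limits of averages of functions of \<open>\<xi>\<^sub>k\<close>
  (\<open>markov_martingale_clt\<close>). For the projection on a complex direction \<open>\<alpha>\<close> the conditional variance of step \<open>k\<close>
  is half of \<open>|\<alpha>|\<^sup>2 E(|D\<^sub>k|\<^sup>2 | \<xi>\<^bsub>k-1\<^esub>)\<close> plus half of the real part of a multiple of
  \<open>e\<^bsup>2ikt\<^esup> E(D\<^sub>k\<^sup>2 | \<xi>\<^bsub>k-1\<^esub>)\<close>. The first part averages to \<open>|\<alpha>|\<^sup>2 \<sigma>\<^sub>t\<^sup>2 / 2\<close> by the ergodic theorem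
  (\<open>birkhoff\<close>). The second averages to zero (\<open>rotated_average_complex\<close>) because \<open>sin 2t \<noteq> 0\<close>, and this is where
  \<open>\<pi>/2\<close> and \<open>3\<pi>/2\<close> are excluded: a bounded function is again of the form \<open>G - e\<^bsup>2it\<^esup> Q G\<close>, so its rotated sums
  have second moments of order \<open>n\<close>; the general case follows by truncation. The limit variance therefore
  depends on \<open>\<alpha>\<close> only through \<open>|\<alpha>|\<close>, which is what makes the two limit coordinates independent with
  the same law.

  All these almost sure statements are proved for the stationary chain. Its forward part is the mixture
  of the laws \<open>P\<^sup>x\<close> over \<open>\<mu>\<close> (\<open>forward_law\<close>), so they hold under \<open>P\<^sup>x\<close> for almost every \<open>x\<close>
  (\<open>AE_start_law\<close>). Only countably many of them are used, and none depends on \<open>\<alpha>\<close>, so one set of starting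
  points serves every characteristic function argument; \<open>weakly_converges_of_char\<close> turns the
  convergence of characteristic functions into weak convergence in the plane.\<close>

section \<open>Integrals against a mixture of measures\<close>

text \<open>Fubini's theorem for a mixture. In the limit step dominated convergence is used twice, under almost every
  \<open>N x\<close> with bound \<open>2|f|\<close>, and then under \<open>M\<close> with the integrals of
  that bound.\<close>

lemma
  fixes f :: "'b \<Rightarrow> 'c::{banach, second_countable_topology}"
  assumes "prob_space M" and N: "N \<in> M \<rightarrow>\<^sub>M subprob_algebra B"
    and int: "integrable (M \<bind> N) f"
  shows AE_integrable_bind: "AE x in M. integrable (N x) f"
    and integrable_integral_bind: "integrable M (\<lambda>x. \<integral>y. f y \<partial>N x)"
    and integral_bind_iterated: "(\<integral>y. f y \<partial>(M \<bind> N)) = (\<integral>x. \<integral>y. f y \<partial>N x \<partial>M)"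
proof -
  interpret M: prob_space M by fact
  have ne: "space M \<noteq> {}" by (rule M.not_empty)
  have sB: "sets (M \<bind> N) = sets B" by (rule sets_bind_measurable[OF N ne])
  have meas: "g \<in> borel_measurable B" if "integrable (M \<bind> N) g" for g :: "'b \<Rightarrow> 'c"
    using borel_measurable_integrable[OF that] by (simp only: measurable_cong_sets[OF sB refl])
  have Nmeas: "g \<in> borel_measurable (N x)" if "x \<in> space M" "integrable (M \<bind> N) g" for g :: "'b \<Rightarrow> 'c" and x
    using meas[OF that(2)] by (simp only: measurable_cong_sets[OF sets_kernel[OF N that(1)] refl])
  have imeas: "(\<lambda>x. \<integral>y. g y \<partial>N x) \<in> borel_measurable M" if "integrable (M \<bind> N) g" for g :: "'b \<Rightarrow> 'c"
    by (rule measurable_compose[OF N integral_measurable_subprob_algebra[OF meas[OF that]]])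
  have fin: "(\<integral>\<^sup>+x. \<integral>\<^sup>+y. norm (g y) \<partial>N x \<partial>M) < \<infinity>" if "integrable (M \<bind> N) g" for g :: "'b \<Rightarrow> 'c"
  proof -
    have "(\<integral>\<^sup>+x. \<integral>\<^sup>+y. norm (g y) \<partial>N x \<partial>M) = (\<integral>\<^sup>+y. norm (g y) \<partial>(M \<bind> N))"
      by (rule nn_integral_bind[symmetric, OF _ N]) (use meas[OF that] in simp)
    also have "\<dots> < \<infinity>" using that by (simp add: integrable_iff_bounded)
    finally show ?thesis .
  qed
  have AEi: "AE x in M. integrable (N x) g" if g: "integrable (M \<bind> N) g" for g :: "'b \<Rightarrow> 'c"
  proof -
    have "AE x in M. (\<integral>\<^sup>+y. norm (g y) \<partial>N x) \<noteq> \<infinity>"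
      using fin[OF g] meas[OF g]
      by (intro nn_integral_PInf_AE measurable_compose[OF N nn_integral_measurable_subprob_algebra]) auto
    then show ?thesis
      using AE_space
    proof eventually_elim
      case (elim x)
      then show ?case
        using Nmeas[OF _ g] by (intro integrableI_bounded) (auto simp: top.not_eq_extremum)
    qed
  qed
  have iint: "integrable M (\<lambda>x. \<integral>y. g y \<partial>N x)" if g: "integrable (M \<bind> N) g" for g :: "'b \<Rightarrow> 'c"
  proof (rule integrableI_bounded)
    show "(\<lambda>x. \<integral>y. g y \<partial>N x) \<in> borel_measurable M" by (rule imeas[OF g])
    have "(\<integral>\<^sup>+x. norm (\<integral>y. g y \<partial>N x) \<partial>M) \<le> (\<integral>\<^sup>+x. \<integral>\<^sup>+y. norm (g y) \<partial>N x \<partial>M)"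
    proof (rule nn_integral_mono_AE)
      show "AE x in M. ennreal (norm (\<integral>y. g y \<partial>N x)) \<le> (\<integral>\<^sup>+y. norm (g y) \<partial>N x)"
        using AEi[OF g] by eventually_elim (rule integral_norm_bound_ennreal)
    qed
    also have "\<dots> < \<infinity>" by (rule fin[OF g])
    finally show "(\<integral>\<^sup>+x. norm (\<integral>y. g y \<partial>N x) \<partial>M) < \<infinity>" .
  qed
  show "AE x in M. integrable (N x) f" by (rule AEi[OF int])
  show "integrable M (\<lambda>x. \<integral>y. f y \<partial>N x)" by (rule iint[OF int])
  from int show "(\<integral>y. f y \<partial>(M \<bind> N)) = (\<integral>x. \<integral>y. f y \<partial>N x \<partial>M)"
  proof (induct f rule: integrable_induct)
    case (base A c)
    then have A: "A \<in> sets B" by (simp add: sB)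
    have eq: "(\<integral>y. indicator A y *\<^sub>R c \<partial>N x) = measure (N x) A *\<^sub>R c" if "x \<in> space M" for x
    proof -
      interpret Nx: subprob_space "N x" by (rule subprob_space_kernel[OF N that])
      have "A \<in> sets (N x)" "emeasure (N x) A < \<infinity>"
        using A sets_kernel[OF N that] Nx.emeasure_finite[of A] by (simp_all add: less_top[symmetric])
      then show ?thesis by simp
    qed
    have iN: "integrable M (\<lambda>x. measure (N x) A)"
    proof (rule M.integrable_const_bound[where B=1])
      show "AE x in M. norm (measure (N x) A) \<le> 1"
        by (rule AE_I2) (use subprob_space.subprob_measure_le_1[OF subprob_space_kernel[OF N]] in auto)
      show "(\<lambda>x. measure (N x) A) \<in> borel_measurable M"
        by (rule measurable_compose[OF N measurable_measure_subprob_algebra[OF A]])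
    qed
    have "(\<integral>y. indicator A y *\<^sub>R c \<partial>(M \<bind> N)) = measure (M \<bind> N) A *\<^sub>R c"
      using base by simp
    also have "\<dots> = (\<integral>x. measure (N x) A \<partial>M) *\<^sub>R c"
      by (subst M.measure_bind[OF N A]) simp
    also have "\<dots> = (\<integral>x. measure (N x) A *\<^sub>R c \<partial>M)"
      using iN by simp
    also have "\<dots> = (\<integral>x. \<integral>y. indicator A y *\<^sub>R c \<partial>N x \<partial>M)"
      by (rule Bochner_Integration.integral_cong) (auto simp: eq)
    finally show ?case .
  next
    case (add f g)
    have "(\<integral>x. \<integral>y. f y + g y \<partial>N x \<partial>M) = (\<integral>x. (\<integral>y. f y \<partial>N x) + (\<integral>y. g y \<partial>N x) \<partial>M)"
    proof (rule integral_cong_AE)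
      show "AE x in M. (\<integral>y. f y + g y \<partial>N x) = (\<integral>y. f y \<partial>N x) + (\<integral>y. g y \<partial>N x)"
        using AEi[OF add(1)] AEi[OF add(3)] by eventually_elim simp
    qed (use imeas add in \<open>auto intro!: borel_measurable_add\<close>)
    then show ?case using add iint by simp
  next
    case (lim f s)
    have spB: "space (M \<bind> N) = space B" by (rule sets_eq_imp_space_eq[OF sB])
    have "(\<lambda>i. \<integral>y. s i y \<partial>(M \<bind> N)) \<longlonglongrightarrow> (\<integral>y. f y \<partial>(M \<bind> N))"
      by (rule integral_dominated_convergence[where w="\<lambda>x. 2 * norm (f x)"]) (use lim in auto)
    moreover have "(\<lambda>i. \<integral>x. \<integral>y. s i y \<partial>N x \<partial>M) \<longlonglongrightarrow> (\<integral>x. \<integral>y. f y \<partial>N x \<partial>M)"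
    proof (rule integral_dominated_convergence[where w="\<lambda>x. 2 * enn2real (\<integral>\<^sup>+y. norm (f y) \<partial>N x)"])
      show "AE x in M. (\<lambda>i. \<integral>y. s i y \<partial>N x) \<longlonglongrightarrow> (\<integral>y. f y \<partial>N x)"
        using AEi[OF lim(5)] AE_space
      proof eventually_elim
        case (elim x)
        have "space (N x) = space (M \<bind> N)" by (simp add: subprob_measurableD(1)[OF N] elim spB)
        then show ?case
          using elim lim Nmeas[OF elim(2)]
          by (intro integral_dominated_convergence[where w="\<lambda>x. 2 * norm (f x)"]) auto
      qed
      show "AE x in M. norm (\<integral>y. s i y \<partial>N x) \<le> 2 * enn2real (\<integral>\<^sup>+y. norm (f y) \<partial>N x)" for i
        using AEi[OF lim(5)] AEi[OF lim(1), of i] AE_space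
      proof eventually_elim
        case (elim x)
        have sp: "space (N x) = space (M \<bind> N)" by (simp add: subprob_measurableD(1)[OF N] elim spB)
        have "norm (\<integral>y. s i y \<partial>N x) \<le> (\<integral>y. norm (s i y) \<partial>N x)" by (rule integral_norm_bound)
        also have "\<dots> \<le> (\<integral>y. 2 * norm (f y) \<partial>N x)"
          using elim lim(4) sp by (intro integral_mono) auto
        also have "\<dots> = 2 * enn2real (\<integral>\<^sup>+y. norm (f y) \<partial>N x)"
          using elim Nmeas[OF elim(3) lim(5)] by (simp add: integral_eq_nn_integral)
        finally show ?case .
      qed
      show "integrable M (\<lambda>x. 2 * enn2real (\<integral>\<^sup>+y. norm (f y) \<partial>N x))"
      proof (rule integrable_mult_right, rule integrableI_bounded)
        show "(\<lambda>x. enn2real (\<integral>\<^sup>+y. norm (f y) \<partial>N x)) \<in> borel_measurable M"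
          using meas[OF lim(5)]
          by (intro borel_measurable_enn2real measurable_compose[OF N nn_integral_measurable_subprob_algebra]) auto
        have "(\<integral>\<^sup>+x. norm (enn2real (\<integral>\<^sup>+y. norm (f y) \<partial>N x)) \<partial>M) \<le> (\<integral>\<^sup>+x. \<integral>\<^sup>+y. norm (f y) \<partial>N x \<partial>M)"
          by (intro nn_integral_mono) (simp add: ennreal_enn2real_if)
        then show "(\<integral>\<^sup>+x. norm (enn2real (\<integral>\<^sup>+y. norm (f y) \<partial>N x)) \<partial>M) < \<infinity>"
          using fin[OF lim(5)] by (rule le_less_trans)
      qed
    qed (use imeas lim in auto)
    ultimately show ?case using lim(2) by (simp add: LIMSEQ_unique)
  qed
qed

lemma AE_summable_of_integrals:
  fixes a :: "nat \<Rightarrow> 'b \<Rightarrow> real"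
  assumes a_int: "\<And>k. integrable M (a k)" and a_nonneg: "\<And>k x. 0 \<le> a k x"
    and summ: "summable (\<lambda>k. \<integral>x. a k x \<partial>M)"
  shows "AE x in M. summable (\<lambda>k. a k x)"
proof -
  have "(\<integral>\<^sup>+x. (\<Sum>k. ennreal (a k x)) \<partial>M) = (\<Sum>k. \<integral>\<^sup>+x. ennreal (a k x) \<partial>M)"
    using a_int by (intro nn_integral_suminf) auto
  also have "\<dots> = (\<Sum>k. ennreal (\<integral>x. a k x \<partial>M))"
    using a_int a_nonneg by (intro suminf_cong nn_integral_eq_integral) auto
  also have "\<dots> \<noteq> \<infinity>"
    using summ a_nonneg by (subst suminf_ennreal2) (auto intro!: integral_nonneg_AE)
  finally have "AE x in M. (\<Sum>k. ennreal (a k x)) \<noteq> \<infinity>"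
    using a_int by (intro nn_integral_PInf_AE) auto
  then show ?thesis
    by eventually_elim (use a_nonneg in \<open>auto intro!: summable_suminf_not_top\<close>)
qed

section \<open>Markov kernels on square integrable functions\<close>

locale markov_kernel = prob_space \<mu> for \<mu> :: "'a measure" +
  fixes Q :: "'a \<Rightarrow> 'a measure"
  assumes kernel: "Q \<in> \<mu> \<rightarrow>\<^sub>M prob_algebra \<mu>"
begin

lemma kernel_subprob: "Q \<in> \<mu> \<rightarrow>\<^sub>M subprob_algebra \<mu>"
  by (rule measurable_prob_algebraD[OF kernel])

lemma sets_Q: "x \<in> space \<mu> \<Longrightarrow> sets (Q x) = sets \<mu>"
  by (rule sets_kernel[OF kernel_subprob])

lemma space_Q: "x \<in> space \<mu> \<Longrightarrow> space (Q x) = space \<mu>"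
  by (rule sets_eq_imp_space_eq[OF sets_Q])

lemma prob_space_Q: "x \<in> space \<mu> \<Longrightarrow> prob_space (Q x)"
  using measurable_space[OF kernel] by (auto simp: space_prob_algebra)

lemma measurable_Q: "x \<in> space \<mu> \<Longrightarrow> f \<in> \<mu> \<rightarrow>\<^sub>M N \<Longrightarrow> f \<in> Q x \<rightarrow>\<^sub>M N"
  by (simp add: measurable_cong_sets[OF sets_Q refl])

lemma measurable_integral_Q:
  fixes f :: "'a \<Rightarrow> 'c::{banach, second_countable_topology}"
  shows "f \<in> borel_measurable \<mu> \<Longrightarrow> (\<lambda>x. \<integral>y. f y \<partial>Q x) \<in> borel_measurable \<mu>"
  by (rule measurable_compose[OF kernel_subprob integral_measurable_subprob_algebra])

end

locale stationary_kernel = markov_kernel +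
  assumes invariant: "\<mu> \<bind> Q = \<mu>"
begin

text \<open>The mass that \<open>Q x\<close> gives to a null set averages to its mass under the invariant law, which
  is zero.\<close>

lemma AE_Q: "AE x in \<mu>. P x \<Longrightarrow> AE x in \<mu>. AE y in Q x. P y"
proof -
  assume "AE x in \<mu>. P x"
  then obtain N where N: "{x\<in>space \<mu>. \<not> P x} \<subseteq> N" "emeasure \<mu> N = 0" "N \<in> sets \<mu>"
    by (rule AE_E)
  have "AE x in \<mu> \<bind> Q. x \<notin> N"
    using N by (intro AE_not_in) (auto simp: invariant null_sets_def)
  then have "AE x in \<mu>. AE y in Q x. y \<notin> N"
    using N(3) by (subst (asm) AE_bind[OF kernel_subprob]) auto
  then show ?thesis
    using AE_space
  proof eventually_elim
    case (elim x)
    show ?case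
      using elim(1) AE_space by eventually_elim (use N(1) space_Q[OF elim(2)] in auto)
  qed
qed

lemma
  fixes f :: "'a \<Rightarrow> 'c::{banach, second_countable_topology}"
  assumes "integrable \<mu> f"
  shows AE_integrable_Q: "AE x in \<mu>. integrable (Q x) f"
    and integrable_Q: "integrable \<mu> (\<lambda>x. \<integral>y. f y \<partial>Q x)"
    and integral_Q: "(\<integral>x. \<integral>y. f y \<partial>Q x \<partial>\<mu>) = (\<integral>x. f x \<partial>\<mu>)"
  using AE_integrable_bind[OF prob_space_axioms kernel_subprob, of f]
    integrable_integral_bind[OF prob_space_axioms kernel_subprob, of f]
    integral_bind_iterated[OF prob_space_axioms kernel_subprob, of f] assms
  by (simp_all add: invariant)

lemma square_integrableD:
  assumes "square_integrable \<mu> f"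
  shows "f \<in> borel_measurable \<mu>" "integrable \<mu> (\<lambda>x. (f x)\<^sup>2)" "integrable \<mu> f"
  using assms unfolding square_integrable_def by (auto intro: square_integrable_imp_integrable)

lemma integrable_mult_square_integrable:
  assumes "square_integrable \<mu> f" "square_integrable \<mu> g"
  shows "integrable \<mu> (\<lambda>x. f x * g x)"
proof (rule Bochner_Integration.integrable_bound)
  show "integrable \<mu> (\<lambda>x. (f x)\<^sup>2 + (g x)\<^sup>2)"
    using square_integrableD[OF assms(1)] square_integrableD[OF assms(2)] by auto
  show "(\<lambda>x. f x * g x) \<in> borel_measurable \<mu>"
    using square_integrableD[OF assms(1)] square_integrableD[OF assms(2)] by auto
  have "\<bar>a * b\<bar> \<le> a\<^sup>2 + b\<^sup>2" for a b :: real
    using sum_squares_bound[of "\<bar>a\<bar>" "\<bar>b\<bar>"] mult_nonneg_nonneg[of "\<bar>a\<bar>" "\<bar>b\<bar>"]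
    by (simp only: abs_mult power2_abs) linarith
  then show "AE x in \<mu>. norm (f x * g x) \<le> norm ((f x)\<^sup>2 + (g x)\<^sup>2)"
    by (auto intro!: AE_I2)
qed

lemma square_integrable_lincomb:
  assumes "square_integrable \<mu> f" "square_integrable \<mu> g"
  shows "square_integrable \<mu> (\<lambda>x. a * f x + b * g x)"
proof -
  have eq: "(a * f x + b * g x)\<^sup>2 = a\<^sup>2 * (f x)\<^sup>2 + (2 * a * b) * (f x * g x) + b\<^sup>2 * (g x)\<^sup>2" for x
    by (simp add: power2_eq_square algebra_simps)
  show ?thesis
    using square_integrableD[OF assms(1)] square_integrableD[OF assms(2)] integrable_mult_square_integrable[OF assms]
    unfolding square_integrable_def eq by auto
qed

text \<open>The pointwise inequality says that the variance of \<open>f\<close> under \<open>Q x\<close> is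
  nonnegative; integrated against the invariant law it makes \<open>Q\<close> a contraction of
  \<open>L\<^sup>2\<close>.\<close>

lemma square_integrable_Q:
  assumes "square_integrable \<mu> f"
  shows "AE x in \<mu>. integrable (Q x) f \<and> integrable (Q x) (\<lambda>y. (f y)\<^sup>2) \<and>
      (markov_operator Q f x)\<^sup>2 \<le> (\<integral>y. (f y)\<^sup>2 \<partial>Q x)"
    and "square_integrable \<mu> (markov_operator Q f)"
    and "(\<integral>x. (markov_operator Q f x)\<^sup>2 \<partial>\<mu>) \<le> (\<integral>x. (f x)\<^sup>2 \<partial>\<mu>)"
proof -
  note f = square_integrableD[OF assms]
  show *: "AE x in \<mu>. integrable (Q x) f \<and> integrable (Q x) (\<lambda>y. (f y)\<^sup>2) \<and>
      (markov_operator Q f x)\<^sup>2 \<le> (\<integral>y. (f y)\<^sup>2 \<partial>Q x)"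
    using AE_integrable_Q[OF f(2)] AE_integrable_Q[OF f(3)] AE_space
  proof eventually_elim
    case (elim x)
    interpret Qx: prob_space "Q x" by (rule prob_space_Q[OF elim(3)])
    show ?case
      using Qx.variance_positive[of f] elim unfolding markov_operator_def
      by (simp add: Qx.variance_eq)
  qed
  have m: "markov_operator Q f \<in> borel_measurable \<mu>"
    unfolding markov_operator_def[abs_def] by (rule measurable_integral_Q[OF f(1)])
  have i: "integrable \<mu> (\<lambda>x. (markov_operator Q f x)\<^sup>2)"
  proof (rule Bochner_Integration.integrable_bound[OF integrable_Q[OF f(2)]])
    show "(\<lambda>x. (markov_operator Q f x)\<^sup>2) \<in> borel_measurable \<mu>" using m by simp
    show "AE x in \<mu>. norm ((markov_operator Q f x)\<^sup>2) \<le> norm (\<integral>y. (f y)\<^sup>2 \<partial>Q x)"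
      using * by eventually_elim auto
  qed
  show "square_integrable \<mu> (markov_operator Q f)"
    using m i by (simp add: square_integrable_def)
  have "(\<integral>x. (markov_operator Q f x)\<^sup>2 \<partial>\<mu>) \<le> (\<integral>x. \<integral>y. (f y)\<^sup>2 \<partial>Q x \<partial>\<mu>)"
    using * by (intro integral_mono_AE i integrable_Q f(2)) auto
  then show "(\<integral>x. (markov_operator Q f x)\<^sup>2 \<partial>\<mu>) \<le> (\<integral>x. (f x)\<^sup>2 \<partial>\<mu>)"
    by (simp add: integral_Q[OF f(2)])
qed

lemma markov_operator_lincomb:
  assumes "square_integrable \<mu> f" "square_integrable \<mu> g"
  shows "AE x in \<mu>. markov_operator Q (\<lambda>x. a * f x + b * g x) x = a * markov_operator Q f x + b * markov_operator Q g x"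
  using square_integrable_Q(1)[OF assms(1)] square_integrable_Q(1)[OF assms(2)]
  by eventually_elim (simp add: markov_operator_def)

lemma markov_operator_cong_AE:
  assumes "square_integrable \<mu> f" "square_integrable \<mu> g" "AE x in \<mu>. f x = g x"
  shows "AE x in \<mu>. markov_operator Q f x = markov_operator Q g x"
  using AE_Q[OF assms(3)] AE_space
proof eventually_elim
  case (elim x)
  then show ?case
    using measurable_Q[OF elim(2)] square_integrableD(1)[OF assms(1)] square_integrableD(1)[OF assms(2)]
    unfolding markov_operator_def by (intro integral_cong_AE) auto
qed

text \<open>The second conclusion has the form of the hypothesis on the bound, so that the lemma can be applied again
  to pass to the limit in \<open>Q (Q f)\<close>.\<close>

lemma markov_operator_tendsto:
  assumes sq: "\<And>m. square_integrable \<mu> (f m)" "square_integrable \<mu> g" "square_integrable \<mu> u"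
    and bound: "AE x in \<mu>. \<forall>m. \<bar>f m x\<bar> \<le> u x"
    and lim: "AE x in \<mu>. (\<lambda>m. f m x) \<longlonglongrightarrow> g x"
  shows "AE x in \<mu>. (\<lambda>m. markov_operator Q (f m) x) \<longlonglongrightarrow> markov_operator Q g x"
    and "AE x in \<mu>. \<forall>m. \<bar>markov_operator Q (f m) x\<bar> \<le> markov_operator Q u x"
proof -
  have fi: "AE x in \<mu>. \<forall>m. integrable (Q x) (f m)"
    unfolding AE_all_countable using square_integrable_Q(1)[OF sq(1)] by auto
  show "AE x in \<mu>. (\<lambda>m. markov_operator Q (f m) x) \<longlonglongrightarrow> markov_operator Q g x"
    using AE_Q[OF bound] AE_Q[OF lim] square_integrable_Q(1)[OF sq(3)] AE_space
  proof eventually_elim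
    case (elim x)
    show ?case
      unfolding markov_operator_def
    proof (rule integral_dominated_convergence[where w=u])
      show "integrable (Q x) u" using elim by auto
      show "AE y in Q x. norm (f i y) \<le> u y" for i using elim(1) by eventually_elim auto
    qed (use elim measurable_Q[OF elim(4)] sq[THEN square_integrableD(1)] in auto)
  qed
  show "AE x in \<mu>. \<forall>m. \<bar>markov_operator Q (f m) x\<bar> \<le> markov_operator Q u x"
    using AE_Q[OF bound] fi square_integrable_Q(1)[OF sq(3)]
  proof eventually_elim
    case (elim x)
    show ?case
    proof
      fix m
      have "\<bar>\<integral>y. f m y \<partial>Q x\<bar> \<le> (\<integral>y. \<bar>f m y\<bar> \<partial>Q x)" by (rule integral_abs_bound)
      also have "\<dots> \<le> (\<integral>y. u y \<partial>Q x)"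
        using elim by (intro integral_mono_AE) (auto elim: eventually_mono)
      finally show "\<bar>markov_operator Q (f m) x\<bar> \<le> markov_operator Q u x"
        by (simp add: markov_operator_def)
    qed
  qed
qed

end

section \<open>The resolvent of a self-adjoint Markov operator off the real line\<close>

locale reversible_kernel = stationary_kernel +
  assumes reversible: "reversible \<mu> Q"
begin

text \<open>This is \<open>(I - e\<^bsup>i\<tau>\<^esup> Q) (I - e\<^bsup>-i\<tau>\<^esup> Q) f = (I - 2 cos \<tau> Q
  + Q\<^sup>2) f\<close>. The product is an operator on real functions, for which self-adjointness is
  stated, and it is positive.\<close>

definition resolvent_square :: "real \<Rightarrow> ('a \<Rightarrow> real) \<Rightarrow> 'a \<Rightarrow> real" where
  "resolvent_square \<tau> f x = f x - 2 * cos \<tau> * markov_operator Q f x + markov_operator Q (markov_operator Q f) x"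

lemma square_integrable_lincomb3:
  assumes "square_integrable \<mu> f" "square_integrable \<mu> g" "square_integrable \<mu> k"
  shows "square_integrable \<mu> (\<lambda>x. a * f x + b * g x + c * k x)"
  using square_integrable_lincomb[OF square_integrable_lincomb[OF assms(1,2), of a b] assms(3), of 1 c] by simp

lemma square_integrable_resolvent_square:
  assumes "square_integrable \<mu> f"
  shows "square_integrable \<mu> (resolvent_square \<tau> f)"
proof -
  have "square_integrable \<mu> (\<lambda>x. 1 * f x + (- 2 * cos \<tau>) * markov_operator Q f x + 1 * markov_operator Q (markov_operator Q f) x)"
    by (intro square_integrable_lincomb3 square_integrable_Q(2) assms)
  then show ?thesis by (simp add: resolvent_square_def[abs_def])
qed

text \<open>By self-adjointness \<open>\<langle>Q\<^sup>2 f, f\<rangle> = \<parallel>Q f\<parallel>\<^sup>2\<close>,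
  and completing the square gives \<open>\<langle>A f, f\<rangle> = \<parallel>Q f - cos \<tau>
  f\<parallel>\<^sup>2 + sin\<^sup>2 \<tau> \<parallel>f\<parallel>\<^sup>2\<close> for \<open>A =
  resolvent_square \<tau>\<close>.\<close>

lemma resolvent_square_lower:
  assumes f: "square_integrable \<mu> f"
  shows "(sin \<tau>)\<^sup>2 * (\<integral>x. (f x)\<^sup>2 \<partial>\<mu>) \<le> (\<integral>x. resolvent_square \<tau> f x * f x \<partial>\<mu>)"
proof -
  let ?Q = "markov_operator Q"
  have Qf: "square_integrable \<mu> (?Q f)" and QQf: "square_integrable \<mu> (?Q (?Q f))"
    by (intro square_integrable_Q(2) f)+
  note i = integrable_mult_square_integrable
  have ff: "integrable \<mu> (\<lambda>x. (f x)\<^sup>2)" and gg: "integrable \<mu> (\<lambda>x. (?Q f x)\<^sup>2)"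
    using square_integrableD f Qf by auto
  have "(\<integral>x. ?Q (?Q f) x * f x \<partial>\<mu>) = (\<integral>x. ?Q f x * ?Q f x \<partial>\<mu>)"
    using reversible f Qf by (auto simp: reversible_def)
  then have "(\<integral>x. resolvent_square \<tau> f x * f x \<partial>\<mu>) =
      (\<integral>x. (f x)\<^sup>2 \<partial>\<mu>) - 2 * cos \<tau> * (\<integral>x. ?Q f x * f x \<partial>\<mu>) + (\<integral>x. (?Q f x)\<^sup>2 \<partial>\<mu>)"
  proof -
    assume eq: "(\<integral>x. ?Q (?Q f) x * f x \<partial>\<mu>) = (\<integral>x. ?Q f x * ?Q f x \<partial>\<mu>)"
    have "(\<integral>x. resolvent_square \<tau> f x * f x \<partial>\<mu>) =
        (\<integral>x. (f x)\<^sup>2 - 2 * cos \<tau> * (?Q f x * f x) + ?Q (?Q f) x * f x \<partial>\<mu>)"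
      by (simp add: resolvent_square_def power2_eq_square algebra_simps)
    also have "\<dots> = (\<integral>x. (f x)\<^sup>2 \<partial>\<mu>) - 2 * cos \<tau> * (\<integral>x. ?Q f x * f x \<partial>\<mu>) + (\<integral>x. ?Q (?Q f) x * f x \<partial>\<mu>)"
      using i[OF Qf f] i[OF QQf f] ff by simp
    finally show ?thesis using eq by (simp add: power2_eq_square)
  qed
  also have "\<dots> = (sin \<tau>)\<^sup>2 * (\<integral>x. (f x)\<^sup>2 \<partial>\<mu>) + (\<integral>x. (?Q f x - cos \<tau> * f x)\<^sup>2 \<partial>\<mu>)"
  proof -
    have "(\<integral>x. (?Q f x - cos \<tau> * f x)\<^sup>2 \<partial>\<mu>) = (\<integral>x. (?Q f x)\<^sup>2 - 2 * cos \<tau> * (?Q f x * f x) + (cos \<tau>)\<^sup>2 * (f x)\<^sup>2 \<partial>\<mu>)"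
      by (simp add: power2_diff power_mult_distrib algebra_simps)
    also have "\<dots> = (\<integral>x. (?Q f x)\<^sup>2 \<partial>\<mu>) - 2 * cos \<tau> * (\<integral>x. ?Q f x * f x \<partial>\<mu>) + (cos \<tau>)\<^sup>2 * (\<integral>x. (f x)\<^sup>2 \<partial>\<mu>)"
      using i[OF Qf f] ff gg by simp
    finally show ?thesis by (simp add: sin_squared_eq algebra_simps)
  qed
  also have "\<dots> \<ge> (sin \<tau>)\<^sup>2 * (\<integral>x. (f x)\<^sup>2 \<partial>\<mu>)" by simp
  finally show ?thesis .
qed

lemma resolvent_square_upper:
  assumes f: "square_integrable \<mu> f"
  shows "(\<integral>x. (resolvent_square \<tau> f x)\<^sup>2 \<partial>\<mu>) \<le> 16 * (\<integral>x. (f x)\<^sup>2 \<partial>\<mu>)"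
proof -
  let ?Q = "markov_operator Q"
  have Qf: "square_integrable \<mu> (?Q f)" and QQf: "square_integrable \<mu> (?Q (?Q f))"
    by (intro square_integrable_Q(2) f)+
  have le: "(a - 2 * cos \<tau> * b + c)\<^sup>2 \<le> 4 * a\<^sup>2 + 8 * b\<^sup>2 + 4 * c\<^sup>2" for a b c :: real
  proof -
    \<comment> \<open>Cauchy-Schwarz with weights 1, 2, 1.\<close>
    have "(a - 2 * cos \<tau> * b + c)\<^sup>2 \<le> 4 * a\<^sup>2 + 8 * (cos \<tau> * b)\<^sup>2 + 4 * c\<^sup>2"
    proof -
      define d where "d = - cos \<tau> * b"
      have "4 * a\<^sup>2 + 8 * d\<^sup>2 + 4 * c\<^sup>2 - (a + 2 * d + c)\<^sup>2 = 2 * (a - d)\<^sup>2 + 2 * (d - c)\<^sup>2 + (a - c)\<^sup>2"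
        by (simp add: power2_eq_square algebra_simps)
      moreover have "0 \<le> 2 * (a - d)\<^sup>2 + 2 * (d - c)\<^sup>2 + (a - c)\<^sup>2" by simp
      ultimately have "(a + 2 * d + c)\<^sup>2 \<le> 4 * a\<^sup>2 + 8 * d\<^sup>2 + 4 * c\<^sup>2" by linarith
      then show ?thesis by (simp add: d_def power2_eq_square algebra_simps)
    qed
    moreover have "(cos \<tau> * b)\<^sup>2 \<le> b\<^sup>2"
      by (simp add: power_mult_distrib mult_left_le_one_le abs_square_le_1)
    ultimately show ?thesis by linarith
  qed
  have "(\<integral>x. (resolvent_square \<tau> f x)\<^sup>2 \<partial>\<mu>) \<le> (\<integral>x. 4 * (f x)\<^sup>2 + 8 * (?Q f x)\<^sup>2 + 4 * (?Q (?Q f) x)\<^sup>2 \<partial>\<mu>)"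
    using square_integrableD(2)[OF square_integrable_resolvent_square[OF f]]
      f[THEN square_integrableD(2)] Qf[THEN square_integrableD(2)] QQf[THEN square_integrableD(2)]
    by (intro integral_mono) (auto simp: resolvent_square_def le)
  also have "\<dots> = 4 * (\<integral>x. (f x)\<^sup>2 \<partial>\<mu>) + 8 * (\<integral>x. (?Q f x)\<^sup>2 \<partial>\<mu>) + 4 * (\<integral>x. (?Q (?Q f) x)\<^sup>2 \<partial>\<mu>)"
    using f[THEN square_integrableD(2)] Qf[THEN square_integrableD(2)] QQf[THEN square_integrableD(2)] by simp
  also have "\<dots> \<le> 16 * (\<integral>x. (f x)\<^sup>2 \<partial>\<mu>)"
    using square_integrable_Q(3)[OF f] square_integrable_Q(3)[OF Qf] by linarith
  finally show ?thesis .
qed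

lemma resolvent_square_lincomb:
  assumes f: "square_integrable \<mu> f" and g: "square_integrable \<mu> g"
  shows "AE x in \<mu>. resolvent_square \<tau> (\<lambda>x. a * f x + b * g x) x = a * resolvent_square \<tau> f x + b * resolvent_square \<tau> g x"
proof -
  let ?Q = "markov_operator Q"
  have Q1: "AE x in \<mu>. ?Q (\<lambda>x. a * f x + b * g x) x = a * ?Q f x + b * ?Q g x"
    by (rule markov_operator_lincomb[OF f g])
  have "AE x in \<mu>. ?Q (?Q (\<lambda>x. a * f x + b * g x)) x = ?Q (\<lambda>x. a * ?Q f x + b * ?Q g x) x"
    by (rule markov_operator_cong_AE[OF _ _ Q1]) (intro square_integrable_Q(2) square_integrable_lincomb f g)+
  moreover have "AE x in \<mu>. ?Q (\<lambda>x. a * ?Q f x + b * ?Q g x) x = a * ?Q (?Q f) x + b * ?Q (?Q g) x"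
    by (intro markov_operator_lincomb square_integrable_Q(2) f g)
  ultimately show ?thesis
    using Q1 by eventually_elim (simp add: resolvent_square_def algebra_simps)
qed

text \<open>A coercive bounded operator \<open>A\<close> makes \<open>I - c A\<close> a strict contraction for small
  \<open>c\<close>: expanding the square gives the factor \<open>1 - 2 c sin\<^sup>2 \<tau> + 16
  c\<^sup>2\<close>, which \<open>c = sin\<^sup>2 \<tau> / 16\<close> minimises.\<close>

lemma resolvent_square_step_contraction:
  assumes f: "square_integrable \<mu> f" and s: "sin \<tau> \<noteq> 0"
  defines "c \<equiv> (sin \<tau>)\<^sup>2 / 16"
  shows "square_integrable \<mu> (\<lambda>x. f x - c * resolvent_square \<tau> f x)"
    and "(\<integral>x. (f x - c * resolvent_square \<tau> f x)\<^sup>2 \<partial>\<mu>) \<le> (1 - (sin \<tau>)^4 / 16) * (\<integral>x. (f x)\<^sup>2 \<partial>\<mu>)"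
proof -
  have A: "square_integrable \<mu> (resolvent_square \<tau> f)" by (rule square_integrable_resolvent_square[OF f])
  show "square_integrable \<mu> (\<lambda>x. f x - c * resolvent_square \<tau> f x)"
    using square_integrable_lincomb[OF f A, of 1 "-c"] by simp
  have "(\<integral>x. (f x - c * resolvent_square \<tau> f x)\<^sup>2 \<partial>\<mu>) =
    (\<integral>x. (f x)\<^sup>2 - 2 * c * (resolvent_square \<tau> f x * f x) + c\<^sup>2 * (resolvent_square \<tau> f x)\<^sup>2 \<partial>\<mu>)"
    by (simp add: power2_diff power_mult_distrib algebra_simps)
  also have "\<dots> = (\<integral>x. (f x)\<^sup>2 \<partial>\<mu>) - 2 * c * (\<integral>x. resolvent_square \<tau> f x * f x \<partial>\<mu>) + c\<^sup>2 * (\<integral>x. (resolvent_square \<tau> f x)\<^sup>2 \<partial>\<mu>)"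
    using square_integrableD(2)[OF f] square_integrableD(2)[OF A] integrable_mult_square_integrable[OF A f] by simp
  also have "\<dots> \<le> (\<integral>x. (f x)\<^sup>2 \<partial>\<mu>) - 2 * c * ((sin \<tau>)\<^sup>2 * (\<integral>x. (f x)\<^sup>2 \<partial>\<mu>)) + c\<^sup>2 * (16 * (\<integral>x. (f x)\<^sup>2 \<partial>\<mu>))"
    by (intro add_mono diff_mono mult_left_mono resolvent_square_lower resolvent_square_upper f order_refl)
       (auto simp: c_def)
  also have "\<dots> = (1 - (sin \<tau>)^4 / 16) * (\<integral>x. (f x)\<^sup>2 \<partial>\<mu>)"
    by (simp add: c_def power2_eq_square power4_eq_xxxx field_simps)
  finally show "(\<integral>x. (f x - c * resolvent_square \<tau> f x)\<^sup>2 \<partial>\<mu>) \<le> (1 - (sin \<tau>)^4 / 16) * (\<integral>x. (f x)\<^sup>2 \<partial>\<mu>)" .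
qed

text \<open>Completeness of \<open>L\<^sup>2\<close> in the form that is needed below: almost sure convergence of the
  series together with one square integrable bound for all its partial sums. With \<open>\<rho> < r <
  1\<close> the function \<open>W = (\<Sum>k. F\<^sub>k\<^sup>2 / r\<^sup>k)\<close> is integrable, and
  Cauchy-Schwarz with the weights \<open>r\<^sup>k\<close> bounds \<open>(\<Sum>k.
  |F\<^sub>k|)\<^sup>2\<close> by \<open>W / (1 - r)\<close>.\<close>

lemma neumann_series_square_integrable:
  fixes F :: "nat \<Rightarrow> 'a \<Rightarrow> real"
  assumes F: "\<And>k. square_integrable \<mu> (F k)"
    and bound: "\<And>k. (\<integral>x. (F k x)\<^sup>2 \<partial>\<mu>) \<le> \<rho> ^ k * C" and \<rho>: "0 \<le> \<rho>" "\<rho> < 1"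
  obtains U where "square_integrable \<mu> U"
    "AE x in \<mu>. summable (\<lambda>k. F k x) \<and> (\<forall>m. \<bar>\<Sum>k<m. F k x\<bar> \<le> U x)"
proof -
  define r where "r = (1 + \<rho>) / 2"
  have r: "0 < r" "\<rho> < r" "r < 1" using \<rho> by (auto simp: r_def)
  define a where "a k x = (F k x)\<^sup>2 / r ^ k" for k x
  have a_nonneg: "0 \<le> a k x" for k x using r by (simp add: a_def)
  have a_int: "integrable \<mu> (a k)" for k
    unfolding a_def[abs_def] using square_integrableD[OF F] by auto
  have a_bound: "(\<integral>x. a k x \<partial>\<mu>) \<le> (\<rho> / r) ^ k * C" for k
    using bound[of k] r by (simp add: a_def[abs_def] power_divide divide_right_mono)
  have summ: "summable (\<lambda>k. \<integral>x. a k x \<partial>\<mu>)"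
  proof (rule summable_comparison_test[OF exI, rule_format])
    show "norm (\<integral>x. a k x \<partial>\<mu>) \<le> (\<rho> / r) ^ k * C" for k
      using a_bound[of k] by (simp add: a_nonneg)
    show "summable (\<lambda>k. (\<rho> / r) ^ k * C)"
      using r \<rho> by (intro summable_mult2 summable_geometric) simp
  qed
  have a_AE: "AE x in \<mu>. summable (\<lambda>k. a k x)"
    by (rule AE_summable_of_integrals[OF a_int a_nonneg summ])
  define W where "W x = (\<Sum>k. a k x)" for x
  have W_int: "integrable \<mu> W"
    unfolding W_def using a_int a_AE summ a_nonneg
    by (intro integrable_suminf) auto
  \<comment> \<open>The absolute value makes \<open>U\<close> a real square root also where the series diverges.\<close>
  define U where "U x = sqrt (\<bar>W x\<bar> / (1 - r))" for x
  have U_sq: "(U x)\<^sup>2 = \<bar>W x\<bar> / (1 - r)" for x using r by (simp add: U_def)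
  have "square_integrable \<mu> U"
    unfolding square_integrable_def U_sq
    using W_int borel_measurable_integrable[OF W_int] by (auto simp: U_def[abs_def])
  moreover have "AE x in \<mu>. summable (\<lambda>k. F k x) \<and> (\<forall>m. \<bar>\<Sum>k<m. F k x\<bar> \<le> U x)"
    using a_AE
  proof eventually_elim
    case (elim x)
    have abs_bound: "(\<Sum>k<m. \<bar>F k x\<bar>) \<le> U x" for m
    proof -
      have "(\<Sum>k<m. \<bar>F k x\<bar>)\<^sup>2 = (\<Sum>k<m. sqrt r ^ k * (\<bar>F k x\<bar> / sqrt r ^ k))\<^sup>2"
        using r by simp
      also have "\<dots> \<le> (\<Sum>k<m. (sqrt r ^ k)\<^sup>2) * (\<Sum>k<m. (\<bar>F k x\<bar> / sqrt r ^ k)\<^sup>2)"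
        by (rule Cauchy_Schwarz_ineq_sum)
      also have "\<dots> = (\<Sum>k<m. r ^ k) * (\<Sum>k<m. a k x)"
      proof -
        have "(sqrt r ^ k)\<^sup>2 = r ^ k" for k
          using r by (metis power_even_eq power_mult real_sqrt_pow2 less_imp_le mult.commute)
        then show ?thesis by (simp add: a_def power_divide)
      qed
      also have "\<dots> \<le> (1 / (1 - r)) * W x"
      proof (rule mult_mono)
        show "(\<Sum>k<m. r ^ k) \<le> 1 / (1 - r)"
          using r sum_le_suminf[of "\<lambda>k. r ^ k" "{..<m}"] by (simp add: summable_geometric suminf_geometric)
        show "(\<Sum>k<m. a k x) \<le> W x"
          unfolding W_def using elim a_nonneg by (intro sum_le_suminf) auto
      qed (use r a_nonneg in \<open>auto intro!: sum_nonneg\<close>)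
      also have "\<dots> \<le> (U x)\<^sup>2" using r by (simp add: U_sq divide_right_mono)
      finally show ?thesis
        by (rule power2_le_imp_le) (use r in \<open>simp add: U_def\<close>)
    qed
    have "summable (\<lambda>k. \<bar>F k x\<bar>)"
      by (rule summableI_nonneg_bounded[OF _ abs_bound]) simp
    then have "summable (\<lambda>k. F k x)" by (rule summable_rabs_cancel)
    moreover have "\<bar>\<Sum>k<m. F k x\<bar> \<le> U x" for m
      using sum_abs abs_bound by (rule order_trans)
    ultimately show ?case by auto
  qed
  ultimately show ?thesis by (rule that)
qed

text \<open>Neumann series: with \<open>F\<^sub>k = (I - c A)\<^sup>k h\<close> the sum \<open>c A (F\<^sub>0 +
  \<dots> + F\<^bsub>m-1\<^esub>)\<close> telescopes to \<open>h - F\<^sub>m\<close>, and \<open>m\<close>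
  tends to infinity pointwise.\<close>

lemma resolvent_square_surj:
  assumes h: "square_integrable \<mu> h" and s: "sin \<tau> \<noteq> 0"
  obtains g where "square_integrable \<mu> g" "AE x in \<mu>. resolvent_square \<tau> g x = h x"
proof -
  let ?Q = "markov_operator Q" and ?A = "resolvent_square \<tau>"
  define c where "c = (sin \<tau>)\<^sup>2 / 16"
  define B where "B f = (\<lambda>x. f x - c * ?A f x)" for f :: "'a \<Rightarrow> real"
  define F where "F k = (B ^^ k) h" for k
  define \<rho> where "\<rho> = 1 - (sin \<tau>)^4 / 16"
  have c: "c > 0" using s by (simp add: c_def)
  have "(sin \<tau>)^4 \<le> 1"
    using power_mono[of "\<bar>sin \<tau>\<bar>" 1 4] by (simp add: power_even_abs)
  moreover have "(sin \<tau>)^4 > 0" using s by simp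
  ultimately have \<rho>: "0 \<le> \<rho>" "\<rho> < 1" by (auto simp: \<rho>_def)
  have F_Suc: "F (Suc k) = B (F k)" and F_0: "F 0 = h" for k by (simp_all add: F_def)
  have Fsq: "square_integrable \<mu> (F k)" for k
  proof (induction k)
    case (Suc k) then show ?case
      unfolding F_Suc B_def c_def by (rule resolvent_square_step_contraction(1)[OF _ s])
  qed (simp add: F_0 h)
  have Fb: "(\<integral>x. (F k x)\<^sup>2 \<partial>\<mu>) \<le> \<rho> ^ k * (\<integral>x. (h x)\<^sup>2 \<partial>\<mu>)" for k
  proof (induction k)
    case (Suc k)
    have "(\<integral>x. (F (Suc k) x)\<^sup>2 \<partial>\<mu>) \<le> \<rho> * (\<integral>x. (F k x)\<^sup>2 \<partial>\<mu>)"
      unfolding F_Suc B_def c_def \<rho>_def by (rule resolvent_square_step_contraction(2)[OF Fsq s])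
    also have "\<dots> \<le> \<rho> * (\<rho> ^ k * (\<integral>x. (h x)\<^sup>2 \<partial>\<mu>))" by (rule mult_left_mono[OF Suc \<rho>(1)])
    finally show ?case by (simp add: mult.assoc)
  qed (simp add: F_0)
  obtain U where U: "square_integrable \<mu> U"
    and FU: "AE x in \<mu>. summable (\<lambda>k. F k x) \<and> (\<forall>m. \<bar>\<Sum>k<m. F k x\<bar> \<le> U x)"
    by (rule neumann_series_square_integrable[OF Fsq Fb \<rho>])
  define S where "S m x = (\<Sum>k<m. F k x)" for m x
  define g where "g x = (\<Sum>k. F k x)" for x
  have S_Suc: "S (Suc m) = (\<lambda>x. 1 * S m x + 1 * F m x)" for m by (auto simp: S_def)
  have Ssq: "square_integrable \<mu> (S m)" for m
  proof (induction m)
    case 0 then show ?case by (simp add: S_def[abs_def] square_integrable_def)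
  next
    case (Suc m) then show ?case unfolding S_Suc by (rule square_integrable_lincomb[OF _ Fsq])
  qed
  have bound: "AE x in \<mu>. \<forall>m. \<bar>S m x\<bar> \<le> U x" using FU by eventually_elim (auto simp: S_def)
  have lim: "AE x in \<mu>. (\<lambda>m. S m x) \<longlonglongrightarrow> g x"
    using FU by eventually_elim (auto simp: S_def g_def intro: summable_LIMSEQ)
  have gsq: "square_integrable \<mu> g"
    unfolding square_integrable_def
  proof (intro conjI)
    show gm: "g \<in> borel_measurable \<mu>"
      unfolding g_def[abs_def] using Fsq[THEN square_integrableD(1)] by measurable
    show "integrable \<mu> (\<lambda>x. (g x)\<^sup>2)"
    proof (rule Bochner_Integration.integrable_bound[OF square_integrableD(2)[OF U]])
      show "AE x in \<mu>. norm ((g x)\<^sup>2) \<le> norm ((U x)\<^sup>2)"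
        using bound lim
      proof eventually_elim
        case (elim x)
        have "\<bar>g x\<bar> \<le> U x"
          by (rule LIMSEQ_le_const2[OF tendsto_rabs[OF elim(2)]]) (use elim(1) in auto)
        then have "\<bar>g x\<bar>\<^sup>2 \<le> (U x)\<^sup>2" by (intro power_mono) auto
        then show ?case by simp
      qed
    qed (use gm in simp)
  qed
  have A_S: "AE x in \<mu>. c * ?A (S m) x = h x - F m x" for m
  proof (induction m)
    case 0
    have "?A (S 0) = (\<lambda>x. 0)"
      by (rule ext) (simp add: S_def[abs_def] resolvent_square_def markov_operator_def[abs_def])
    then show ?case by (simp add: F_0)
  next
    case (Suc m)
    show ?case
      using resolvent_square_lincomb[OF Ssq[of m] Fsq[of m], of \<tau> 1 1] Suc
      unfolding S_Suc F_Suc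
    proof eventually_elim
      case (elim x)
      have "c * ?A (\<lambda>x. 1 * S m x + 1 * F m x) x = c * ?A (S m) x + c * ?A (F m) x"
        unfolding elim(1) by (simp add: algebra_simps)
      then show ?case using elim(2) by (simp add: B_def)
    qed
  qed
  have Q1: "AE x in \<mu>. (\<lambda>m. ?Q (S m) x) \<longlonglongrightarrow> ?Q g x" "AE x in \<mu>. \<forall>m. \<bar>?Q (S m) x\<bar> \<le> ?Q U x"
    by (rule markov_operator_tendsto[OF Ssq gsq U bound lim])+
  have Q2: "AE x in \<mu>. (\<lambda>m. ?Q (?Q (S m)) x) \<longlonglongrightarrow> ?Q (?Q g) x"
    by (rule markov_operator_tendsto(1)[OF _ _ _ Q1(2,1)]) (intro square_integrable_Q(2) Ssq gsq U)+
  have "AE x in \<mu>. c * ?A g x = h x"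
  proof -
    have "AE x in \<mu>. \<forall>m. c * ?A (S m) x = h x - F m x"
      unfolding AE_all_countable using A_S by blast
    then show ?thesis
      using Q1(1) Q2 lim FU
    proof eventually_elim
      case (elim x)
      have "(\<lambda>m. c * ?A (S m) x) \<longlonglongrightarrow> c * ?A g x"
        unfolding resolvent_square_def by (intro tendsto_intros elim)
      moreover have "(\<lambda>m. h x - F m x) \<longlonglongrightarrow> h x - 0"
        using elim(5) by (intro tendsto_diff tendsto_const summable_LIMSEQ_zero) auto
      ultimately show ?case using elim(1) LIMSEQ_unique by fastforce
    qed
  qed
  moreover have "AE x in \<mu>. ?A (\<lambda>x. c * g x + 0 * g x) x = c * ?A g x + 0 * ?A g x"
    by (rule resolvent_square_lincomb[OF gsq gsq])
  ultimately have "AE x in \<mu>. ?A (\<lambda>x. c * g x + 0 * g x) x = h x"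
    by eventually_elim simp
  with square_integrable_lincomb[OF gsq gsq, of c 0] show ?thesis by (rule that)
qed

text \<open>If \<open>A g = h\<close>, then \<open>G = (I - e\<^bsup>-i\<tau>\<^esup> Q) g\<close> solves the
  equation. Its real and imaginary parts are \<open>g1\<close> and \<open>g2\<close>.\<close>

proposition resolvent_equation:
  assumes h: "square_integrable \<mu> h" and s: "sin \<tau> \<noteq> 0"
  obtains G :: "'a \<Rightarrow> complex" where "G \<in> borel_measurable \<mu>" "integrable \<mu> (\<lambda>x. (cmod (G x))\<^sup>2)"
    "AE x in \<mu>. complex_of_real (h x) = G x - cis \<tau> * (\<integral>y. G y \<partial>Q x)"
proof -
  let ?Q = "markov_operator Q"
  obtain g where g: "square_integrable \<mu> g" and eq: "AE x in \<mu>. resolvent_square \<tau> g x = h x"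
    by (rule resolvent_square_surj[OF h s])
  have Qg: "square_integrable \<mu> (?Q g)" by (rule square_integrable_Q(2)[OF g])
  define g1 where "g1 = (\<lambda>x. 1 * g x + (- cos \<tau>) * ?Q g x)"
  define g2 where "g2 = (\<lambda>x. sin \<tau> * ?Q g x + 0 * g x)"
  define G where "G x = complex_of_real (g1 x) + \<i> * complex_of_real (g2 x)" for x
  have g1: "square_integrable \<mu> g1" and g2: "square_integrable \<mu> g2"
    unfolding g1_def g2_def by (intro square_integrable_lincomb g Qg)+
  have Q1: "AE x in \<mu>. ?Q g1 x = 1 * ?Q g x + (- cos \<tau>) * ?Q (?Q g) x"
    and Q2: "AE x in \<mu>. ?Q g2 x = sin \<tau> * ?Q (?Q g) x + 0 * ?Q g x"
    unfolding g1_def g2_def by (intro markov_operator_lincomb g Qg)+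
  show ?thesis
  proof (rule that[of G])
    show m: "G \<in> borel_measurable \<mu>"
      unfolding G_def[abs_def] using square_integrableD(1)[OF g1] square_integrableD(1)[OF g2] by measurable
    have "(cmod (G x))\<^sup>2 = (g1 x)\<^sup>2 + (g2 x)\<^sup>2" for x by (simp add: G_def cmod_power2)
    then show "integrable \<mu> (\<lambda>x. (cmod (G x))\<^sup>2)"
      using square_integrableD(2)[OF g1] square_integrableD(2)[OF g2] by simp
    show "AE x in \<mu>. complex_of_real (h x) = G x - cis \<tau> * (\<integral>y. G y \<partial>Q x)"
      using Q1 Q2 eq square_integrable_Q(1)[OF g1] square_integrable_Q(1)[OF g2]
    proof eventually_elim
      case (elim x)
      have algebra: "complex_of_real H = (complex_of_real (a - C * b) + \<i> * complex_of_real (S * b)) -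
          Complex C S * (complex_of_real (b - C * d) + \<i> * complex_of_real (S * d))"
        if "H = a - 2 * C * b + (C * C + S * S) * d" for H a b d C S :: real
        using that by (simp add: complex_eq_iff algebra_simps)
      have "h x = g x - 2 * cos \<tau> * ?Q g x + (cos \<tau> * cos \<tau> + sin \<tau> * sin \<tau>) * ?Q (?Q g) x"
        using elim(3) by (simp add: resolvent_square_def flip: power2_eq_square)
      note algebra[OF this]
      moreover have "(\<integral>y. G y \<partial>Q x) = complex_of_real (?Q g1 x) + \<i> * complex_of_real (?Q g2 x)"
        unfolding G_def markov_operator_def using elim(4,5) by simp
      moreover have "?Q g1 x = ?Q g x - cos \<tau> * ?Q (?Q g) x" "?Q g2 x = sin \<tau> * ?Q (?Q g) x"
        using elim(1,2) by simp_all
      moreover have "G x = complex_of_real (g x - cos \<tau> * ?Q g x) + \<i> * complex_of_real (sin \<tau> * ?Q g x)"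
        by (simp add: G_def g1_def g2_def)
      moreover have "cis \<tau> = Complex (cos \<tau>) (sin \<tau>)" by (rule cis.code)
      ultimately show ?case by (simp only:)
    qed
  qed
qed

end

section \<open>Markov laws on path space\<close>

text \<open>Freezing a path at time \<open>n\<close> maps path space to itself, so a functional depends on the
  coordinates up to \<open>n\<close> only if it is unchanged by composition with this map. This replaces
  products over initial segments.\<close>

definition stopped_path :: "nat \<Rightarrow> (nat \<Rightarrow> 'a) \<Rightarrow> nat \<Rightarrow> 'a" where
  "stopped_path n \<omega> = (\<lambda>i. \<omega> (min i n))"

context markov_kernel begin

abbreviation path_space :: "(nat \<Rightarrow> 'a) measure" where
  "path_space \<equiv> \<Pi>\<^sub>M i\<in>UNIV. \<mu>"

lemma stopped_path_measurable: "stopped_path n \<in> path_space \<rightarrow>\<^sub>M path_space"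
  unfolding stopped_path_def[abs_def] by (rule measurable_PiM_single') (auto simp: space_PiM)

lemma fun_upd_path_measurable: "(\<lambda>(\<omega>, s). fun_upd \<omega> n s) \<in> path_space \<Otimes>\<^sub>M \<mu> \<rightarrow>\<^sub>M path_space"
  unfolding split_beta' by (rule measurable_fun_upd[where J=UNIV]) auto

lemma fun_upd_path_measurable': "\<omega> \<in> space path_space \<Longrightarrow> (\<lambda>s. fun_upd \<omega> n s) \<in> \<mu> \<rightarrow>\<^sub>M path_space"
  using measurable_compose_Pair1[OF _ fun_upd_path_measurable] by simp

text \<open>The path \<open>\<omega>\<close> with its coordinate at time \<open>n + 1\<close> drawn anew from \<open>Q
  (\<omega> n)\<close>.\<close>

definition refresh :: "nat \<Rightarrow> (nat \<Rightarrow> 'a) \<Rightarrow> (nat \<Rightarrow> 'a) measure" where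
  "refresh n \<omega> = distr (Q (\<omega> n)) path_space (\<lambda>s. fun_upd \<omega> (Suc n) s)"

lemma refresh_kernel: "refresh n \<in> path_space \<rightarrow>\<^sub>M prob_algebra path_space"
  unfolding refresh_def
proof (rule measurable_distr_prob_space2)
  show "(\<lambda>\<omega>. Q (\<omega> n)) \<in> path_space \<rightarrow>\<^sub>M prob_algebra \<mu>"
    using measurable_component_singleton[of n UNIV "\<lambda>_. \<mu>"] kernel by (auto intro: measurable_compose)
  show "(\<lambda>(\<omega>, s). fun_upd \<omega> (Suc n) s) \<in> path_space \<Otimes>\<^sub>M \<mu> \<rightarrow>\<^sub>M path_space"
    by (rule fun_upd_path_measurable)
qed

lemma path_component_space: "\<omega> \<in> space path_space \<Longrightarrow> \<omega> n \<in> space \<mu>"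
  by (auto simp: space_PiM)

lemma
  fixes G :: "_ \<Rightarrow> 'c::{banach, second_countable_topology}"
  assumes "\<omega> \<in> space path_space"
  shows integral_refresh: "G \<in> borel_measurable path_space \<Longrightarrow>
      (\<integral>\<eta>. G \<eta> \<partial>refresh n \<omega>) = (\<integral>s. G (fun_upd \<omega> (Suc n) s) \<partial>Q (\<omega> n))"
    and nn_integral_refresh: "H \<in> borel_measurable path_space \<Longrightarrow>
      (\<integral>\<^sup>+\<eta>. H \<eta> \<partial>refresh n \<omega>) = (\<integral>\<^sup>+s. H (fun_upd \<omega> (Suc n) s) \<partial>Q (\<omega> n))"
  unfolding refresh_def
  using measurable_Q[OF path_component_space[OF assms] fun_upd_path_measurable'[OF assms]]
  by (simp_all add: integral_distr nn_integral_distr)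

text \<open>The Markov property: drawing the coordinate at time \<open>n + 1\<close> anew does not change the law of
  the path up to that time. The initial law is left open, so that the chains started at a point and the
  stationary chain are both covered.\<close>

definition markov_law :: "(nat \<Rightarrow> 'a) measure \<Rightarrow> bool" where
  "markov_law M \<longleftrightarrow> prob_space M \<and> sets M = sets path_space \<and>
     (\<forall>n. distr M path_space (stopped_path (Suc n)) = distr (M \<bind> refresh n) path_space (stopped_path (Suc n)))"

lemma markov_lawD:
  assumes "markov_law M"
  shows "prob_space M" "sets M = sets path_space" "space M = space path_space"
    "sets (M \<bind> refresh n) = sets path_space"
    "refresh n \<in> M \<rightarrow>\<^sub>M subprob_algebra path_space"
proof -
  show p: "prob_space M" and s: "sets M = sets path_space" using assms by (auto simp: markov_law_def)
  show "space M = space path_space" by (rule sets_eq_imp_space_eq[OF s])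
  show r: "refresh n \<in> M \<rightarrow>\<^sub>M subprob_algebra path_space"
    using measurable_prob_algebraD[OF refresh_kernel, of n] by (simp add: measurable_cong_sets[OF s refl])
  show "sets (M \<bind> refresh n) = sets path_space"
    by (rule sets_bind_measurable[OF r prob_space.not_empty[OF p]])
qed

lemma markov_law_measurable: "markov_law M \<Longrightarrow> f \<in> path_space \<rightarrow>\<^sub>M N \<Longrightarrow> f \<in> M \<rightarrow>\<^sub>M N"
  by (simp add: measurable_cong_sets[OF markov_lawD(2) refl])

lemma
  fixes G :: "_ \<Rightarrow> 'c::{banach, second_countable_topology}"
  assumes M: "markov_law M"
  shows markov_law_nn_integral:
    "H \<in> borel_measurable path_space \<Longrightarrow> (\<And>\<omega>. \<omega> \<in> space path_space \<Longrightarrow> H (stopped_path (Suc n) \<omega>) = H \<omega>) \<Longrightarrow>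
      (\<integral>\<^sup>+\<omega>. H \<omega> \<partial>M) = (\<integral>\<^sup>+\<omega>. \<integral>\<^sup>+s. H (fun_upd \<omega> (Suc n) s) \<partial>Q (\<omega> n) \<partial>M)"
    and markov_law_integral:
    "integrable M G \<Longrightarrow> (\<And>\<omega>. \<omega> \<in> space path_space \<Longrightarrow> G (stopped_path (Suc n) \<omega>) = G \<omega>) \<Longrightarrow>
      (\<integral>\<omega>. G \<omega> \<partial>M) = (\<integral>\<omega>. \<integral>s. G (fun_upd \<omega> (Suc n) s) \<partial>Q (\<omega> n) \<partial>M)"
proof -
  note d = markov_lawD[OF M]
  let ?R = "M \<bind> refresh n"
  have sR: "sets ?R = sets path_space" by (rule d(4))
  have spR: "space ?R = space path_space" by (rule sets_eq_imp_space_eq[OF sR])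
  have stM: "stopped_path (Suc n) \<in> M \<rightarrow>\<^sub>M path_space" and stR: "stopped_path (Suc n) \<in> ?R \<rightarrow>\<^sub>M path_space"
    using stopped_path_measurable by (simp_all add: measurable_cong_sets[OF d(2) refl] measurable_cong_sets[OF sR refl])
  have eq: "distr M path_space (stopped_path (Suc n)) = distr ?R path_space (stopped_path (Suc n))"
    using M by (simp add: markov_law_def)
  {
    fix H :: "(nat \<Rightarrow> 'a) \<Rightarrow> ennreal"
    assume H: "H \<in> borel_measurable path_space" and st: "\<And>\<omega>. \<omega> \<in> space path_space \<Longrightarrow> H (stopped_path (Suc n) \<omega>) = H \<omega>"
    have "(\<integral>\<^sup>+\<omega>. H \<omega> \<partial>M) = (\<integral>\<^sup>+\<omega>. H (stopped_path (Suc n) \<omega>) \<partial>M)"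
      by (intro nn_integral_cong) (simp add: st d)
    also have "\<dots> = (\<integral>\<^sup>+\<omega>. H \<omega> \<partial>distr M path_space (stopped_path (Suc n)))"
      by (rule nn_integral_distr[symmetric, OF stM]) (simp add: H)
    also have "\<dots> = (\<integral>\<^sup>+\<omega>. H (stopped_path (Suc n) \<omega>) \<partial>?R)"
      unfolding eq by (rule nn_integral_distr[OF stR]) (simp add: H)
    also have "\<dots> = (\<integral>\<^sup>+\<omega>. H \<omega> \<partial>?R)"
      by (intro nn_integral_cong) (simp add: st spR)
    also have "\<dots> = (\<integral>\<^sup>+\<omega>. \<integral>\<^sup>+\<eta>. H \<eta> \<partial>refresh n \<omega> \<partial>M)"
      by (rule nn_integral_bind[OF H d(5)])
    also have "\<dots> = (\<integral>\<^sup>+\<omega>. \<integral>\<^sup>+s. H (fun_upd \<omega> (Suc n) s) \<partial>Q (\<omega> n) \<partial>M)"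
      by (intro nn_integral_cong nn_integral_refresh H) (simp add: d)
    finally show "(\<integral>\<^sup>+\<omega>. H \<omega> \<partial>M) = (\<integral>\<^sup>+\<omega>. \<integral>\<^sup>+s. H (fun_upd \<omega> (Suc n) s) \<partial>Q (\<omega> n) \<partial>M)" .
  next
    fix G :: "(nat \<Rightarrow> 'a) \<Rightarrow> 'c"
    assume int: "integrable M G" and st: "\<And>\<omega>. \<omega> \<in> space path_space \<Longrightarrow> G (stopped_path (Suc n) \<omega>) = G \<omega>"
    have G: "G \<in> borel_measurable path_space"
      using borel_measurable_integrable[OF int] by (simp add: measurable_cong_sets[OF d(2) refl])
    have GM: "G \<in> borel_measurable M" and GR: "G \<in> borel_measurable ?R"
      using G by (simp_all add: measurable_cong_sets[OF d(2) refl] measurable_cong_sets[OF sR refl])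
    have cM: "integrable M G \<longleftrightarrow> integrable M (\<lambda>\<omega>. G (stopped_path (Suc n) \<omega>))"
      by (intro Bochner_Integration.integrable_cong) (simp_all add: st d)
    have cR: "integrable ?R G \<longleftrightarrow> integrable ?R (\<lambda>\<omega>. G (stopped_path (Suc n) \<omega>))"
      by (intro Bochner_Integration.integrable_cong) (simp_all add: st spR)
    have intR: "integrable ?R G"
      using int unfolding cM cR
      by (simp add: integrable_distr_eq[OF stM G, symmetric] integrable_distr_eq[OF stR G, symmetric] eq)
    have "(\<integral>\<omega>. G \<omega> \<partial>M) = (\<integral>\<omega>. G (stopped_path (Suc n) \<omega>) \<partial>M)"
      by (intro Bochner_Integration.integral_cong) (simp_all add: st d)
    also have "\<dots> = (\<integral>\<omega>. G \<omega> \<partial>distr M path_space (stopped_path (Suc n)))"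
      by (rule integral_distr[symmetric, OF stM G])
    also have "\<dots> = (\<integral>\<omega>. G (stopped_path (Suc n) \<omega>) \<partial>?R)"
      unfolding eq by (rule integral_distr[OF stR G])
    also have "\<dots> = (\<integral>\<omega>. G \<omega> \<partial>?R)"
      by (intro Bochner_Integration.integral_cong) (simp_all add: st spR)
    also have "\<dots> = (\<integral>\<omega>. \<integral>\<eta>. G \<eta> \<partial>refresh n \<omega> \<partial>M)"
      by (rule integral_bind_iterated[OF d(1,5) intR])
    also have "\<dots> = (\<integral>\<omega>. \<integral>s. G (fun_upd \<omega> (Suc n) s) \<partial>Q (\<omega> n) \<partial>M)"
      by (intro Bochner_Integration.integral_cong integral_refresh G) (simp_all add: d)
    finally show "(\<integral>\<omega>. G \<omega> \<partial>M) = (\<integral>\<omega>. \<integral>s. G (fun_upd \<omega> (Suc n) s) \<partial>Q (\<omega> n) \<partial>M)" .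
  }
qed

lemma markov_lawI:
  assumes "prob_space M" and s: "sets M = sets path_space"
    and step: "\<And>n H. H \<in> borel_measurable path_space \<Longrightarrow> (\<And>\<omega>. H (stopped_path (Suc n) \<omega>) = H \<omega>) \<Longrightarrow>
      (\<integral>\<^sup>+\<omega>. H \<omega> \<partial>M) = (\<integral>\<^sup>+\<omega>. \<integral>\<^sup>+s. H (fun_upd \<omega> (Suc n) s) \<partial>Q (\<omega> n) \<partial>M)"
  shows "markov_law M"
  unfolding markov_law_def
proof (intro conjI allI measure_eqI)
  fix n X
  assume "X \<in> sets (distr M path_space (stopped_path (Suc n)))"
  then have X: "X \<in> sets path_space" by simp
  have sp: "space M = space path_space" by (rule sets_eq_imp_space_eq[OF s])
  have r: "refresh n \<in> M \<rightarrow>\<^sub>M subprob_algebra path_space"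
    using measurable_prob_algebraD[OF refresh_kernel, of n] by (simp add: measurable_cong_sets[OF s refl])
  let ?R = "M \<bind> refresh n"
  have sR: "sets ?R = sets path_space"
    by (rule sets_bind_measurable[OF r prob_space.not_empty[OF assms(1)]])
  define H where "H \<omega> = (indicator X (stopped_path (Suc n) \<omega>) :: ennreal)" for \<omega>
  have stM: "stopped_path (Suc n) \<in> M \<rightarrow>\<^sub>M path_space" and stR: "stopped_path (Suc n) \<in> ?R \<rightarrow>\<^sub>M path_space"
    using stopped_path_measurable by (simp_all add: measurable_cong_sets[OF s refl] measurable_cong_sets[OF sR refl])
  have Hm: "H \<in> borel_measurable path_space"
    unfolding H_def[abs_def] by (rule measurable_compose[OF stopped_path_measurable]) (use X in simp)
  have "emeasure (distr M path_space (stopped_path (Suc n))) X = (\<integral>\<^sup>+\<omega>. indicator X \<omega> \<partial>distr M path_space (stopped_path (Suc n)))"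
    using X by simp
  also have "\<dots> = (\<integral>\<^sup>+\<omega>. H \<omega> \<partial>M)"
    unfolding H_def using X by (intro nn_integral_distr stM) simp
  also have "\<dots> = (\<integral>\<^sup>+\<omega>. \<integral>\<^sup>+s. H (fun_upd \<omega> (Suc n) s) \<partial>Q (\<omega> n) \<partial>M)"
    by (rule step[OF Hm]) (simp add: H_def stopped_path_def)
  also have "\<dots> = (\<integral>\<^sup>+\<omega>. \<integral>\<^sup>+\<eta>. H \<eta> \<partial>refresh n \<omega> \<partial>M)"
    by (intro nn_integral_cong nn_integral_refresh[symmetric] Hm) (simp add: sp)
  also have "\<dots> = (\<integral>\<^sup>+\<eta>. H \<eta> \<partial>?R)"
    by (rule nn_integral_bind[symmetric, OF Hm r])
  also have "\<dots> = (\<integral>\<^sup>+\<omega>. indicator X \<omega> \<partial>distr ?R path_space (stopped_path (Suc n)))"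
    unfolding H_def using X by (intro nn_integral_distr[symmetric] stR) simp
  also have "\<dots> = emeasure (distr ?R path_space (stopped_path (Suc n))) X"
    using X by simp
  finally show "emeasure (distr M path_space (stopped_path (Suc n))) X =
    emeasure (distr ?R path_space (stopped_path (Suc n))) X" .
qed (use assms in simp_all)

text \<open>The finite-dimensional laws \<open>IT.C\<close> of the Ionescu-Tulcea construction arise by adding one
  coordinate drawn from the kernel, which is the drawing in \<open>markov_law\<close>; \<open>proj\<close>
  identifies them with projections of the limit.\<close>

lemma
  assumes x: "x \<in> space \<mu>"
  shows chain_from_markov: "markov_law (chain_from \<mu> Q x)"
    and chain_from_start: "f \<in> borel_measurable \<mu> \<Longrightarrow> (\<integral>\<^sup>+\<omega>. f (\<omega> 0) \<partial>chain_from \<mu> Q x) = f x"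
proof -
  interpret IT: Ionescu_Tulcea "chain_step \<mu> Q x" "\<lambda>_. \<mu>"
    by (rule Ionescu_Tulcea_chain_step[OF kernel x])
  let ?L = "chain_from \<mu> Q x"
  have L: "?L = IT.PF.lim" by (simp add: chain_from_def)
  have sL: "sets ?L = sets path_space" by (simp add: L)
  have spL: "space ?L = space path_space" by (simp add: L)
  have proj: "distr ?L (\<Pi>\<^sub>M i\<in>{0..<m}. \<mu>) (\<lambda>\<omega>. restrict \<omega> {0..<m}) = IT.C 0 m (\<lambda>_. undefined)" for m
  proof (rule measure_eqI)
    show sC: "sets (distr ?L (\<Pi>\<^sub>M i\<in>{0..<m}. \<mu>) (\<lambda>\<omega>. restrict \<omega> {0..<m})) = sets (IT.C 0 m (\<lambda>_. undefined))"
      by (simp add: IT.sets_C)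
    fix X assume "X \<in> sets (distr ?L (\<Pi>\<^sub>M i\<in>{0..<m}. \<mu>) (\<lambda>\<omega>. restrict \<omega> {0..<m}))"
    then have X: "X \<in> sets (\<Pi>\<^sub>M i\<in>{0..<m}. \<mu>)" by simp
    have "emeasure (distr ?L (\<Pi>\<^sub>M i\<in>{0..<m}. \<mu>) (\<lambda>\<omega>. restrict \<omega> {0..<m})) X = emeasure (IT.CI {0..<m}) X"
      unfolding L by (subst IT.distr_lim) auto
    also have "\<dots> = emeasure (IT.C 0 m (\<lambda>_. undefined)) (IT.PF.emb {0..<m} {0..<m} X)"
      by (rule IT.emeasure_CI[OF order_refl X])
    also have "IT.PF.emb {0..<m} {0..<m} X = X"
      using sets.sets_into_space[OF X] by (intro prod_emb_id) (simp add: space_PiM)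
    finally show "emeasure (distr ?L (\<Pi>\<^sub>M i\<in>{0..<m}. \<mu>) (\<lambda>\<omega>. restrict \<omega> {0..<m})) X =
        emeasure (IT.C 0 m (\<lambda>_. undefined)) X" .
  qed
  have restr: "(\<lambda>\<omega>. restrict \<omega> {0..<m}) \<in> ?L \<rightarrow>\<^sub>M (\<Pi>\<^sub>M i\<in>{0..<m}. \<mu>)" for m
    by (subst measurable_cong_sets[OF sL refl]) (auto intro!: measurable_restrict)
  have u: "(\<lambda>_. undefined) \<in> space (\<Pi>\<^sub>M i\<in>{0..<0::nat}. \<mu>)" by (auto simp: space_PiM PiE_iff extensional_def)
  have nn_proj: "(\<integral>\<^sup>+\<omega>. F (restrict \<omega> {0..<m}) \<partial>?L) = (\<integral>\<^sup>+\<eta>. F \<eta> \<partial>IT.C 0 m (\<lambda>_. undefined))"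
    if "F \<in> borel_measurable (\<Pi>\<^sub>M i\<in>{0..<m}. \<mu>)" for F m
    using that unfolding proj[symmetric] by (intro nn_integral_distr[symmetric] restr) auto
  have nn_C: "(\<integral>\<^sup>+\<eta>. F \<eta> \<partial>IT.C 0 (Suc m) (\<lambda>_. undefined)) =
      (\<integral>\<^sup>+\<eta>. \<integral>\<^sup>+s. F (fun_upd \<eta> m s) \<partial>chain_step \<mu> Q x m \<eta> \<partial>IT.C 0 m (\<lambda>_. undefined))"
    if F: "F \<in> borel_measurable (\<Pi>\<^sub>M i\<in>{0..<Suc m}. \<mu>)" for F m
  proof -
    have "(\<integral>\<^sup>+\<eta>. F \<eta> \<partial>IT.C 0 (Suc m) (\<lambda>_. undefined)) =
        (\<integral>\<^sup>+\<eta>. \<integral>\<^sup>+\<zeta>. F \<zeta> \<partial>IT.eP m \<eta> \<partial>IT.C 0 m (\<lambda>_. undefined))"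
    proof -
      have "IT.eP m \<in> IT.C 0 m (\<lambda>_. undefined) \<rightarrow>\<^sub>M subprob_algebra (\<Pi>\<^sub>M i\<in>{0..<Suc m}. \<mu>)"
        using IT.measurable_eP[of m] by (subst measurable_cong_sets[OF IT.sets_C[OF u] refl]) simp
      from nn_integral_bind[OF F this] show ?thesis by simp
    qed
    also have "\<dots> = (\<integral>\<^sup>+\<eta>. \<integral>\<^sup>+s. F (fun_upd \<eta> m s) \<partial>chain_step \<mu> Q x m \<eta> \<partial>IT.C 0 m (\<lambda>_. undefined))"
      using IT.space_C[OF u, of m] by (intro nn_integral_cong IT.nn_integral_eP F) simp
    finally show ?thesis .
  qed
  have prob: "prob_space ?L"
    by (rule prob_space_distrD[OF restr[of 0]]) (simp only: proj IT.prob_space_C[OF u])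
  show "markov_law ?L"
  proof (rule markov_lawI[OF prob sL])
    fix n and H :: "(nat \<Rightarrow> 'a) \<Rightarrow> ennreal"
    assume H: "H \<in> borel_measurable path_space" and st: "\<And>\<omega>. H (stopped_path (Suc n) \<omega>) = H \<omega>"
    \<comment> \<open>\<open>F\<close> is \<open>H\<close> as a function of the first \<open>n + 2\<close> coordinates:
      \<open>stopped_path\<close> overwrites the later ones, which are undefined.\<close>
    define F where "F \<eta> = H (stopped_path (Suc n) \<eta>)" for \<eta>
    have Fm: "F \<in> borel_measurable (\<Pi>\<^sub>M i\<in>{0..<Suc (Suc n)}. \<mu>)"
      unfolding F_def[abs_def]
    proof (rule measurable_compose[OF _ H])
      show "stopped_path (Suc n) \<in> (\<Pi>\<^sub>M i\<in>{0..<Suc (Suc n)}. \<mu>) \<rightarrow>\<^sub>M path_space"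
        unfolding stopped_path_def[abs_def]
        by (rule measurable_PiM_single') (auto simp: space_PiM PiE_iff intro!: measurable_component_singleton)
    qed
    have eq: "F (restrict \<omega> {0..<Suc (Suc n)}) = H \<omega>" for \<omega>
    proof -
      have "stopped_path (Suc n) (restrict \<omega> {0..<Suc (Suc n)}) = stopped_path (Suc n) \<omega>"
        by (rule ext) (simp add: stopped_path_def less_Suc_eq_le)
      then show ?thesis using st[of \<omega>] by (simp add: F_def)
    qed
    have eq': "F (fun_upd (restrict \<omega> {0..<Suc n}) (Suc n) s) = H (fun_upd \<omega> (Suc n) s)" for \<omega> s
    proof -
      have "stopped_path (Suc n) (fun_upd (restrict \<omega> {0..<Suc n}) (Suc n) s) = stopped_path (Suc n) (fun_upd \<omega> (Suc n) s)"
        by (rule ext) (auto simp: stopped_path_def min_def)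
      then show ?thesis using st[of "fun_upd \<omega> (Suc n) s"] by (simp add: F_def)
    qed
    define K where "K \<eta> = (\<integral>\<^sup>+s. F (fun_upd \<eta> (Suc n) s) \<partial>Q (\<eta> n))" for \<eta>
    have Km: "K \<in> borel_measurable (\<Pi>\<^sub>M i\<in>{0..<Suc n}. \<mu>)"
      unfolding K_def[abs_def]
    proof (rule nn_integral_measurable_subprob_algebra2)
      show "(\<lambda>(\<eta>, s). F (fun_upd \<eta> (Suc n) s)) \<in> borel_measurable ((\<Pi>\<^sub>M i\<in>{0..<Suc n}. \<mu>) \<Otimes>\<^sub>M \<mu>)"
        unfolding split_beta'
        by (rule measurable_compose[OF measurable_fun_upd[where J="{0..<Suc n}"] Fm]) auto
      have "(\<lambda>\<eta>. \<eta> n) \<in> (\<Pi>\<^sub>M i\<in>{0..<Suc n}. \<mu>) \<rightarrow>\<^sub>M \<mu>"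
        by (rule measurable_component_singleton) simp
      then show "(\<lambda>\<eta>. Q (\<eta> n)) \<in> (\<Pi>\<^sub>M i\<in>{0..<Suc n}. \<mu>) \<rightarrow>\<^sub>M subprob_algebra \<mu>"
        using kernel_subprob by (rule measurable_compose)
    qed
    have "(\<integral>\<^sup>+\<omega>. H \<omega> \<partial>?L) = (\<integral>\<^sup>+\<omega>. F (restrict \<omega> {0..<Suc (Suc n)}) \<partial>?L)"
      by (simp only: eq)
    also have "\<dots> = (\<integral>\<^sup>+\<eta>. F \<eta> \<partial>IT.C 0 (Suc (Suc n)) (\<lambda>_. undefined))"
      by (rule nn_proj[OF Fm])
    also have "\<dots> = (\<integral>\<^sup>+\<eta>. K \<eta> \<partial>IT.C 0 (Suc n) (\<lambda>_. undefined))"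
      unfolding nn_C[OF Fm] by (simp add: chain_step_def K_def)
    also have "\<dots> = (\<integral>\<^sup>+\<omega>. K (restrict \<omega> {0..<Suc n}) \<partial>?L)"
      by (rule nn_proj[OF Km, symmetric])
    also have "\<dots> = (\<integral>\<^sup>+\<omega>. \<integral>\<^sup>+s. H (fun_upd \<omega> (Suc n) s) \<partial>Q (\<omega> n) \<partial>?L)"
      unfolding K_def eq' by simp
    finally show "(\<integral>\<^sup>+\<omega>. H \<omega> \<partial>?L) = (\<integral>\<^sup>+\<omega>. \<integral>\<^sup>+s. H (fun_upd \<omega> (Suc n) s) \<partial>Q (\<omega> n) \<partial>?L)" .
  qed
  assume f: "f \<in> borel_measurable \<mu>"
  have Fm: "(\<lambda>\<eta>. f (\<eta> 0)) \<in> borel_measurable (\<Pi>\<^sub>M i\<in>{0..<Suc 0}. \<mu>)"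
    by (rule measurable_compose[OF measurable_component_singleton[of 0 "{0..<Suc 0}" "\<lambda>_. \<mu>"] f]) simp
  have "(\<integral>\<^sup>+\<omega>. f (\<omega> 0) \<partial>?L) = (\<integral>\<^sup>+\<eta>. f (\<eta> 0) \<partial>IT.C 0 (Suc 0) (\<lambda>_. undefined))"
    using nn_proj[OF Fm] by simp
  also have "\<dots> = (\<integral>\<^sup>+\<eta>. \<integral>\<^sup>+s. f s \<partial>chain_step \<mu> Q x 0 \<eta> \<partial>IT.C 0 0 (\<lambda>_. undefined))"
    using nn_C[OF Fm] by (simp del: IT.C.simps)
  also have "\<dots> = f x"
    using f x prob_space.emeasure_space_1[OF IT.prob_space_C[OF u, of 0]]
    by (simp add: chain_step_def nn_integral_return del: IT.C.simps)
  finally show "(\<integral>\<^sup>+\<omega>. f (\<omega> 0) \<partial>?L) = f x" .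
qed

lemma measurable_path_coordinate: "f \<in> \<mu> \<rightarrow>\<^sub>M N \<Longrightarrow> (\<lambda>\<omega>. f (\<omega> i)) \<in> path_space \<rightarrow>\<^sub>M N"
  using measurable_component_singleton[of i UNIV "\<lambda>_. \<mu>"] by (auto intro: measurable_compose)

lemma fourier_sum_measurable:
  assumes h: "h \<in> borel_measurable \<mu>"
  shows "(\<lambda>\<omega>. fourier_sum (\<lambda>k. h (\<omega> k)) n t) \<in> borel_measurable path_space"
proof -
  have "(\<lambda>x. complex_of_real (h x)) \<in> borel_measurable \<mu>" using h by simp
  then show ?thesis
    unfolding fourier_sum_def
    by (intro borel_measurable_sum borel_measurable_times borel_measurable_const measurable_path_coordinate)
qed

definition cylinder_weight :: "(nat \<Rightarrow> 'a set) \<Rightarrow> nat \<Rightarrow> (nat \<Rightarrow> 'a) \<Rightarrow> ennreal" where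
  "cylinder_weight A n \<omega> = (\<Prod>i<n. indicator (A i) (\<omega> i))"

lemma cylinder_weight_measurable:
  "(\<And>i. A i \<in> sets \<mu>) \<Longrightarrow> cylinder_weight A n \<in> borel_measurable path_space"
  unfolding cylinder_weight_def[abs_def]
  by (intro borel_measurable_prod_ennreal measurable_path_coordinate borel_measurable_indicator)

lemma nn_integral_Q_measurable:
  "f \<in> borel_measurable \<mu> \<Longrightarrow> (\<lambda>x. \<integral>\<^sup>+y. f y \<partial>Q x) \<in> borel_measurable \<mu>"
  by (rule measurable_compose[OF kernel_subprob nn_integral_measurable_subprob_algebra])

text \<open>The Markov property tested on rectangles only. Conditional probabilities of single coordinates give it
  directly, and together with the initial law it determines the law of the path
  (\<open>cylinder_step_unique\<close>).\<close>

definition cylinder_step :: "(nat \<Rightarrow> 'a) measure \<Rightarrow> bool" where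
  "cylinder_step M \<longleftrightarrow> (\<forall>A n f. (\<forall>i. A i \<in> sets \<mu>) \<longrightarrow> f \<in> borel_measurable \<mu> \<longrightarrow>
     (\<integral>\<^sup>+\<omega>. cylinder_weight A (Suc n) \<omega> * f (\<omega> (Suc n)) \<partial>M) =
     (\<integral>\<^sup>+\<omega>. cylinder_weight A n \<omega> * (indicator (A n) (\<omega> n) * (\<integral>\<^sup>+s. f s \<partial>Q (\<omega> n))) \<partial>M))"

lemma cylinder_stepD:
  assumes "cylinder_step M" "\<forall>i. A i \<in> sets \<mu>" "f \<in> borel_measurable \<mu>"
  shows "(\<integral>\<^sup>+\<omega>. cylinder_weight A (Suc n) \<omega> * f (\<omega> (Suc n)) \<partial>M) =
     (\<integral>\<^sup>+\<omega>. cylinder_weight A n \<omega> * (indicator (A n) (\<omega> n) * (\<integral>\<^sup>+s. f s \<partial>Q (\<omega> n))) \<partial>M)"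
  using assms unfolding cylinder_step_def by blast

lemma markov_law_cylinder_step:
  assumes M: "markov_law M" shows "cylinder_step M"
  unfolding cylinder_step_def
proof (intro allI impI)
  fix A :: "nat \<Rightarrow> 'a set" and n and f :: "'a \<Rightarrow> ennreal"
  assume A: "\<forall>i. A i \<in> sets \<mu>" and f: "f \<in> borel_measurable \<mu>"
  have fm: "(\<lambda>\<omega>. f (\<omega> (Suc n))) \<in> borel_measurable path_space"
    by (rule measurable_path_coordinate[OF f])
  have "(\<lambda>\<omega>. cylinder_weight A (Suc n) \<omega> * f (\<omega> (Suc n))) \<in> borel_measurable path_space"
    using A by (intro borel_measurable_times_ennreal cylinder_weight_measurable fm) auto
  then have "(\<integral>\<^sup>+\<omega>. cylinder_weight A (Suc n) \<omega> * f (\<omega> (Suc n)) \<partial>M) =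
      (\<integral>\<^sup>+\<omega>. \<integral>\<^sup>+s. cylinder_weight A (Suc n) (fun_upd \<omega> (Suc n) s) * f s \<partial>Q (\<omega> n) \<partial>M)"
    by (subst markov_law_nn_integral[OF M, of _ n])
       (simp_all add: cylinder_weight_def stopped_path_def)
  also have "\<dots> = (\<integral>\<^sup>+\<omega>. cylinder_weight A n \<omega> * (indicator (A n) (\<omega> n) * (\<integral>\<^sup>+s. f s \<partial>Q (\<omega> n))) \<partial>M)"
  proof (rule nn_integral_cong)
    fix \<omega> assume "\<omega> \<in> space M"
    then have "\<omega> n \<in> space \<mu>" using markov_lawD(3)[OF M] path_component_space by auto
    then have fQ: "f \<in> borel_measurable (Q (\<omega> n))" by (rule measurable_Q[OF _ f])
    have "cylinder_weight A (Suc n) (fun_upd \<omega> (Suc n) s) = cylinder_weight A n \<omega> * indicator (A n) (\<omega> n)" for s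
      by (simp add: cylinder_weight_def)
    then show "(\<integral>\<^sup>+s. cylinder_weight A (Suc n) (fun_upd \<omega> (Suc n) s) * f s \<partial>Q (\<omega> n)) =
        cylinder_weight A n \<omega> * (indicator (A n) (\<omega> n) * (\<integral>\<^sup>+s. f s \<partial>Q (\<omega> n)))"
      by (simp add: nn_integral_cmult[OF fQ] mult.assoc[symmetric])
  qed
  finally show "(\<integral>\<^sup>+\<omega>. cylinder_weight A (Suc n) \<omega> * f (\<omega> (Suc n)) \<partial>M) =
     (\<integral>\<^sup>+\<omega>. cylinder_weight A n \<omega> * (indicator (A n) (\<omega> n) * (\<integral>\<^sup>+s. f s \<partial>Q (\<omega> n))) \<partial>M)" .
qed

lemma emeasure_path_rectangle:
  assumes J: "finite J" and A: "\<And>i. i \<in> J \<Longrightarrow> A i \<in> sets \<mu>"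
  shows "\<exists>B n. (\<forall>i. B i \<in> sets \<mu>) \<and> (\<forall>M. sets M = sets path_space \<longrightarrow>
      emeasure M (prod_emb UNIV (\<lambda>_. \<mu>) J (Pi\<^sub>E J A)) = (\<integral>\<^sup>+\<omega>. cylinder_weight B n \<omega> * 1 \<partial>M))"
proof -
  define B where "B i = (if i \<in> J then A i else space \<mu>)" for i
  obtain n where n: "J \<subseteq> {..<n}" using J finite_nat_iff_bounded by blast
  have B: "B i \<in> sets \<mu>" for i using A by (auto simp: B_def)
  have "emeasure M (prod_emb UNIV (\<lambda>_. \<mu>) J (Pi\<^sub>E J A)) = (\<integral>\<^sup>+\<omega>. cylinder_weight B n \<omega> * 1 \<partial>M)"
    if s: "sets M = sets path_space" for M
  proof -
    have sp: "space M = space path_space" by (rule sets_eq_imp_space_eq[OF s])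
    have X: "prod_emb UNIV (\<lambda>_. \<mu>) J (Pi\<^sub>E J A) \<in> sets M"
      unfolding s using J A by (intro sets_PiM_I) auto
    have "(\<integral>\<^sup>+\<omega>. cylinder_weight B n \<omega> * 1 \<partial>M) = (\<integral>\<^sup>+\<omega>. indicator (prod_emb UNIV (\<lambda>_. \<mu>) J (Pi\<^sub>E J A)) \<omega> \<partial>M)"
    proof (rule nn_integral_cong)
      fix \<omega> assume "\<omega> \<in> space M"
      then have \<omega>: "\<And>i. \<omega> i \<in> space \<mu>" using sp path_component_space by auto
      have "\<omega> \<in> prod_emb UNIV (\<lambda>_. \<mu>) J (Pi\<^sub>E J A) \<longleftrightarrow> (\<forall>i<n. \<omega> i \<in> B i)"
        using \<omega> n by (auto simp: prod_emb_iff PiE_iff B_def)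
      moreover have "cylinder_weight B n \<omega> = indicator {\<omega>. \<forall>i<n. \<omega> i \<in> B i} \<omega>"
      proof (cases "\<forall>i<n. \<omega> i \<in> B i")
        case False
        then obtain i where "i < n" "\<omega> i \<notin> B i" by blast
        then have "(\<Prod>i<n. indicator (B i) (\<omega> i) :: ennreal) = 0"
          by (intro prod_zero bexI[of _ i]) auto
        with False show ?thesis by (simp add: cylinder_weight_def)
      qed (simp add: cylinder_weight_def)
      ultimately show "cylinder_weight B n \<omega> * 1 = indicator (prod_emb UNIV (\<lambda>_. \<mu>) J (Pi\<^sub>E J A)) \<omega>"
        by (simp add: indicator_def)
    qed
    then show ?thesis using X by simp
  qed
  then show ?thesis using B by (intro exI[of _ B] exI[of _ n] conjI allI impI)
qed

text \<open>The recursion moves the last coordinate one step back at the price of another test function, down to time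
  \<open>0\<close>. The induction needs an arbitrary function of the last coordinate, not only an indicator.\<close>

lemma cylinder_step_unique:
  assumes M: "prob_space M" "sets M = sets path_space" "cylinder_step M"
    and N: "sets N = sets path_space" "cylinder_step N"
    and start: "\<And>f. f \<in> borel_measurable \<mu> \<Longrightarrow> (\<integral>\<^sup>+\<omega>. f (\<omega> 0) \<partial>M) = (\<integral>\<^sup>+\<omega>. f (\<omega> 0) \<partial>N)"
  shows "M = N"
proof -
  have eq: "(\<integral>\<^sup>+\<omega>. cylinder_weight A n \<omega> * f (\<omega> n) \<partial>M) = (\<integral>\<^sup>+\<omega>. cylinder_weight A n \<omega> * f (\<omega> n) \<partial>N)"
    if A: "\<forall>i. A i \<in> sets \<mu>" and "f \<in> borel_measurable \<mu>" for A n f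
    using that(2)
  proof (induction n arbitrary: f)
    case 0 show ?case using start[OF 0] by (simp add: cylinder_weight_def)
  next
    case (Suc n)
    have "(\<lambda>x. indicator (A n) x * (\<integral>\<^sup>+s. f s \<partial>Q x)) \<in> borel_measurable \<mu>"
      using A Suc(2) by (intro borel_measurable_times_ennreal nn_integral_Q_measurable) auto
    from Suc(1)[OF this] show ?case
      unfolding cylinder_stepD[OF M(3) A Suc(2)] cylinder_stepD[OF N(2) A Suc(2)] .
  qed
  show ?thesis
  proof (rule measure_eqI_PiM_infinite[where I=UNIV and M="\<lambda>_. \<mu>"])
    fix J :: "nat set" and A
    assume J: "finite J" "\<And>i. i \<in> J \<Longrightarrow> A i \<in> sets \<mu>"
    obtain B n where B: "(\<forall>i. B i \<in> sets \<mu>) \<and> (\<forall>M. sets M = sets path_space \<longrightarrow>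
        emeasure M (prod_emb UNIV (\<lambda>_. \<mu>) J (Pi\<^sub>E J A)) = (\<integral>\<^sup>+\<omega>. cylinder_weight B n \<omega> * 1 \<partial>M))"
      using emeasure_path_rectangle[OF J(1), of A, OF J(2)] by blast
    show "emeasure M (prod_emb UNIV (\<lambda>_. \<mu>) J (Pi\<^sub>E J A)) = emeasure N (prod_emb UNIV (\<lambda>_. \<mu>) J (Pi\<^sub>E J A))"
      unfolding B[THEN conjunct2, rule_format, OF M(2)] B[THEN conjunct2, rule_format, OF N(1)]
      by (rule eq[OF B[THEN conjunct1]]) simp
  next
    show "finite_measure M" using M(1) by (rule prob_space.finite_measure)
  qed (use M(2) N(1) in simp_all)
qed

text \<open>Measurability in the starting point is checked on rectangles, where the same recursion leads to time
  \<open>0\<close> and the chain started at \<open>x\<close> sits at \<open>x\<close>.\<close>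

lemma chain_from_kernel: "chain_from \<mu> Q \<in> \<mu> \<rightarrow>\<^sub>M prob_algebra path_space"
proof -
  note L = markov_lawD[OF chain_from_markov]
  have meas: "(\<lambda>x. \<integral>\<^sup>+\<omega>. cylinder_weight A n \<omega> * f (\<omega> n) \<partial>chain_from \<mu> Q x) \<in> borel_measurable \<mu>"
    if A: "\<forall>i. A i \<in> sets \<mu>" and "f \<in> borel_measurable \<mu>" for A n f
    using that(2)
  proof (induction n arbitrary: f)
    case 0
    have "(\<lambda>x. \<integral>\<^sup>+\<omega>. cylinder_weight A 0 \<omega> * f (\<omega> 0) \<partial>chain_from \<mu> Q x) \<in> borel_measurable \<mu> \<longleftrightarrow> f \<in> borel_measurable \<mu>"
      by (intro measurable_cong) (simp add: cylinder_weight_def chain_from_start[OF _ 0])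
    then show ?case using 0 by simp
  next
    case (Suc n)
    have m: "(\<lambda>x. indicator (A n) x * (\<integral>\<^sup>+s. f s \<partial>Q x)) \<in> borel_measurable \<mu>"
      using A Suc(2) by (intro borel_measurable_times_ennreal nn_integral_Q_measurable) auto
    have "(\<lambda>x. \<integral>\<^sup>+\<omega>. cylinder_weight A (Suc n) \<omega> * f (\<omega> (Suc n)) \<partial>chain_from \<mu> Q x) \<in> borel_measurable \<mu> \<longleftrightarrow>
        (\<lambda>x. \<integral>\<^sup>+\<omega>. cylinder_weight A n \<omega> * (indicator (A n) (\<omega> n) * (\<integral>\<^sup>+s. f s \<partial>Q (\<omega> n))) \<partial>chain_from \<mu> Q x) \<in> borel_measurable \<mu>"
      by (intro measurable_cong cylinder_stepD[OF markov_law_cylinder_step[OF chain_from_markov] A Suc(2)])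
    then show ?case using Suc(1)[OF m] by simp
  qed
  show ?thesis
  proof (rule measurable_prob_algebra_generated[OF sets_PiM Int_stable_prod_algebra prod_algebra_sets_into_space])
    fix X assume "X \<in> prod_algebra UNIV (\<lambda>_::nat. \<mu>)"
    then obtain J E where X: "X = prod_emb UNIV (\<lambda>_. \<mu>) J (Pi\<^sub>E J E)"
      and J: "finite J" "\<And>j. j \<in> J \<Longrightarrow> E j \<in> sets \<mu>"
      by (force elim!: prod_algebraE)
    obtain B n where B: "(\<forall>i. B i \<in> sets \<mu>) \<and> (\<forall>M. sets M = sets path_space \<longrightarrow>
        emeasure M (prod_emb UNIV (\<lambda>_. \<mu>) J (Pi\<^sub>E J E)) = (\<integral>\<^sup>+\<omega>. cylinder_weight B n \<omega> * 1 \<partial>M))"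
      using emeasure_path_rectangle[OF J(1), of E, OF J(2)] by blast
    have "(\<lambda>x. emeasure (chain_from \<mu> Q x) X) \<in> borel_measurable \<mu> \<longleftrightarrow>
      (\<lambda>x. \<integral>\<^sup>+\<omega>. cylinder_weight B n \<omega> * 1 \<partial>chain_from \<mu> Q x) \<in> borel_measurable \<mu>"
      unfolding X using L(2) by (intro measurable_cong B[THEN conjunct2, rule_format])
    moreover have "(\<lambda>x. \<integral>\<^sup>+\<omega>. cylinder_weight B n \<omega> * 1 \<partial>chain_from \<mu> Q x) \<in> borel_measurable \<mu>"
      by (rule meas[OF B[THEN conjunct1]]) simp
    ultimately show "(\<lambda>x. emeasure (chain_from \<mu> Q x) X) \<in> borel_measurable \<mu>"
      by (rule iffD2)
  qed (use L(1,2) in simp_all)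
qed

end

section \<open>The stationary law as a mixture over starting points\<close>

definition forward_path :: "(int \<Rightarrow> 'a) \<Rightarrow> nat \<Rightarrow> 'a" where
  "forward_path \<omega> = (\<lambda>n. \<omega> (int n))"

definition path_shift :: "(nat \<Rightarrow> 'a) \<Rightarrow> nat \<Rightarrow> 'a" where
  "path_shift \<omega> = (\<lambda>n. \<omega> (Suc n))"

lemma path_shift_funpow: "(path_shift ^^ k) \<omega> n = \<omega> (n + k)"
  by (induction k arbitrary: n) (simp_all add: path_shift_def)

context markov_kernel begin

lemma path_shift_measurable: "path_shift \<in> path_space \<rightarrow>\<^sub>M path_space"
  unfolding path_shift_def[abs_def] by (rule measurable_PiM_single') (auto simp: space_PiM)

definition start_law :: "(nat \<Rightarrow> 'a) measure" where
  "start_law = \<mu> \<bind> chain_from \<mu> Q"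

lemma sets_start_law: "sets start_law = sets path_space"
  unfolding start_law_def
  by (rule sets_bind_measurable[OF measurable_prob_algebraD[OF chain_from_kernel] not_empty])

lemma nn_integral_start_law:
  "f \<in> borel_measurable path_space \<Longrightarrow> (\<integral>\<^sup>+\<omega>. f \<omega> \<partial>start_law) = (\<integral>\<^sup>+x. \<integral>\<^sup>+\<omega>. f \<omega> \<partial>chain_from \<mu> Q x \<partial>\<mu>)"
  unfolding start_law_def by (rule nn_integral_bind[OF _ measurable_prob_algebraD[OF chain_from_kernel]])

lemma prob_space_start_law: "prob_space start_law"
  unfolding start_law_def
  using markov_lawD(1)[OF chain_from_markov]
  by (intro prob_space_bind[OF _ measurable_prob_algebraD[OF chain_from_kernel]]) auto

lemma markov_law_start_law: "markov_law start_law"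
proof (rule markov_lawI[OF prob_space_start_law sets_start_law])
  fix n and H :: "(nat \<Rightarrow> 'a) \<Rightarrow> ennreal"
  assume H: "H \<in> borel_measurable path_space" and st: "\<And>\<omega>. H (stopped_path (Suc n) \<omega>) = H \<omega>"
  have K: "(\<lambda>\<omega>. \<integral>\<^sup>+s. H (fun_upd \<omega> (Suc n) s) \<partial>Q (\<omega> n)) \<in> borel_measurable path_space"
  proof (rule nn_integral_measurable_subprob_algebra2)
    show "(\<lambda>(\<omega>, s). H (fun_upd \<omega> (Suc n) s)) \<in> borel_measurable (path_space \<Otimes>\<^sub>M \<mu>)"
      using measurable_compose[OF fun_upd_path_measurable H] by (simp add: split_beta')
    show "(\<lambda>\<omega>. Q (\<omega> n)) \<in> path_space \<rightarrow>\<^sub>M subprob_algebra \<mu>"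
      by (rule measurable_path_coordinate[OF kernel_subprob])
  qed
  show "(\<integral>\<^sup>+\<omega>. H \<omega> \<partial>start_law) = (\<integral>\<^sup>+\<omega>. \<integral>\<^sup>+s. H (fun_upd \<omega> (Suc n) s) \<partial>Q (\<omega> n) \<partial>start_law)"
    unfolding nn_integral_start_law[OF H] nn_integral_start_law[OF K]
    by (intro nn_integral_cong markov_law_nn_integral[OF chain_from_markov] H) (simp_all add: st)
qed

text \<open>This turns almost sure statements on the stationary chain into statements on the chain started at almost
  every point.\<close>

lemma AE_start_law:
  assumes "AE \<omega> in start_law. R \<omega>"
  shows "AE x in \<mu>. AE \<omega> in chain_from \<mu> Q x. R \<omega>"
proof -
  have sp: "space start_law = space path_space" by (rule sets_eq_imp_space_eq[OF sets_start_law])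
  obtain N where N: "{\<omega>\<in>space start_law. \<not> R \<omega>} \<subseteq> N" "emeasure start_law N = 0" "N \<in> sets start_law"
    using assms by (rule AE_E)
  have "AE \<omega> in \<mu> \<bind> chain_from \<mu> Q. \<omega> \<notin> N"
    using N unfolding start_law_def[symmetric] by (intro AE_not_in) (auto simp: null_sets_def)
  then have "AE x in \<mu>. AE \<omega> in chain_from \<mu> Q x. \<omega> \<notin> N"
    using N(3) by (subst (asm) AE_bind[OF measurable_prob_algebraD[OF chain_from_kernel]]) (auto simp: sets_start_law)
  then show ?thesis
    using AE_space
  proof eventually_elim
    case (elim x)
    show ?case
      using elim(1) AE_space
      by eventually_elim (use N(1) sp markov_lawD(3)[OF chain_from_markov[OF elim(2)]] in auto)
  qed
qed

lemma forward_path_measurable: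
  "forward_path \<in> (\<Pi>\<^sub>M i\<in>UNIV. \<mu>) \<rightarrow>\<^sub>M path_space"
  unfolding forward_path_def[abs_def] by (rule measurable_PiM_single') (auto simp: space_PiM)

context
  fixes P :: "(int \<Rightarrow> 'a) measure"
  assumes P: "stationary_markov_law \<mu> Q P"
begin

lemma stationary_lawD:
  shows "prob_space P" "sets P = sets (\<Pi>\<^sub>M i\<in>UNIV. \<mu>)" "space P = space (\<Pi>\<^sub>M i\<in>UNIV. \<mu>)"
    "distr P P shift = P" "distr P \<mu> (\<lambda>\<omega>. \<omega> 0) = \<mu>"
    "A \<in> sets \<mu> \<Longrightarrow> AE \<omega> in P. real_cond_exp P (past \<mu> n) (\<lambda>\<omega>. indicat_real A (\<omega> (n + 1))) \<omega> = measure (Q (\<omega> n)) A"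
proof -
  note * = P[unfolded stationary_markov_law_def]
  show "sets P = sets (\<Pi>\<^sub>M i\<in>UNIV. \<mu>)" using * by blast
  then show "space P = space (\<Pi>\<^sub>M i\<in>UNIV. \<mu>)" by (rule sets_eq_imp_space_eq)
qed (use P[unfolded stationary_markov_law_def] in blast)+

lemma measurable_P: "f \<in> (\<Pi>\<^sub>M i\<in>UNIV. \<mu>) \<rightarrow>\<^sub>M N \<Longrightarrow> f \<in> P \<rightarrow>\<^sub>M N"
  by (simp add: measurable_cong_sets[OF stationary_lawD(2) refl])

lemma measurable_P_coordinate: "f \<in> \<mu> \<rightarrow>\<^sub>M N \<Longrightarrow> (\<lambda>\<omega>. f (\<omega> i)) \<in> P \<rightarrow>\<^sub>M N"
  using measurable_component_singleton[of i UNIV "\<lambda>_. \<mu>"] by (intro measurable_P) (auto intro: measurable_compose)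

lemma past_coordinate: "i \<le> n \<Longrightarrow> (\<lambda>\<omega>. \<omega> i) \<in> past \<mu> n \<rightarrow>\<^sub>M \<mu>"
proof -
  assume i: "i \<le> n"
  have "(\<lambda>\<omega>. restrict \<omega> {..n}) \<in> past \<mu> n \<rightarrow>\<^sub>M (\<Pi>\<^sub>M i\<in>{..n}. \<mu>)"
    unfolding past_def
    by (rule measurable_vimage_algebra1) (auto simp: space_PiM PiE_iff extensional_def restrict_def)
  from measurable_compose[OF this measurable_component_singleton[of i "{..n}" "\<lambda>_. \<mu>"]] i
  show ?thesis by simp
qed

lemma past_subalgebra: "sigma_finite_subalgebra P (past \<mu> n)"
proof -
  have "subalgebra P (past \<mu> n)"
    unfolding subalgebra_def
  proof
    show "space (past \<mu> n) = space P" by (simp add: past_def stationary_lawD(3))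
    have r: "(\<lambda>\<omega>. restrict \<omega> {..n}) \<in> P \<rightarrow>\<^sub>M (\<Pi>\<^sub>M i\<in>{..n}. \<mu>)"
      by (rule measurable_P[OF measurable_restrict_subset]) simp
    show "sets (past \<mu> n) \<subseteq> sets P"
      unfolding past_def stationary_lawD(3)[symmetric] using measurable_sets[OF r]
      by (subst sets_vimage_algebra2) (auto dest: measurable_space[OF r])
  qed
  then have "finite_measure_subalgebra P (past \<mu> n)"
    using stationary_lawD(1) by (auto simp: finite_measure_subalgebra_def finite_measure_subalgebra_axioms_def prob_space_def)
  then show ?thesis by (rule finite_measure_subalgebra_is_sigma_finite)
qed

text \<open>Let \<open>w\<close> be the indicator of a rectangle in the coordinates \<open>0, \<dots>, n\<close>. The
  measures \<open>M1\<close> and \<open>M2\<close> are the law of the coordinate \<open>n + 1\<close> under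
  the density \<open>w\<close>, and one kernel step from the law of coordinate \<open>n\<close> under
  \<open>w\<close>. They agree on each set by the defining property of conditional expectation, hence on all
  nonnegative functions.\<close>

lemma forward_cylinder_step: "cylinder_step (distr P path_space forward_path)"
  unfolding cylinder_step_def
proof (intro allI impI)
  fix A :: "nat \<Rightarrow> 'a set" and n and f :: "'a \<Rightarrow> ennreal"
  assume A: "\<forall>i. A i \<in> sets \<mu>" and f: "f \<in> borel_measurable \<mu>"
  interpret P: prob_space P by (rule stationary_lawD)
  interpret cond: sigma_finite_subalgebra P "past \<mu> (int n)" by (rule past_subalgebra)
  define w where "w \<omega> = (\<Prod>i<Suc n. indicat_real (A i) (\<omega> (int i)))" for \<omega> :: "int \<Rightarrow> 'a"
  have w01: "0 \<le> w \<omega>" "w \<omega> \<le> 1" for \<omega>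
    by (auto simp: w_def indicator_def intro!: prod_nonneg prod_le_1)
  have w_past: "w \<in> borel_measurable (past \<mu> (int n))"
    unfolding w_def[abs_def]
  proof (rule borel_measurable_prod)
    fix i assume "i \<in> {..<Suc n}"
    then have "(\<lambda>\<omega>. \<omega> (int i)) \<in> past \<mu> (int n) \<rightarrow>\<^sub>M \<mu>" by (intro past_coordinate) auto
    from measurable_compose[OF this borel_measurable_indicator[of "A i"]] A
    show "(\<lambda>\<omega>. indicat_real (A i) (\<omega> (int i))) \<in> borel_measurable (past \<mu> (int n))" by simp
  qed
  have w_P: "w \<in> borel_measurable P" by (rule measurable_from_subalg[OF cond.subalg w_past])
  have ind: "(\<lambda>\<omega>. indicat_real B (\<omega> i)) \<in> borel_measurable P" if "B \<in> sets \<mu>" for B i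
    by (rule measurable_P_coordinate) (use that in simp)
  have Qm: "(\<lambda>\<omega>. measure (Q (\<omega> i)) B) \<in> borel_measurable P" if "B \<in> sets \<mu>" for B i
    by (rule measurable_P_coordinate) (rule measurable_compose[OF kernel_subprob measurable_measure_subprob_algebra[OF that]])
  have sp: "\<omega> i \<in> space \<mu>" if "\<omega> \<in> space P" for \<omega> i using that by (auto simp: stationary_lawD(3) space_PiM)
  define M1 where "M1 = distr (density P (\<lambda>\<omega>. ennreal (w \<omega>))) \<mu> (\<lambda>\<omega>. \<omega> (int (Suc n)))"
  define M2 where "M2 = distr (density P (\<lambda>\<omega>. ennreal (w \<omega>))) \<mu> (\<lambda>\<omega>. \<omega> (int n)) \<bind> Q"
  have co: "(\<lambda>\<omega>. \<omega> i) \<in> P \<rightarrow>\<^sub>M \<mu>" for i using measurable_P_coordinate[of "\<lambda>x. x" \<mu> i] by simp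
  have nn1: "(\<integral>\<^sup>+x. g x \<partial>M1) = (\<integral>\<^sup>+\<omega>. ennreal (w \<omega>) * g (\<omega> (int (Suc n))) \<partial>P)" if "g \<in> borel_measurable \<mu>" for g
    unfolding M1_def using that co w_P measurable_compose[OF co that]
    by (subst nn_integral_distr) (auto simp: nn_integral_density)
  have nn2: "(\<integral>\<^sup>+x. g x \<partial>M2) = (\<integral>\<^sup>+\<omega>. ennreal (w \<omega>) * (\<integral>\<^sup>+s. g s \<partial>Q (\<omega> (int n))) \<partial>P)" if g: "g \<in> borel_measurable \<mu>" for g
  proof -
    have "Q \<in> distr (density P (\<lambda>\<omega>. ennreal (w \<omega>))) \<mu> (\<lambda>\<omega>. \<omega> (int n)) \<rightarrow>\<^sub>M subprob_algebra \<mu>"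
      using kernel_subprob by simp
    from nn_integral_bind[OF g this]
    have "(\<integral>\<^sup>+x. g x \<partial>M2) = (\<integral>\<^sup>+x. \<integral>\<^sup>+s. g s \<partial>Q x \<partial>distr (density P (\<lambda>\<omega>. ennreal (w \<omega>))) \<mu> (\<lambda>\<omega>. \<omega> (int n)))"
      by (simp add: M2_def)
    also have "\<dots> = (\<integral>\<^sup>+\<omega>. \<integral>\<^sup>+s. g s \<partial>Q (\<omega> (int n)) \<partial>density P (\<lambda>\<omega>. ennreal (w \<omega>)))"
      using nn_integral_Q_measurable[OF g] co by (intro nn_integral_distr) auto
    also have "\<dots> = (\<integral>\<^sup>+\<omega>. ennreal (w \<omega>) * (\<integral>\<^sup>+s. g s \<partial>Q (\<omega> (int n))) \<partial>P)"
      using w_P measurable_compose[OF co nn_integral_Q_measurable[OF g]] by (intro nn_integral_density) auto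
    finally show ?thesis .
  qed
  have "M1 = M2"
  proof (rule measure_eqI)
    show s12: "sets M1 = sets M2"
      unfolding M1_def M2_def
      by (subst sets_bind_measurable[of Q _ \<mu>]) (use kernel_subprob not_empty in simp_all)
    fix B assume "B \<in> sets M1"
    then have B: "B \<in> sets \<mu>" by (simp add: M1_def)
    have B2: "B \<in> sets M2" using \<open>B \<in> sets M1\<close> s12 by simp
    have Bi: "(\<lambda>x. indicator B x :: ennreal) \<in> borel_measurable \<mu>" using B by simp
    have i1: "integrable P (\<lambda>\<omega>. w \<omega> * indicat_real B (\<omega> (int n + 1)))"
      using w01 w_P ind[OF B]
      by (intro P.integrable_const_bound[where B=1]) (auto simp: mult_le_one indicator_def)
    have i2: "integrable P (\<lambda>\<omega>. w \<omega> * measure (Q (\<omega> (int n))) B)"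
    proof (rule P.integrable_const_bound[where B=1])
      show "AE \<omega> in P. norm (w \<omega> * measure (Q (\<omega> (int n))) B) \<le> 1"
      proof (rule AE_I2)
        fix \<omega> assume "\<omega> \<in> space P"
        then have "measure (Q (\<omega> (int n))) B \<le> 1" using prob_space.prob_le_1[OF prob_space_Q[OF sp]] by auto
        then show "norm (w \<omega> * measure (Q (\<omega> (int n))) B) \<le> 1"
          using w01[of \<omega>] by (simp add: abs_mult mult_le_one)
      qed
    qed (use w_P Qm[OF B] in simp)
    have "emeasure M1 B = (\<integral>\<^sup>+\<omega>. ennreal (w \<omega>) * indicator B (\<omega> (int (Suc n))) \<partial>P)"
      using nn1[OF Bi] \<open>B \<in> sets M1\<close> by simp
    also have "\<dots> = (\<integral>\<^sup>+\<omega>. ennreal (w \<omega> * indicat_real B (\<omega> (int n + 1))) \<partial>P)"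
      using w01 by (intro nn_integral_cong) (auto simp: ennreal_mult ennreal_indicator add.commute)
    also have "\<dots> = ennreal (\<integral>\<omega>. w \<omega> * indicat_real B (\<omega> (int n + 1)) \<partial>P)"
      using i1 w01 by (intro nn_integral_eq_integral) auto
    also have "(\<integral>\<omega>. w \<omega> * indicat_real B (\<omega> (int n + 1)) \<partial>P) =
        (\<integral>\<omega>. w \<omega> * real_cond_exp P (past \<mu> (int n)) (\<lambda>\<omega>. indicat_real B (\<omega> (int n + 1))) \<omega> \<partial>P)"
      by (rule cond.real_cond_exp_intg(2)[OF i1 w_past ind[OF B], symmetric])
    also have "\<dots> = (\<integral>\<omega>. w \<omega> * measure (Q (\<omega> (int n))) B \<partial>P)"
    proof (rule integral_cong_AE)
      show "AE \<omega> in P. w \<omega> * real_cond_exp P (past \<mu> (int n)) (\<lambda>\<omega>. indicat_real B (\<omega> (int n + 1))) \<omega> =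
          w \<omega> * measure (Q (\<omega> (int n))) B"
        using stationary_lawD(6)[OF B, of "int n"] by eventually_elim simp
    qed (use w_P Qm[OF B] in auto)
    also have "ennreal \<dots> = (\<integral>\<^sup>+\<omega>. ennreal (w \<omega> * measure (Q (\<omega> (int n))) B) \<partial>P)"
      using i2 w01 by (intro nn_integral_eq_integral[symmetric]) auto
    also have "\<dots> = (\<integral>\<^sup>+\<omega>. ennreal (w \<omega>) * (\<integral>\<^sup>+s. indicator B s \<partial>Q (\<omega> (int n))) \<partial>P)"
    proof (rule nn_integral_cong)
      fix \<omega> assume \<omega>: "\<omega> \<in> space P"
      interpret Qx: prob_space "Q (\<omega> (int n))" by (rule prob_space_Q[OF sp[OF \<omega>]])
      show "ennreal (w \<omega> * measure (Q (\<omega> (int n))) B) = ennreal (w \<omega>) * (\<integral>\<^sup>+s. indicator B s \<partial>Q (\<omega> (int n)))"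
        using B w01 by (simp add: sets_Q[OF sp[OF \<omega>]] ennreal_mult Qx.emeasure_eq_measure)
    qed
    also have "\<dots> = emeasure M2 B" using nn2[OF Bi] B2 by simp
    finally show "emeasure M1 B = emeasure M2 B" .
  qed
  have weight: "cylinder_weight A (Suc n) (forward_path \<omega>) = ennreal (w \<omega>)" for \<omega>
    by (simp add: cylinder_weight_def forward_path_def w_def prod_ennreal[symmetric] ennreal_indicator ennreal_mult prod_nonneg)
  have "(\<integral>\<^sup>+\<omega>. cylinder_weight A (Suc n) \<omega> * f (\<omega> (Suc n)) \<partial>distr P path_space forward_path) =
      (\<integral>\<^sup>+\<omega>. cylinder_weight A (Suc n) (forward_path \<omega>) * f (forward_path \<omega> (Suc n)) \<partial>P)"
    using A by (intro nn_integral_distr measurable_P[OF forward_path_measurable] borel_measurable_times_ennreal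
      cylinder_weight_measurable measurable_path_coordinate f) (auto intro!: measurable_path_coordinate[OF f] cylinder_weight_measurable)
  also have "\<dots> = (\<integral>\<^sup>+x. f x \<partial>M1)"
    unfolding nn1[OF f] weight by (simp add: forward_path_def)
  also have "\<dots> = (\<integral>\<^sup>+x. f x \<partial>M2)" by (simp add: \<open>M1 = M2\<close>)
  also have "\<dots> = (\<integral>\<^sup>+\<omega>. cylinder_weight A (Suc n) (forward_path \<omega>) * (\<integral>\<^sup>+s. f s \<partial>Q (forward_path \<omega> n)) \<partial>P)"
    unfolding nn2[OF f] weight by (simp add: forward_path_def)
  also have "\<dots> = (\<integral>\<^sup>+\<omega>. cylinder_weight A (Suc n) \<omega> * (\<integral>\<^sup>+s. f s \<partial>Q (\<omega> n)) \<partial>distr P path_space forward_path)"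
    using A by (intro nn_integral_distr[symmetric] measurable_P[OF forward_path_measurable])
      (auto intro!: borel_measurable_times_ennreal measurable_path_coordinate[OF nn_integral_Q_measurable[OF f]] cylinder_weight_measurable)
  also have "\<dots> = (\<integral>\<^sup>+\<omega>. cylinder_weight A n \<omega> * (indicator (A n) (\<omega> n) * (\<integral>\<^sup>+s. f s \<partial>Q (\<omega> n))) \<partial>distr P path_space forward_path)"
    by (simp add: cylinder_weight_def mult.assoc)
  finally show "(\<integral>\<^sup>+\<omega>. cylinder_weight A (Suc n) \<omega> * f (\<omega> (Suc n)) \<partial>distr P path_space forward_path) =
      (\<integral>\<^sup>+\<omega>. cylinder_weight A n \<omega> * (indicator (A n) (\<omega> n) * (\<integral>\<^sup>+s. f s \<partial>Q (\<omega> n))) \<partial>distr P path_space forward_path)" .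
qed

proposition forward_law: "distr P path_space forward_path = start_law"
proof (rule cylinder_step_unique)
  show "prob_space (distr P path_space forward_path)"
    by (rule prob_space.prob_space_distr[OF stationary_lawD(1) measurable_P[OF forward_path_measurable]])
  show "cylinder_step start_law" by (rule markov_law_cylinder_step[OF markov_law_start_law])
  show "(\<integral>\<^sup>+\<omega>. f (\<omega> 0) \<partial>distr P path_space forward_path) = (\<integral>\<^sup>+\<omega>. f (\<omega> 0) \<partial>start_law)"
    if f: "f \<in> borel_measurable \<mu>" for f
  proof -
    have co: "(\<lambda>\<omega>. \<omega> 0) \<in> P \<rightarrow>\<^sub>M \<mu>" using measurable_P_coordinate[of "\<lambda>x. x" \<mu> 0] by simp
    have "(\<integral>\<^sup>+\<omega>. f (\<omega> 0) \<partial>distr P path_space forward_path) = (\<integral>\<^sup>+\<omega>. f (\<omega> 0) \<partial>P)"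
      using measurable_path_coordinate[OF f]
      by (subst nn_integral_distr[OF measurable_P[OF forward_path_measurable]]) (auto simp: forward_path_def)
    also have "\<dots> = (\<integral>\<^sup>+x. f x \<partial>distr P \<mu> (\<lambda>\<omega>. \<omega> 0))"
      by (rule nn_integral_distr[OF co, symmetric]) (simp add: f)
    also have "\<dots> = (\<integral>\<^sup>+x. f x \<partial>\<mu>)" by (simp add: stationary_lawD(5))
    also have "\<dots> = (\<integral>\<^sup>+x. \<integral>\<^sup>+\<omega>. f (\<omega> 0) \<partial>chain_from \<mu> Q x \<partial>\<mu>)"
      by (intro nn_integral_cong chain_from_start[symmetric] f)
    also have "\<dots> = (\<integral>\<^sup>+\<omega>. f (\<omega> 0) \<partial>start_law)"
      by (rule nn_integral_start_law[OF measurable_path_coordinate[OF f], symmetric])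
    finally show ?thesis .
  qed
qed (simp_all add: sets_start_law forward_cylinder_step)

lemma shift_measurable: "shift \<in> P \<rightarrow>\<^sub>M P"
proof -
  have "shift \<in> (\<Pi>\<^sub>M i\<in>UNIV. \<mu>) \<rightarrow>\<^sub>M (\<Pi>\<^sub>M i\<in>UNIV. \<mu>)"
    unfolding shift_def[abs_def] by (rule measurable_PiM_single') (auto simp: space_PiM)
  then show ?thesis by (simp add: measurable_cong_sets[OF stationary_lawD(2) stationary_lawD(2)])
qed

lemma forward_path_shift: "forward_path (shift \<omega>) = path_shift (forward_path \<omega>)"
  by (simp add: forward_path_def shift_def path_shift_def add.commute)

lemma path_shift_preserves: "distr start_law start_law path_shift = start_law"
proof -
  have "distr start_law start_law path_shift = distr start_law path_space path_shift"
    by (rule distr_cong) (simp_all add: sets_start_law)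
  also have "\<dots> = distr P path_space (path_shift \<circ> forward_path)"
    unfolding forward_law[symmetric]
    by (rule distr_distr[OF path_shift_measurable measurable_P[OF forward_path_measurable]])
  also have "\<dots> = distr P path_space (forward_path \<circ> shift)"
    by (intro arg_cong[where f="distr P path_space"]) (auto simp: forward_path_shift)
  also have "\<dots> = distr (distr P P shift) path_space forward_path"
    by (rule distr_distr[symmetric, OF measurable_P[OF forward_path_measurable] shift_measurable])
  also have "\<dots> = start_law" by (simp add: stationary_lawD(4) forward_law)
  finally show ?thesis .
qed

text \<open>A set of one-sided paths that is invariant pulls back to an invariant set of two-sided paths of the same
  probability.\<close>

lemma path_shift_ergodic:
  assumes erg: "shift_ergodic P" and A: "A \<in> sets start_law" and inv: "path_shift -` A \<inter> space start_law = A"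
  shows "measure start_law A = 0 \<or> measure start_law A = 1"
proof -
  have A': "A \<in> sets path_space" using A by (simp add: sets_start_law)
  have sp: "space start_law = space path_space" by (rule sets_eq_imp_space_eq[OF sets_start_law])
  let ?B = "forward_path -` A \<inter> space P"
  have B: "?B \<in> sets P" by (rule measurable_sets[OF measurable_P[OF forward_path_measurable] A'])
  have inv': "\<eta> \<in> A \<longleftrightarrow> path_shift \<eta> \<in> A" if "\<eta> \<in> space path_space" for \<eta>
    using inv that unfolding sp by auto
  have "shift -` ?B \<inter> space P = ?B"
    using measurable_space[OF shift_measurable] measurable_space[OF measurable_P[OF forward_path_measurable]]
    by (auto simp: forward_path_shift inv')
  with erg B have "measure P ?B = 0 \<or> measure P ?B = 1" by (simp add: shift_ergodic_def)
  moreover have "measure start_law A = measure P ?B"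
    unfolding forward_law[symmetric] by (rule measure_distr[OF measurable_P[OF forward_path_measurable] A'])
  ultimately show ?thesis by simp
qed

end
end

section \<open>A martingale central limit theorem along a Markov chain\<close>

lemma exp_minus_second_order:
  assumes "0 \<le> (x::real)"
  shows "0 \<le> exp (- x) - (1 - x)" "exp (- x) - (1 - x) \<le> x\<^sup>2 / 2"
proof -
  show "0 \<le> exp (- x) - (1 - x)" using exp_ge_add_one_self[of "- x"] by simp
  define g where "g t = t\<^sup>2 / 2 - exp (- t) + 1 - t" for t :: real
  have "g 0 \<le> g x"
  proof (rule DERIV_nonneg_imp_nondecreasing[OF assms])
    fix t :: real assume "0 \<le> t" "t \<le> x"
    have "(g has_real_derivative (t + exp (- t) - 1)) (at t)"
      unfolding g_def[abs_def] by (auto intro!: derivative_eq_intros)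
    moreover have "0 \<le> t + exp (- t) - 1" using exp_ge_add_one_self[of "- t"] by simp
    ultimately show "\<exists>y. (g has_real_derivative y) (at t) \<and> 0 \<le> y" by blast
  qed
  then show "exp (- x) - (1 - x) \<le> x\<^sup>2 / 2" by (simp add: g_def)
qed

text \<open>Lindeberg's estimate for a single variable: the characteristic function is expanded to second order and
  compared with a Gaussian of the same variance. Where \<open>|X| \<le> \<epsilon>\<close> the cubic
  remainder is at most \<open>\<epsilon> X\<^sup>2\<close>, elsewhere the quadratic one is taken; the
  second-order error of the Gaussian is handled by \<open>q\<^sup>2 \<le> q (\<epsilon>\<^sup>2 +
  l)\<close>.\<close>

lemma (in prob_space) char_fun_gaussian_error:
  fixes X :: "'a \<Rightarrow> real"
  assumes X[measurable]: "X \<in> borel_measurable M" and X1: "integrable M X" and X2: "integrable M (\<lambda>x. (X x)\<^sup>2)"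
    and mean: "expectation X = 0" and C: "expectation (\<lambda>x. (X x)\<^sup>2) \<le> C"
    and \<epsilon>: "0 < \<epsilon>" "\<epsilon> \<le> 1"
  defines "q \<equiv> expectation (\<lambda>x. (X x)\<^sup>2)" and "l \<equiv> expectation (\<lambda>x. (X x)\<^sup>2 * indicator {r. \<epsilon> < \<bar>r\<bar>} (X x))"
  shows "cmod (expectation (\<lambda>x. iexp (X x)) - exp (- (q / 2))) \<le> 2 * \<epsilon> * q + (1 + C) * l"
proof -
  have m[measurable]: "{r::real. \<epsilon> < \<bar>r\<bar>} \<in> sets borel" by measurable
  have il: "integrable M (\<lambda>x. (X x)\<^sup>2 * indicator {r. \<epsilon> < \<bar>r\<bar>} (X x))"
    by (rule Bochner_Integration.integrable_bound[OF X2]) (auto intro!: AE_I2 simp: indicator_def)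
  have q0: "0 \<le> q" and l0: "0 \<le> l" unfolding q_def l_def by simp_all
  have "q \<le> expectation (\<lambda>x. \<epsilon>\<^sup>2 + (X x)\<^sup>2 * indicator {r. \<epsilon> < \<bar>r\<bar>} (X x))"
    unfolding q_def
  proof (intro integral_mono X2)
    show "(X x)\<^sup>2 \<le> \<epsilon>\<^sup>2 + (X x)\<^sup>2 * indicator {r. \<epsilon> < \<bar>r\<bar>} (X x)" for x
      using \<epsilon> power_mono[of "\<bar>X x\<bar>" \<epsilon> 2] by (auto simp: indicator_def not_less)
  qed (use il in simp)
  also have "\<dots> = \<epsilon>\<^sup>2 + l" unfolding l_def using il by (simp add: prob_space)
  finally have q_le: "q \<le> \<epsilon>\<^sup>2 + l" .
  have "cmod (char (distr M borel X) 1 - (1 - 1\<^sup>2 * q / 2)) \<le>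
      (1\<^sup>2 / 6) * expectation (\<lambda>x. min (6 * (X x)\<^sup>2) (\<bar>1\<bar> * \<bar>X x\<bar> ^ 3))"
    by (rule char_approx3'[OF X X1 X2 mean _ refl]) (simp add: q_def mean)
  then have "cmod (expectation (\<lambda>x. iexp (X x)) - complex_of_real (1 - q / 2)) \<le>
      expectation (\<lambda>x. min (6 * (X x)\<^sup>2) (\<bar>X x\<bar> ^ 3)) / 6"
    by (simp add: char_def integral_distr)
  also have "\<dots> \<le> expectation (\<lambda>x. \<epsilon> * (X x)\<^sup>2 + 6 * ((X x)\<^sup>2 * indicator {r. \<epsilon> < \<bar>r\<bar>} (X x))) / 6"
  proof (intro divide_right_mono integral_mono)
    show "min (6 * (X x)\<^sup>2) (\<bar>X x\<bar> ^ 3) \<le> \<epsilon> * (X x)\<^sup>2 + 6 * ((X x)\<^sup>2 * indicator {r. \<epsilon> < \<bar>r\<bar>} (X x))" for x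
    proof (cases "\<epsilon> < \<bar>X x\<bar>")
      case True
      have "min (6 * (X x)\<^sup>2) (\<bar>X x\<bar> ^ 3) \<le> 6 * (X x)\<^sup>2" by (rule min.cobounded1)
      moreover have "0 \<le> \<epsilon> * (X x)\<^sup>2" using \<epsilon> by simp
      ultimately show ?thesis using True by (simp add: indicator_def)
    next
      case False
      then have "\<bar>X x\<bar> * \<bar>X x\<bar>\<^sup>2 \<le> \<epsilon> * \<bar>X x\<bar>\<^sup>2" by (intro mult_right_mono) auto
      then have "\<bar>X x\<bar> ^ 3 \<le> \<epsilon> * (X x)\<^sup>2" by (simp add: power3_eq_cube power2_eq_square)
      then show ?thesis using False by (simp add: indicator_def min.coboundedI2)
    qed
    show "integrable M (\<lambda>x. min (6 * (X x)\<^sup>2) (\<bar>X x\<bar> ^ 3))"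
      by (rule Bochner_Integration.integrable_bound[of _ "\<lambda>x. 6 * (X x)\<^sup>2"]) (use X2 in \<open>auto intro!: AE_I2\<close>)
  qed (use X2 il in auto)
  also have "\<dots> = \<epsilon> * q / 6 + l" unfolding q_def l_def using X2 il by simp
  finally have 1: "cmod (expectation (\<lambda>x. iexp (X x)) - complex_of_real (1 - q / 2)) \<le> \<epsilon> * q / 6 + l" .
  have "cmod (complex_of_real (1 - q / 2) - exp (- (q / 2))) = \<bar>(1 - q / 2) - exp (- (q / 2))\<bar>"
    by (simp only: of_real_diff[symmetric] norm_of_real)
  also have "\<dots> \<le> (q / 2)\<^sup>2 / 2" using exp_minus_second_order[of "q / 2"] q0 by auto
  also have "\<dots> \<le> (\<epsilon> * q + C * l) / 8"
  proof -
    have "q * q \<le> q * (\<epsilon>\<^sup>2 + l)" by (rule mult_left_mono[OF q_le q0])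
    also have "\<dots> = \<epsilon> * (\<epsilon> * q) + q * l" by (simp add: power2_eq_square algebra_simps)
    also have "\<dots> \<le> 1 * (\<epsilon> * q) + C * l"
      using \<epsilon> q0 l0 C by (intro add_mono mult_right_mono) (auto simp: q_def)
    finally show ?thesis by (simp add: power2_eq_square)
  qed
  finally have 2: "cmod (complex_of_real (1 - q / 2) - exp (- (q / 2))) \<le> (\<epsilon> * q + C * l) / 8" .
  have "0 \<le> C" by (rule order_trans[OF q0 C[folded q_def]])
  then have "0 \<le> \<epsilon> * q" "0 \<le> C * l" using \<epsilon> q0 l0 by simp_all
  moreover have "u / 6 + l + (u + w) / 8 \<le> 2 * u + (l + w)" if "0 \<le> u" "0 \<le> w" for u w :: real
  proof -
    have "u / 6 + l + (u + w) / 8 \<le> u + l + (u + w)"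
      using that by (intro add_mono) auto
    then show ?thesis by simp
  qed
  ultimately have "\<epsilon> * q / 6 + l + (\<epsilon> * q + C * l) / 8 \<le> 2 * (\<epsilon> * q) + (l + C * l)"
    by blast
  then have "\<epsilon> * q / 6 + l + (\<epsilon> * q + C * l) / 8 \<le> 2 * \<epsilon> * q + (1 + C) * l"
    by (simp only: mult.assoc distrib_right mult_1)
  then show ?thesis
    using norm_triangle_mono[OF 1 2] by simp
qed

context markov_kernel begin

lemma measurable_integral_Q_dependent:
  fixes F :: "'a \<Rightarrow> 'a \<Rightarrow> 'c::{banach, second_countable_topology}"
  assumes F: "case_prod F \<in> borel_measurable (\<mu> \<Otimes>\<^sub>M \<mu>)"
  shows "(\<lambda>s. \<integral>s'. F s s' \<partial>Q s) \<in> borel_measurable \<mu>"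
proof -
  have "(\<lambda>s. distr (Q s) (\<mu> \<Otimes>\<^sub>M \<mu>) (Pair s)) \<in> \<mu> \<rightarrow>\<^sub>M subprob_algebra (\<mu> \<Otimes>\<^sub>M \<mu>)"
    by (rule measurable_distr2[OF _ kernel_subprob]) simp
  from measurable_compose[OF this integral_measurable_subprob_algebra[OF F]]
  have "(\<lambda>s. integral\<^sup>L (distr (Q s) (\<mu> \<Otimes>\<^sub>M \<mu>) (Pair s)) (case_prod F)) \<in> borel_measurable \<mu>" .
  then show ?thesis
  proof (rule measurable_cong[THEN iffD1, rotated])
    fix s assume s: "s \<in> space \<mu>"
    show "integral\<^sup>L (distr (Q s) (\<mu> \<Otimes>\<^sub>M \<mu>) (Pair s)) (case_prod F) = (\<integral>s'. F s s' \<partial>Q s)"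
      by (subst integral_distr[OF measurable_Q[OF s measurable_Pair1'[OF s]] F]) simp
  qed
qed

lemma measurable_path_transition:
  assumes F: "case_prod F \<in> borel_measurable (\<mu> \<Otimes>\<^sub>M \<mu>)"
  shows "(\<lambda>\<omega>. F (\<omega> i) (\<omega> j)) \<in> borel_measurable path_space"
proof -
  have "(\<lambda>\<omega>. (\<omega> i, \<omega> j)) \<in> path_space \<rightarrow>\<^sub>M \<mu> \<Otimes>\<^sub>M \<mu>"
    using measurable_path_coordinate[of "\<lambda>x. x" \<mu>] by (intro measurable_Pair) auto
  from measurable_compose[OF this F] show ?thesis by simp
qed

definition cond_var :: "(nat \<Rightarrow> 'a \<Rightarrow> 'a \<Rightarrow> real) \<Rightarrow> nat \<Rightarrow> 'a \<Rightarrow> real" where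
  "cond_var y k s = (\<integral>s'. (y k s s')\<^sup>2 \<partial>Q s)"

definition cond_tail :: "real \<Rightarrow> (nat \<Rightarrow> 'a \<Rightarrow> 'a \<Rightarrow> real) \<Rightarrow> nat \<Rightarrow> 'a \<Rightarrow> real" where
  "cond_tail \<epsilon> y k s = (\<integral>s'. (y k s s')\<^sup>2 * indicator {r. \<epsilon> < \<bar>r\<bar>} (y k s s') \<partial>Q s)"

definition cond_centred :: "(nat \<Rightarrow> 'a \<Rightarrow> 'a \<Rightarrow> real) \<Rightarrow> nat \<Rightarrow> 'a \<Rightarrow> bool" where
  "cond_centred y k s \<longleftrightarrow> integrable (Q s) (y k s) \<and> integrable (Q s) (\<lambda>s'. (y k s s')\<^sup>2) \<and> (\<integral>s'. y k s s' \<partial>Q s) = 0"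

text \<open>This is \<open>1\<close> as long as the conditional variance accumulated up to and including step
  \<open>k\<close> is at most \<open>C\<close>, and \<open>0\<close> afterwards. It depends on
  \<open>\<omega> 0, \<dots>, \<omega> k\<close>, hence it is known before the step from \<open>\<omega>
  k\<close> to \<open>\<omega> (k + 1)\<close> is taken; multiplying the increments by it stops the
  martingale before its variance exceeds \<open>C\<close>.\<close>

definition running :: "(nat \<Rightarrow> 'a \<Rightarrow> 'a \<Rightarrow> real) \<Rightarrow> real \<Rightarrow> nat \<Rightarrow> (nat \<Rightarrow> 'a) \<Rightarrow> real" where
  "running y C k \<omega> = of_bool ((\<Sum>j\<le>k. cond_var y j (\<omega> j)) \<le> C)"

definition stopped_mart :: "(nat \<Rightarrow> 'a \<Rightarrow> 'a \<Rightarrow> real) \<Rightarrow> real \<Rightarrow> nat \<Rightarrow> (nat \<Rightarrow> 'a) \<Rightarrow> real" where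
  "stopped_mart y C n \<omega> = (\<Sum>k<n. running y C k \<omega> * y k (\<omega> k) (\<omega> (Suc k)))"

definition stopped_var :: "(nat \<Rightarrow> 'a \<Rightarrow> 'a \<Rightarrow> real) \<Rightarrow> real \<Rightarrow> nat \<Rightarrow> (nat \<Rightarrow> 'a) \<Rightarrow> real" where
  "stopped_var y C n \<omega> = (\<Sum>k<n. running y C k \<omega> * cond_var y k (\<omega> k))"

definition stopped_tail :: "real \<Rightarrow> (nat \<Rightarrow> 'a \<Rightarrow> 'a \<Rightarrow> real) \<Rightarrow> real \<Rightarrow> nat \<Rightarrow> (nat \<Rightarrow> 'a) \<Rightarrow> real" where
  "stopped_tail \<epsilon> y C n \<omega> = (\<Sum>k<n. running y C k \<omega> * cond_tail \<epsilon> y k (\<omega> k))"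

lemma cond_var_nonneg: "0 \<le> cond_var y k s" by (simp add: cond_var_def)
lemma cond_tail_nonneg: "0 \<le> cond_tail \<epsilon> y k s" by (simp add: cond_tail_def)

lemma running_cases: "running y C k \<omega> = 0 \<or> running y C k \<omega> = 1 \<and> (\<Sum>j\<le>k. cond_var y j (\<omega> j)) \<le> C"
  by (simp add: running_def)

lemma stopped_var_bounds:
  assumes "0 \<le> C"
  shows "0 \<le> stopped_var y C n \<omega>" "stopped_var y C n \<omega> \<le> C"
proof -
  show "0 \<le> stopped_var y C n \<omega>"
    unfolding stopped_var_def by (intro sum_nonneg mult_nonneg_nonneg cond_var_nonneg) (simp add: running_def)
  have "stopped_var y C n \<omega> \<le> C \<and> stopped_var y C n \<omega> \<le> (\<Sum>j<n. cond_var y j (\<omega> j))"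
  proof (induction n)
    case (Suc n)
    then show ?case
      using running_cases[of y C n \<omega>] cond_var_nonneg[of y n "\<omega> n"]
      by (auto simp: stopped_var_def lessThan_Suc_atMost[symmetric])
  qed (simp add: stopped_var_def assms)
  then show "stopped_var y C n \<omega> \<le> C" by simp
qed

lemma unstopped:
  assumes "(\<Sum>j<n. cond_var y j (\<omega> j)) \<le> C"
  shows "stopped_mart y C n \<omega> = (\<Sum>k<n. y k (\<omega> k) (\<omega> (Suc k)))"
    "stopped_var y C n \<omega> = (\<Sum>k<n. cond_var y k (\<omega> k))"
proof -
  have "running y C k \<omega> = 1" if "k < n" for k
  proof -
    have "(\<Sum>j\<le>k. cond_var y j (\<omega> j)) \<le> (\<Sum>j<n. cond_var y j (\<omega> j))"
      using that by (intro sum_mono2) (auto intro: cond_var_nonneg)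
    then show ?thesis using assms by (simp add: running_def)
  qed
  then show "stopped_mart y C n \<omega> = (\<Sum>k<n. y k (\<omega> k) (\<omega> (Suc k)))"
    "stopped_var y C n \<omega> = (\<Sum>k<n. cond_var y k (\<omega> k))"
    by (simp_all add: stopped_mart_def stopped_var_def)
qed

context
  fixes y :: "nat \<Rightarrow> 'a \<Rightarrow> 'a \<Rightarrow> real"
  assumes y_measurable: "\<And>k. case_prod (y k) \<in> borel_measurable (\<mu> \<Otimes>\<^sub>M \<mu>)"
begin

lemma cond_var_measurable: "cond_var y k \<in> borel_measurable \<mu>"
  unfolding cond_var_def[abs_def]
proof (rule measurable_integral_Q_dependent)
  show "(\<lambda>(s, s'). (y k s s')\<^sup>2) \<in> borel_measurable (\<mu> \<Otimes>\<^sub>M \<mu>)"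
    using borel_measurable_power[OF y_measurable, of k 2] by (simp add: split_beta')
qed

lemma cond_tail_measurable: "cond_tail \<epsilon> y k \<in> borel_measurable \<mu>"
  unfolding cond_tail_def[abs_def]
proof (rule measurable_integral_Q_dependent)
  have "(\<lambda>r::real. r\<^sup>2 * indicator {r. \<epsilon> < \<bar>r\<bar>} r) \<in> borel_measurable borel" by measurable
  from measurable_compose[OF y_measurable this]
  show "(\<lambda>(s, s'). (y k s s')\<^sup>2 * indicat_real {r. \<epsilon> < \<bar>r\<bar>} (y k s s')) \<in> borel_measurable (\<mu> \<Otimes>\<^sub>M \<mu>)"
    by (simp add: split_beta')
qed

lemma running_measurable: "running y C k \<in> borel_measurable path_space"
proof -
  have s: "(\<lambda>\<omega>. \<Sum>j\<le>k. cond_var y j (\<omega> j)) \<in> borel_measurable path_space"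
    by (intro borel_measurable_sum measurable_path_coordinate cond_var_measurable)
  have "(\<lambda>r::real. of_bool (r \<le> C) :: real) \<in> borel_measurable borel" by measurable
  from measurable_compose[OF s this] show ?thesis by (simp add: running_def[abs_def])
qed

lemma stopped_measurable:
  "stopped_mart y C n \<in> borel_measurable path_space"
  "stopped_var y C n \<in> borel_measurable path_space"
  "stopped_tail \<epsilon> y C n \<in> borel_measurable path_space"
  unfolding stopped_mart_def[abs_def] stopped_var_def[abs_def] stopped_tail_def[abs_def]
  by (intro borel_measurable_sum borel_measurable_times running_measurable measurable_path_coordinate
    measurable_path_transition cond_var_measurable cond_tail_measurable y_measurable)+

lemma adapted:
  assumes "\<And>i. i \<le> n \<Longrightarrow> \<omega> i = \<omega>' i"
  shows "running y C n \<omega> = running y C n \<omega>'" "stopped_mart y C n \<omega> = stopped_mart y C n \<omega>'"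
    "stopped_var y C (Suc n) \<omega> = stopped_var y C (Suc n) \<omega>'"
proof -
  have run: "running y C k \<omega> = running y C k \<omega>'" if "k \<le> n" for k
  proof -
    have "(\<Sum>j\<le>k. cond_var y j (\<omega> j)) = (\<Sum>j\<le>k. cond_var y j (\<omega>' j))"
      using that assms by (intro sum.cong) auto
    then show ?thesis by (simp add: running_def)
  qed
  from run show "running y C n \<omega> = running y C n \<omega>'" by simp
  show "stopped_mart y C n \<omega> = stopped_mart y C n \<omega>'"
    unfolding stopped_mart_def using run assms by (intro sum.cong) auto
  show "stopped_var y C (Suc n) \<omega> = stopped_var y C (Suc n) \<omega>'"
    unfolding stopped_var_def using run assms by (intro sum.cong) auto
qed

lemma measurable_transition_Q: "s \<in> space \<mu> \<Longrightarrow> y k s \<in> borel_measurable (Q s)"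
  using measurable_compose[OF measurable_Pair1' y_measurable, of s k] by (intro measurable_Q) simp_all

lemma cond_tail_le:
  assumes "s \<in> space \<mu>" "cond_centred y k s"
  shows "cond_tail \<epsilon> y k s \<le> cond_var y k s"
  unfolding cond_tail_def cond_var_def
proof (rule integral_mono)
  note [measurable] = measurable_transition_Q[OF assms(1)]
  have [measurable]: "{r::real. \<epsilon> < \<bar>r\<bar>} \<in> sets borel" by measurable
  show i: "integrable (Q s) (\<lambda>s'. (y k s s')\<^sup>2)" using assms(2) by (simp add: cond_centred_def)
  show "integrable (Q s) (\<lambda>s'. (y k s s')\<^sup>2 * indicat_real {r. \<epsilon> < \<bar>r\<bar>} (y k s s'))"
    by (rule Bochner_Integration.integrable_bound[OF i]) (auto intro!: AE_I2 simp: indicator_def)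
qed (auto simp: indicator_def)

text \<open>If \<open>S\<close> is the stopped martingale and \<open>V\<close> its conditional variance, then
  \<open>exp (i S + V / 2)\<close> is almost a martingale: given the past, one step multiplies it by
  \<open>\<Phi> / e\<close>, a characteristic function over the Gaussian one of the same variance. Stopping
  keeps \<open>exp (V / 2)\<close> bounded, so that the one-step errors add up.\<close>

lemma stopped_exponential_step:
  assumes M: "markov_law M" and good: "AE \<omega> in M. \<forall>k. cond_centred y k (\<omega> k)"
    and C: "0 \<le> C" and \<epsilon>: "0 < \<epsilon>" "\<epsilon> \<le> 1"
  defines "Z \<equiv> \<lambda>n \<omega>. iexp (stopped_mart y C n \<omega>) * complex_of_real (exp (stopped_var y C n \<omega> / 2))"
  defines "b \<equiv> \<lambda>n \<omega>. running y C n \<omega> * (2 * \<epsilon> * cond_var y n (\<omega> n) + (1 + C) * cond_tail \<epsilon> y n (\<omega> n))"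
  shows "integrable M (Z n)" "integrable M (b n)"
    "cmod ((\<integral>\<omega>. Z (Suc n) \<omega> \<partial>M) - (\<integral>\<omega>. Z n \<omega> \<partial>M)) \<le> exp (C / 2) * (\<integral>\<omega>. b n \<omega> \<partial>M)"
proof -
  note d = markov_lawD[OF M]
  interpret M: prob_space M by (rule d)
  note toM = markov_law_measurable[OF M]
  have [measurable]: "stopped_mart y C n \<in> borel_measurable path_space" "stopped_var y C n \<in> borel_measurable path_space"
    "running y C n \<in> borel_measurable path_space" for n
    by (rule stopped_measurable running_measurable)+
  have Vle: "exp (stopped_var y C n \<omega> / 2) \<le> exp (C / 2)" for n \<omega>
    using stopped_var_bounds(2)[OF C] by simp
  have Zm: "Z n \<in> borel_measurable path_space" for n
    unfolding Z_def by measurable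
  show Zi: "integrable M (Z n)" for n
    using Vle by (intro M.integrable_const_bound[where B="exp (C / 2)"] AE_I2 toM Zm) (simp add: Z_def norm_mult)
  \<comment> \<open>\<open>V\<close> is taken one step ahead in \<open>A\<close>: it is already determined by the past.\<close>
  define A where "A n \<omega> = iexp (stopped_mart y C n \<omega>) * complex_of_real (exp (stopped_var y C (Suc n) \<omega> / 2))" for n \<omega>
  define \<phi> where "\<phi> n s = (\<integral>s'. iexp (y n s s') \<partial>Q s)" for n s
  define \<Phi> where "\<Phi> n \<omega> = complex_of_real (running y C n \<omega>) * \<phi> n (\<omega> n) + complex_of_real (1 - running y C n \<omega>)" for n \<omega>
  define e where "e n \<omega> = complex_of_real (exp (- (running y C n \<omega> * cond_var y n (\<omega> n) / 2)))" for n \<omega>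
  have bound: "AE \<omega> in M. cmod (A n \<omega> * (\<Phi> n \<omega> - e n \<omega>)) \<le> exp (C / 2) * b n \<omega> \<and>
      0 \<le> b n \<omega> \<and> b n \<omega> \<le> 2 * \<epsilon> * C + (1 + C) * C"
    using good AE_space
  proof eventually_elim
    case (elim \<omega>)
    then have s: "\<omega> n \<in> space \<mu>" using d(3) path_component_space by auto
    interpret Qs: prob_space "Q (\<omega> n)" by (rule prob_space_Q[OF s])
    have g: "cond_centred y n (\<omega> n)" using elim by simp
    have A: "cmod (A n \<omega>) \<le> exp (C / 2)" using Vle by (simp add: A_def norm_mult)
    have b0: "0 \<le> b n \<omega>"
      unfolding b_def using cond_var_nonneg cond_tail_nonneg C \<epsilon>
      by (intro mult_nonneg_nonneg add_nonneg_nonneg) (auto simp: running_def)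
    have main: "cmod (\<Phi> n \<omega> - e n \<omega>) \<le> b n \<omega> \<and> b n \<omega> \<le> 2 * \<epsilon> * C + (1 + C) * C"
      using running_cases[of y C n \<omega>]
    proof
      assume "running y C n \<omega> = 0"
      then show ?thesis using C \<epsilon> by (simp add: \<Phi>_def e_def b_def)
    next
      assume r: "running y C n \<omega> = 1 \<and> (\<Sum>j\<le>n. cond_var y j (\<omega> j)) \<le> C"
      have "cond_var y n (\<omega> n) \<le> (\<Sum>j\<le>n. cond_var y j (\<omega> j))"
        by (rule member_le_sum) (auto intro: cond_var_nonneg)
      then have qC: "cond_var y n (\<omega> n) \<le> C" using r by simp
      have "cmod (\<phi> n (\<omega> n) - exp (- (cond_var y n (\<omega> n) / 2))) \<le>
          2 * \<epsilon> * cond_var y n (\<omega> n) + (1 + C) * cond_tail \<epsilon> y n (\<omega> n)"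
        unfolding \<phi>_def cond_var_def cond_tail_def
        by (rule Qs.char_fun_gaussian_error)
           (use g qC \<epsilon> measurable_transition_Q[OF s] in \<open>auto simp: cond_centred_def cond_var_def\<close>)
      moreover have "2 * \<epsilon> * cond_var y n (\<omega> n) + (1 + C) * cond_tail \<epsilon> y n (\<omega> n) \<le> 2 * \<epsilon> * C + (1 + C) * C"
        using qC order_trans[OF cond_tail_le[OF s g] qC] C \<epsilon> by (intro add_mono mult_left_mono) auto
      ultimately show ?thesis using r by (simp add: \<Phi>_def e_def b_def exp_of_real)
    qed
    have "cmod (A n \<omega> * (\<Phi> n \<omega> - e n \<omega>)) \<le> exp (C / 2) * b n \<omega>"
      unfolding norm_mult using A main by (intro mult_mono) auto
    then show ?case using b0 main by simp
  qed
  have bm: "b n \<in> borel_measurable path_space" for n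
    unfolding b_def
    by (intro borel_measurable_times borel_measurable_add borel_measurable_const running_measurable measurable_path_coordinate
      cond_var_measurable cond_tail_measurable)
  show bi: "integrable M (b n)"
  proof (rule M.integrable_const_bound[OF _ toM[OF bm], where B="2 * \<epsilon> * C + (1 + C) * C"])
    show "AE \<omega> in M. norm (b n \<omega>) \<le> 2 * \<epsilon> * C + (1 + C) * C"
      using bound by eventually_elim (elim conjE, simp only: real_norm_def abs_of_nonneg)
  qed
  have \<phi>m: "\<phi> n \<in> borel_measurable \<mu>"
    unfolding \<phi>_def[abs_def]
  proof (rule measurable_integral_Q_dependent)
    show "(\<lambda>(s, s'). iexp (y n s s')) \<in> borel_measurable (\<mu> \<Otimes>\<^sub>M \<mu>)"
      using measurable_compose[OF y_measurable[of n], of iexp borel] by (simp add: split_beta')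
  qed
  have [measurable]: "(\<lambda>\<omega>. \<phi> n (\<omega> n)) \<in> borel_measurable path_space" "(\<lambda>\<omega>. cond_var y n (\<omega> n)) \<in> borel_measurable path_space"
    by (intro measurable_path_coordinate \<phi>m cond_var_measurable)+
  have Am: "A n \<in> borel_measurable path_space" and \<Phi>m: "\<Phi> n \<in> borel_measurable path_space" and em: "e n \<in> borel_measurable path_space"
    unfolding A_def[abs_def] \<Phi>_def[abs_def] e_def[abs_def] by measurable
  have ZA: "Z n \<omega> = A n \<omega> * e n \<omega>" for \<omega>
    by (simp add: Z_def A_def e_def stopped_var_def exp_add[symmetric] add_divide_distrib flip: exp_of_real)
  have "(\<integral>\<omega>. Z (Suc n) \<omega> \<partial>M) = (\<integral>\<omega>. \<integral>s. Z (Suc n) (fun_upd \<omega> (Suc n) s) \<partial>Q (\<omega> n) \<partial>M)"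
  proof (rule markov_law_integral[OF M Zi])
    fix \<omega> :: "nat \<Rightarrow> 'a"
    have *: "stopped_path (Suc n) \<omega> i = \<omega> i" if "i \<le> Suc n" for i using that by (simp add: stopped_path_def min_def)
    show "Z (Suc n) (stopped_path (Suc n) \<omega>) = Z (Suc n) \<omega>"
      using adapted[of "Suc n" "stopped_path (Suc n) \<omega>" \<omega>] adapted[of n "stopped_path (Suc n) \<omega>" \<omega>] * by (simp add: Z_def)
  qed
  also have "\<dots> = (\<integral>\<omega>. A n \<omega> * \<Phi> n \<omega> \<partial>M)"
  proof (rule Bochner_Integration.integral_cong[OF refl])
    fix \<omega> assume "\<omega> \<in> space M"
    then have s: "\<omega> n \<in> space \<mu>" using d(3) path_component_space by auto
    interpret Qs: prob_space "Q (\<omega> n)" by (rule prob_space_Q[OF s])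
    have Zu: "Z (Suc n) (fun_upd \<omega> (Suc n) s) = A n \<omega> * iexp (running y C n \<omega> * y n (\<omega> n) s)" for s
    proof -
      have *: "fun_upd \<omega> (Suc n) s i = \<omega> i" if "i \<le> n" for i using that by simp
      have "stopped_mart y C (Suc n) (fun_upd \<omega> (Suc n) s) =
          stopped_mart y C n (fun_upd \<omega> (Suc n) s) + running y C n (fun_upd \<omega> (Suc n) s) * y n (\<omega> n) s"
        by (simp add: stopped_mart_def)
      then show ?thesis
        using adapted[of n "fun_upd \<omega> (Suc n) s" \<omega>] *
        by (simp add: Z_def A_def exp_add distrib_left)
    qed
    have "(\<integral>s. Z (Suc n) (fun_upd \<omega> (Suc n) s) \<partial>Q (\<omega> n)) = A n \<omega> * (\<integral>s. iexp (running y C n \<omega> * y n (\<omega> n) s) \<partial>Q (\<omega> n))"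
      unfolding Zu by simp
    also have "(\<integral>s. iexp (running y C n \<omega> * y n (\<omega> n) s) \<partial>Q (\<omega> n)) = \<Phi> n \<omega>"
      using running_cases[of y C n \<omega>] by (auto simp: \<Phi>_def \<phi>_def Qs.prob_space)
    finally show "(\<integral>s. Z (Suc n) (fun_upd \<omega> (Suc n) s) \<partial>Q (\<omega> n)) = A n \<omega> * \<Phi> n \<omega>" .
  qed
  finally have ZS: "(\<integral>\<omega>. Z (Suc n) \<omega> \<partial>M) = (\<integral>\<omega>. A n \<omega> * \<Phi> n \<omega> \<partial>M)" .
  have dm: "(\<lambda>\<omega>. A n \<omega> * (\<Phi> n \<omega> - e n \<omega>)) \<in> borel_measurable M"
    by (rule toM) (use Am \<Phi>m em in simp)
  have di: "integrable M (\<lambda>\<omega>. A n \<omega> * (\<Phi> n \<omega> - e n \<omega>))"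
  proof (rule Bochner_Integration.integrable_bound[OF integrable_mult_right[OF bi, of "exp (C / 2)"] dm])
    show "AE \<omega> in M. norm (A n \<omega> * (\<Phi> n \<omega> - e n \<omega>)) \<le> norm (exp (C / 2) * b n \<omega>)"
      using bound by eventually_elim (simp add: abs_of_nonneg)
  qed
  have "(\<integral>\<omega>. A n \<omega> * \<Phi> n \<omega> \<partial>M) = (\<integral>\<omega>. Z n \<omega> + A n \<omega> * (\<Phi> n \<omega> - e n \<omega>) \<partial>M)"
    by (simp add: ZA algebra_simps)
  also have "\<dots> = (\<integral>\<omega>. Z n \<omega> \<partial>M) + (\<integral>\<omega>. A n \<omega> * (\<Phi> n \<omega> - e n \<omega>) \<partial>M)"
    using Zi di by simp
  finally have "(\<integral>\<omega>. Z (Suc n) \<omega> \<partial>M) - (\<integral>\<omega>. Z n \<omega> \<partial>M) = (\<integral>\<omega>. A n \<omega> * (\<Phi> n \<omega> - e n \<omega>) \<partial>M)"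
    by (simp add: ZS)
  also have "cmod \<dots> \<le> (\<integral>\<omega>. cmod (A n \<omega> * (\<Phi> n \<omega> - e n \<omega>)) \<partial>M)" by (rule integral_norm_bound)
  also have "\<dots> \<le> (\<integral>\<omega>. exp (C / 2) * b n \<omega> \<partial>M)"
    using di bi bound by (intro integral_mono_AE) auto
  finally show "cmod ((\<integral>\<omega>. Z (Suc n) \<omega> \<partial>M) - (\<integral>\<omega>. Z n \<omega> \<partial>M)) \<le> exp (C / 2) * (\<integral>\<omega>. b n \<omega> \<partial>M)"
    by simp
qed

lemma stopped_exponential_bound:
  assumes M: "markov_law M" and good: "AE \<omega> in M. \<forall>k. cond_centred y k (\<omega> k)"
    and C: "0 \<le> C" and \<epsilon>: "0 < \<epsilon>" "\<epsilon> \<le> 1"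
  shows "cmod ((\<integral>\<omega>. iexp (stopped_mart y C n \<omega>) * complex_of_real (exp (stopped_var y C n \<omega> / 2)) \<partial>M) - 1) \<le>
    exp (C / 2) * (2 * \<epsilon> * C + (1 + C) * (\<integral>\<omega>. stopped_tail \<epsilon> y C n \<omega> \<partial>M))"
    and "integrable M (stopped_tail \<epsilon> y C n)"
    and "AE \<omega> in M. 0 \<le> stopped_tail \<epsilon> y C n \<omega> \<and> stopped_tail \<epsilon> y C n \<omega> \<le> C"
proof -
  note d = markov_lawD[OF M]
  interpret M: prob_space M by (rule d)
  define Z where "Z n \<omega> = iexp (stopped_mart y C n \<omega>) * complex_of_real (exp (stopped_var y C n \<omega> / 2))" for n \<omega>
  define b where "b n \<omega> = running y C n \<omega> * (2 * \<epsilon> * cond_var y n (\<omega> n) + (1 + C) * cond_tail \<epsilon> y n (\<omega> n))" for n \<omega>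
  have bi: "integrable M (b n)" for n
    unfolding b_def[abs_def] by (rule stopped_exponential_step(2)[OF M good C \<epsilon>])
  have tel: "cmod ((\<integral>\<omega>. Z n \<omega> \<partial>M) - 1) \<le> (\<Sum>k<n. exp (C / 2) * (\<integral>\<omega>. b k \<omega> \<partial>M))" for n
  proof (induction n)
    case 0 show ?case by (simp add: Z_def stopped_mart_def stopped_var_def M.prob_space)
  next
    case (Suc n)
    have "cmod ((\<integral>\<omega>. Z (Suc n) \<omega> \<partial>M) - 1) \<le> cmod ((\<integral>\<omega>. Z (Suc n) \<omega> \<partial>M) - (\<integral>\<omega>. Z n \<omega> \<partial>M)) + cmod ((\<integral>\<omega>. Z n \<omega> \<partial>M) - 1)"
      using norm_triangle_ineq[of "(\<integral>\<omega>. Z (Suc n) \<omega> \<partial>M) - (\<integral>\<omega>. Z n \<omega> \<partial>M)" "(\<integral>\<omega>. Z n \<omega> \<partial>M) - 1"] by simp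
    also have "\<dots> \<le> exp (C / 2) * (\<integral>\<omega>. b n \<omega> \<partial>M) + (\<Sum>k<n. exp (C / 2) * (\<integral>\<omega>. b k \<omega> \<partial>M))"
      unfolding b_def Z_def by (intro add_mono stopped_exponential_step(3)[OF M good C \<epsilon>] Suc[unfolded b_def Z_def])
    finally show ?case by (simp only: sum.lessThan_Suc add.commute)
  qed
  have tail: "AE \<omega> in M. 0 \<le> stopped_tail \<epsilon> y C n \<omega> \<and> stopped_tail \<epsilon> y C n \<omega> \<le> C" for n
    using good AE_space
  proof eventually_elim
    case (elim \<omega>)
    have "stopped_tail \<epsilon> y C n \<omega> \<le> stopped_var y C n \<omega>"
      unfolding stopped_tail_def stopped_var_def
      using elim d(3) path_component_space
      by (intro sum_mono mult_left_mono cond_tail_le) (auto simp: running_def)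
    moreover have "0 \<le> stopped_tail \<epsilon> y C n \<omega>"
      unfolding stopped_tail_def by (intro sum_nonneg mult_nonneg_nonneg cond_tail_nonneg) (simp add: running_def)
    ultimately show ?case using stopped_var_bounds(2)[OF C, of y n \<omega>] by simp
  qed
  note toM = markov_law_measurable[OF M]
  have ti: "integrable M (stopped_tail \<epsilon> y C n)" for n
  proof (rule M.integrable_const_bound[OF _ toM[OF stopped_measurable(3)], where B=C])
    show "AE \<omega> in M. norm (stopped_tail \<epsilon> y C n \<omega>) \<le> C" using tail[of n] by eventually_elim simp
  qed
  have vi: "integrable M (stopped_var y C n)" for n
    by (rule M.integrable_const_bound[OF AE_I2 toM[OF stopped_measurable(2)], where B=C])
       (simp add: stopped_var_bounds[OF C])
  have "(\<Sum>k<n. \<integral>\<omega>. b k \<omega> \<partial>M) = (\<integral>\<omega>. (\<Sum>k<n. b k \<omega>) \<partial>M)"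
    using bi by simp
  also have "\<dots> = (\<integral>\<omega>. 2 * \<epsilon> * stopped_var y C n \<omega> + (1 + C) * stopped_tail \<epsilon> y C n \<omega> \<partial>M)"
  proof (rule Bochner_Integration.integral_cong[OF refl])
    fix \<omega>
    have "b k \<omega> = 2 * \<epsilon> * (running y C k \<omega> * cond_var y k (\<omega> k)) + (1 + C) * (running y C k \<omega> * cond_tail \<epsilon> y k (\<omega> k))" for k
      by (simp add: b_def algebra_simps)
    then show "(\<Sum>k<n. b k \<omega>) = 2 * \<epsilon> * stopped_var y C n \<omega> + (1 + C) * stopped_tail \<epsilon> y C n \<omega>"
      by (simp only: sum.distrib sum_distrib_left[symmetric] stopped_var_def stopped_tail_def)
  qed
  also have "\<dots> = 2 * \<epsilon> * (\<integral>\<omega>. stopped_var y C n \<omega> \<partial>M) + (1 + C) * (\<integral>\<omega>. stopped_tail \<epsilon> y C n \<omega> \<partial>M)"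
    using ti vi by simp
  also have "\<dots> \<le> 2 * \<epsilon> * C + (1 + C) * (\<integral>\<omega>. stopped_tail \<epsilon> y C n \<omega> \<partial>M)"
  proof -
    have "(\<integral>\<omega>. stopped_var y C n \<omega> \<partial>M) \<le> C"
      by (rule M.integral_le_const[OF vi AE_I2]) (rule stopped_var_bounds(2)[OF C])
    then show ?thesis using \<epsilon> by simp
  qed
  finally have "(\<Sum>k<n. \<integral>\<omega>. b k \<omega> \<partial>M) \<le> 2 * \<epsilon> * C + (1 + C) * (\<integral>\<omega>. stopped_tail \<epsilon> y C n \<omega> \<partial>M)" .
  then have "exp (C / 2) * (\<Sum>k<n. \<integral>\<omega>. b k \<omega> \<partial>M) \<le> exp (C / 2) * (2 * \<epsilon> * C + (1 + C) * (\<integral>\<omega>. stopped_tail \<epsilon> y C n \<omega> \<partial>M))"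
    by (rule mult_left_mono) simp
  with tel[of n] show "cmod ((\<integral>\<omega>. iexp (stopped_mart y C n \<omega>) * complex_of_real (exp (stopped_var y C n \<omega> / 2)) \<partial>M) - 1) \<le>
    exp (C / 2) * (2 * \<epsilon> * C + (1 + C) * (\<integral>\<omega>. stopped_tail \<epsilon> y C n \<omega> \<partial>M))"
    by (simp only: Z_def[abs_def] sum_distrib_left)
  show "integrable M (stopped_tail \<epsilon> y C n)" by (rule ti)
  show "AE \<omega> in M. 0 \<le> stopped_tail \<epsilon> y C n \<omega> \<and> stopped_tail \<epsilon> y C n \<omega> \<le> C" by (rule tail)
qed

end

text \<open>The classical martingale central limit theorem with stopping. For \<open>C = v + 1\<close> the martingale
  is almost surely not stopped for large \<open>n\<close>, so \<open>exp (i S + V / 2)\<close>, which has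
  mean close to \<open>1\<close>, is close to \<open>exp (v / 2)\<close> times the exponential of interest.
  The stopped quantities are bounded, so almost sure convergence passes to the expectations.\<close>

theorem markov_martingale_clt:
  fixes y :: "nat \<Rightarrow> nat \<Rightarrow> 'a \<Rightarrow> 'a \<Rightarrow> real"
  assumes M: "markov_law M"
    and y: "\<And>n k. case_prod (y n k) \<in> borel_measurable (\<mu> \<Otimes>\<^sub>M \<mu>)"
    and good: "AE \<omega> in M. \<forall>n k. cond_centred (y n) k (\<omega> k)"
    and var: "AE \<omega> in M. (\<lambda>n. \<Sum>k<n. cond_var (y n) k (\<omega> k)) \<longlonglongrightarrow> v"
    and tail: "\<And>\<epsilon>. 0 < \<epsilon> \<Longrightarrow> AE \<omega> in M. (\<lambda>n. \<Sum>k<n. cond_tail \<epsilon> (y n) k (\<omega> k)) \<longlonglongrightarrow> 0"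
  shows "(\<lambda>n. \<integral>\<omega>. iexp (\<Sum>k<n. y n k (\<omega> k) (\<omega> (Suc k))) \<partial>M) \<longlonglongrightarrow> exp (- (v / 2))"
proof -
  note d = markov_lawD[OF M]
  interpret M: prob_space M by (rule d)
  note toM = markov_law_measurable[OF M]
  have good': "AE \<omega> in M. \<forall>k. cond_centred (y n) k (\<omega> k)" for n using good by eventually_elim simp
  have v0: "0 \<le> v"
  proof -
    obtain \<omega> where "(\<lambda>n. \<Sum>k<n. cond_var (y n) k (\<omega> k)) \<longlonglongrightarrow> v"
      using eventually_happens'[OF M.ae_filter_bot var] by blast
    then show ?thesis by (rule LIMSEQ_le_const) (auto intro!: sum_nonneg cond_var_nonneg)
  qed
  define C where "C = v + 1"
  have C: "0 \<le> C" "v < C" using v0 by (auto simp: C_def)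
  define Z where "Z n \<omega> = iexp (stopped_mart (y n) C n \<omega>) * complex_of_real (exp (stopped_var (y n) C n \<omega> / 2))" for n \<omega>
  define T where "T n \<omega> = iexp (\<Sum>k<n. y n k (\<omega> k) (\<omega> (Suc k)))" for n \<omega>
  have Zm: "Z n \<in> borel_measurable M" for n
  proof (rule toM)
    have [measurable]: "stopped_mart (y n) C n \<in> borel_measurable path_space" "stopped_var (y n) C n \<in> borel_measurable path_space"
      by (rule stopped_measurable[OF y])+
    show "Z n \<in> borel_measurable path_space" unfolding Z_def[abs_def] by measurable
  qed
  have Tm: "T n \<in> borel_measurable M" for n
  proof (rule toM)
    have [measurable]: "(\<lambda>\<omega>. \<Sum>k<n. y n k (\<omega> k) (\<omega> (Suc k))) \<in> borel_measurable path_space"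
      by (intro borel_measurable_sum measurable_path_transition y)
    show "T n \<in> borel_measurable path_space" unfolding T_def[abs_def] by measurable
  qed
  have Zb: "cmod (Z n \<omega>) \<le> exp (C / 2)" for n \<omega>
    using stopped_var_bounds(2)[OF C(1)] by (simp add: Z_def norm_mult)
  have Ti: "integrable M (T n)" for n
    by (rule M.integrable_const_bound[where B=1, OF _ Tm]) (simp add: T_def)
  have Zi: "integrable M (Z n)" for n
    by (rule M.integrable_const_bound[where B="exp (C / 2)", OF _ Zm]) (use Zb in simp)
  have EZ: "(\<lambda>n. \<integral>\<omega>. Z n \<omega> \<partial>M) \<longlonglongrightarrow> 1"
  proof (rule LIMSEQ_I)
    fix r :: real assume r: "0 < r"
    \<comment> \<open>This makes the part \<open>exp (C / 2) * 2 \<epsilon> C\<close> of the error bound at most \<open>r /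
      2\<close>; the other part tends to zero.\<close>
    define \<epsilon> where "\<epsilon> = min 1 (r / (4 * exp (C / 2) * (C + 1)))"
    have \<epsilon>: "0 < \<epsilon>" "\<epsilon> \<le> 1" using r C by (auto simp: \<epsilon>_def)
    have "exp (C / 2) * (2 * \<epsilon> * C) \<le> r / 2"
    proof -
      have "exp (C / 2) * (2 * \<epsilon> * C) \<le> 2 * exp (C / 2) * (C + 1) * \<epsilon>" using \<epsilon> C by (simp add: algebra_simps)
      also have "\<dots> \<le> 2 * exp (C / 2) * (C + 1) * (r / (4 * exp (C / 2) * (C + 1)))"
        using C by (intro mult_left_mono) (auto simp: \<epsilon>_def)
      also have "\<dots> = r / 2"
      proof -
        define D where "D = exp (C / 2) * (C + 1)"
        have "0 < D" using C by (simp add: D_def)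
        then have "2 * D * (r / (4 * D)) = r / 2" by simp
        then show ?thesis by (simp only: D_def mult.assoc)
      qed
      finally show ?thesis .
    qed
    have "(\<lambda>n. \<integral>\<omega>. stopped_tail \<epsilon> (y n) C n \<omega> \<partial>M) \<longlonglongrightarrow> (\<integral>\<omega>. 0 \<partial>M)"
    proof (rule integral_dominated_convergence[where w="\<lambda>_. C"])
      show "AE \<omega> in M. (\<lambda>n. stopped_tail \<epsilon> (y n) C n \<omega>) \<longlonglongrightarrow> 0"
        using tail[OF \<epsilon>(1)]
      proof eventually_elim
        case (elim \<omega>)
        have "0 \<le> stopped_tail \<epsilon> (y n) C n \<omega> \<and> stopped_tail \<epsilon> (y n) C n \<omega> \<le> (\<Sum>k<n. cond_tail \<epsilon> (y n) k (\<omega> k))" for n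
        proof
          have r01: "0 \<le> running (y n) C k \<omega>" "running (y n) C k \<omega> \<le> 1" for k by (simp_all add: running_def)
          show "0 \<le> stopped_tail \<epsilon> (y n) C n \<omega>"
            unfolding stopped_tail_def by (intro sum_nonneg mult_nonneg_nonneg cond_tail_nonneg r01)
          show "stopped_tail \<epsilon> (y n) C n \<omega> \<le> (\<Sum>k<n. cond_tail \<epsilon> (y n) k (\<omega> k))"
            unfolding stopped_tail_def by (intro sum_mono mult_left_le_one_le cond_tail_nonneg r01)
        qed
        then show ?case
          by (intro tendsto_sandwich[OF _ _ tendsto_const elim]) auto
      qed
      show "AE \<omega> in M. norm (stopped_tail \<epsilon> (y n) C n \<omega>) \<le> C" for n
        using stopped_exponential_bound(3)[of "y n" M C \<epsilon> n, OF y M good' C(1) \<epsilon>] by eventually_elim simp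
      show "stopped_tail \<epsilon> (y n) C n \<in> borel_measurable M" for n
        by (rule toM[OF stopped_measurable(3)[OF y]])
    qed auto
    then have "(\<lambda>n. exp (C / 2) * (2 * \<epsilon> * C + (1 + C) * (\<integral>\<omega>. stopped_tail \<epsilon> (y n) C n \<omega> \<partial>M))) \<longlonglongrightarrow> exp (C / 2) * (2 * \<epsilon> * C + (1 + C) * 0)"
      by (intro tendsto_intros) simp
    moreover have "exp (C / 2) * (2 * \<epsilon> * C + (1 + C) * 0) < r"
      using \<open>exp (C / 2) * (2 * \<epsilon> * C) \<le> r / 2\<close> r by simp
    ultimately have "\<forall>\<^sub>F n in sequentially. exp (C / 2) * (2 * \<epsilon> * C + (1 + C) * (\<integral>\<omega>. stopped_tail \<epsilon> (y n) C n \<omega> \<partial>M)) < r"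
      by (rule order_tendstoD(2))
    then have "\<forall>\<^sub>F n in sequentially. norm ((\<integral>\<omega>. Z n \<omega> \<partial>M) - 1) < r"
      by eventually_elim (unfold Z_def, rule le_less_trans[OF stopped_exponential_bound(1)[OF y M good' C(1) \<epsilon>]])
    then show "\<exists>no. \<forall>n\<ge>no. norm ((\<integral>\<omega>. Z n \<omega> \<partial>M) - 1) < r"
      by (simp add: eventually_sequentially)
  qed
  have "(\<lambda>n. \<integral>\<omega>. T n \<omega> - complex_of_real (exp (- (v / 2))) * Z n \<omega> \<partial>M) \<longlonglongrightarrow> (\<integral>\<omega>. 0 \<partial>M)"
  proof (rule integral_dominated_convergence[where w="\<lambda>_. 1 + exp (- (v / 2)) * exp (C / 2)"])
    show "AE \<omega> in M. (\<lambda>n. T n \<omega> - complex_of_real (exp (- (v / 2))) * Z n \<omega>) \<longlonglongrightarrow> 0"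
      using var
    proof eventually_elim
      case (elim \<omega>)
      let ?s = "\<lambda>n. \<Sum>k<n. cond_var (y n) k (\<omega> k)"
      have "(\<lambda>n. cmod (complex_of_real (1 - exp (- (v / 2)) * exp (?s n / 2)))) \<longlonglongrightarrow> cmod (complex_of_real (1 - exp (- (v / 2)) * exp (v / 2)))"
        by (intro tendsto_intros elim) simp
      then have lim: "(\<lambda>n. cmod (complex_of_real (1 - exp (- (v / 2)) * exp (?s n / 2)))) \<longlonglongrightarrow> 0"
        by (simp add: exp_add[symmetric] del: of_real_diff of_real_mult)
      have "\<forall>\<^sub>F n in sequentially. ?s n < C" by (rule order_tendstoD(2)[OF elim C(2)])
      then have "\<forall>\<^sub>F n in sequentially. cmod (T n \<omega> - complex_of_real (exp (- (v / 2))) * Z n \<omega>) \<le> cmod (complex_of_real (1 - exp (- (v / 2)) * exp (?s n / 2)))"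
      proof eventually_elim
        case (elim n)
        have "T n \<omega> - complex_of_real (exp (- (v / 2))) * Z n \<omega> = T n \<omega> * complex_of_real (1 - exp (- (v / 2)) * exp (?s n / 2))"
          using unstopped[OF less_imp_le[OF elim]] by (simp add: Z_def T_def algebra_simps)
        then show ?case by (simp add: norm_mult T_def del: of_real_diff of_real_mult)
      qed
      then show ?case by (rule Lim_null_comparison[OF _ lim])
    qed
    show "AE \<omega> in M. norm (T n \<omega> - complex_of_real (exp (- (v / 2))) * Z n \<omega>) \<le> 1 + exp (- (v / 2)) * exp (C / 2)" for n
    proof (rule AE_I2)
      fix \<omega>
      have "norm (T n \<omega> - complex_of_real (exp (- (v / 2))) * Z n \<omega>) \<le> norm (T n \<omega>) + norm (complex_of_real (exp (- (v / 2))) * Z n \<omega>)"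
        by (rule norm_triangle_ineq4)
      also have "\<dots> \<le> 1 + exp (- (v / 2)) * exp (C / 2)"
        using Zb[of n \<omega>] by (intro add_mono) (auto simp: T_def norm_mult)
      finally show "norm (T n \<omega> - complex_of_real (exp (- (v / 2))) * Z n \<omega>) \<le> 1 + exp (- (v / 2)) * exp (C / 2)" .
    qed
  qed (use Tm Zm in auto)
  then have "(\<lambda>n. (\<integral>\<omega>. T n \<omega> \<partial>M) - complex_of_real (exp (- (v / 2))) * (\<integral>\<omega>. Z n \<omega> \<partial>M)) \<longlonglongrightarrow> 0"
    using Ti Zi by simp
  from tendsto_add[OF this tendsto_mult_left[OF EZ, of "complex_of_real (exp (- (v / 2)))"]]
  have "(\<lambda>n. \<integral>\<omega>. T n \<omega> \<partial>M) \<longlonglongrightarrow> complex_of_real (exp (- (v / 2)))" by simp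
  then show ?thesis by (simp add: T_def exp_of_real)
qed

end

section \<open>The pointwise ergodic theorem\<close>

locale ergodic_system = prob_space +
  fixes T :: "'a \<Rightarrow> 'a"
  assumes T_measurable[measurable]: "T \<in> M \<rightarrow>\<^sub>M M"
    and T_preserves: "distr M M T = M"
    and T_ergodic: "\<And>A. A \<in> sets M \<Longrightarrow> T -` A \<inter> space M = A \<Longrightarrow> prob A = 0 \<or> prob A = 1"
begin

lemma
  fixes f :: "'a \<Rightarrow> real"
  assumes "integrable M f"
  shows integrable_compose_T: "integrable M (\<lambda>x. f (T x))"
    and integral_compose_T: "(\<integral>x. f (T x) \<partial>M) = (\<integral>x. f x \<partial>M)"
proof -
  have "integrable (distr M M T) f" using assms by (simp add: T_preserves)
  then show "integrable M (\<lambda>x. f (T x))" by (rule integrable_distr[OF T_measurable])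
  have "(\<integral>x. f x \<partial>distr M M T) = (\<integral>x. f (T x) \<partial>M)"
    using assms by (intro integral_distr) auto
  then show "(\<integral>x. f (T x) \<partial>M) = (\<integral>x. f x \<partial>M)" by (simp add: T_preserves)
qed

text \<open>The maximum of \<open>0\<close> and the first \<open>n\<close> ergodic sums, as a recursion along the
  orbit.\<close>

primrec running_max :: "('a \<Rightarrow> real) \<Rightarrow> nat \<Rightarrow> 'a \<Rightarrow> real" where
  "running_max f 0 x = 0"
| "running_max f (Suc n) x = max 0 (f x + running_max f n (T x))"

lemma running_max_mono: "running_max f n x \<le> running_max f (Suc n) x"
proof (induction n arbitrary: x)
  case (Suc n)
  show ?case unfolding running_max.simps(2)[of f "Suc n"] running_max.simps(2)[of f n x]
    using Suc[of "T x"] by linarith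
qed simp

lemma running_max_nonneg: "0 \<le> running_max f n x"
  by (cases n) simp_all

lemma sum_le_running_max: "(\<Sum>k<n. f ((T ^^ k) x)) \<le> running_max f n x"
proof (induction n arbitrary: x)
  case (Suc n)
  have "(\<Sum>k<Suc n. f ((T ^^ k) x)) = f x + (\<Sum>k<n. f ((T ^^ k) (T x)))"
    by (subst sum.lessThan_Suc_shift) (simp add: funpow_swap1)
  also have "\<dots> \<le> running_max f (Suc n) x" using Suc[of "T x"] by simp
  finally show ?case .
qed simp

lemma integrable_running_max:
  assumes "integrable M f" shows "integrable M (running_max f n)"
proof (induction n)
  case (Suc n)
  have "integrable M (\<lambda>x. max 0 (f x + running_max f n (T x)))"
    by (intro integrable_max integrable_zero Bochner_Integration.integrable_add assms integrable_compose_T Suc)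
  then show ?case by simp
qed (simp add: running_max.simps(1)[abs_def])

text \<open>The set where the ergodic sums are unbounded is invariant, so it is null or full. If it were full, the
  differences \<open>running_max f (n + 1) - running_max f n \<circ> T = max (- running_max f n \<circ> T)
  f\<close> would decrease to \<open>f\<close>; their integrals are nonnegative since \<open>T\<close>
  preserves the measure and the maxima increase, which contradicts the negative integral of
  \<open>f\<close>.\<close>

lemma birkhoff_sums_bounded_above:
  fixes f :: "'a \<Rightarrow> real"
  assumes f: "integrable M f" and neg: "(\<integral>x. f x \<partial>M) < 0"
  shows "AE x in M. \<exists>B. \<forall>n. (\<Sum>k<n. f ((T ^^ k) x)) \<le> B"
proof -
  let ?F = "running_max f"
  have Fm[measurable]: "?F n \<in> borel_measurable M" for n
    using integrable_running_max[OF f] by auto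
  define A where "A = {x \<in> space M. \<forall>m::nat. \<exists>n. real m < ?F n x}"
  have A[measurable]: "A \<in> sets M" unfolding A_def by measurable
  have mono: "?F n x \<le> ?F n' x" if "n \<le> n'" for n n' x
    using that by (rule lift_Suc_mono_le[of "\<lambda>n. ?F n x", OF running_max_mono])
  have unb: "(\<forall>m::nat. \<exists>n. real m < ?F n x) \<longleftrightarrow> (\<forall>m::nat. \<exists>n. real m < ?F n (T x))" for x
  proof safe
    fix m assume *: "\<forall>m::nat. \<exists>n. real m < ?F n x"
    obtain m' :: nat where m': "real m + \<bar>f x\<bar> < real m'" using reals_Archimedean2 by blast
    obtain n where n: "real m' < ?F n x" using * by blast
    then obtain k where "n = Suc k" by (cases n) auto
    then have "real m < ?F k (T x)" using n m' by (auto simp: max_def split: if_splits)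
    then show "\<exists>n. real m < ?F n (T x)" by blast
  next
    fix m assume *: "\<forall>m::nat. \<exists>n. real m < ?F n (T x)"
    obtain m' :: nat where m': "real m + \<bar>f x\<bar> < real m'" using reals_Archimedean2 by blast
    obtain n where n: "real m' < ?F n (T x)" using * by blast
    then have "real m < ?F (Suc n) x" using m' by auto
    then show "\<exists>n. real m < ?F n x" by blast
  qed
  have "T -` A \<inter> space M = A"
    using unb measurable_space[OF T_measurable] by (auto simp: A_def)
  then have "prob A = 0 \<or> prob A = 1" by (rule T_ergodic[OF A])
  moreover have "prob A \<noteq> 1"
  proof
    assume "prob A = 1"
    then have "AE x in M. x \<in> A" using A by (simp add: AE_in_set_eq_1)
    have "(\<lambda>n. \<integral>x. ?F (Suc n) x - ?F n (T x) \<partial>M) \<longlonglongrightarrow> (\<integral>x. f x \<partial>M)"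
    proof (rule integral_dominated_convergence[where w="\<lambda>x. \<bar>f x\<bar>"])
      show "AE x in M. (\<lambda>n. ?F (Suc n) x - ?F n (T x)) \<longlonglongrightarrow> f x"
        using \<open>AE x in M. x \<in> A\<close>
      proof eventually_elim
        case (elim x)
        then have "\<forall>m::nat. \<exists>n. real m < ?F n (T x)" using unb by (auto simp: A_def)
        moreover obtain m :: nat where "- f x < real m" using reals_Archimedean2 by blast
        ultimately obtain N where "- f x < ?F N (T x)" by (meson order_less_trans)
        then have "?F (Suc n) x - ?F n (T x) = f x" if "n \<ge> N" for n
          using mono[OF that, of "T x"] by auto
        then show ?case by (intro tendsto_eventually eventually_sequentiallyI)
      qed
      show "AE x in M. norm (?F (Suc n) x - ?F n (T x)) \<le> \<bar>f x\<bar>" for n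
      proof (rule AE_I2)
        fix x show "norm (?F (Suc n) x - ?F n (T x)) \<le> \<bar>f x\<bar>"
          using running_max_nonneg[of f n "T x"] by auto
      qed
    qed (use f in auto)
    moreover have "0 \<le> (\<integral>x. ?F (Suc n) x - ?F n (T x) \<partial>M)" for n
    proof -
      note i = integrable_running_max[OF f]
      have "(\<integral>x. ?F (Suc n) x - ?F n (T x) \<partial>M) = (\<integral>x. ?F (Suc n) x \<partial>M) - (\<integral>x. ?F n x \<partial>M)"
        using i integrable_compose_T[OF i] integral_compose_T[OF i]
        by (subst Bochner_Integration.integral_diff) (auto simp del: running_max.simps)
      moreover have "(\<integral>x. ?F n x \<partial>M) \<le> (\<integral>x. ?F (Suc n) x \<partial>M)"
        by (intro integral_mono i running_max_mono)
      ultimately show ?thesis by simp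
    qed
    ultimately have "0 \<le> (\<integral>x. f x \<partial>M)" by (intro LIMSEQ_le_const) auto
    then show False using neg by simp
  qed
  ultimately have "AE x in M. x \<notin> A"
    using A by (simp add: prob_eq_0)
  then show ?thesis
    using AE_space
  proof eventually_elim
    case (elim x)
    then obtain m :: nat where "\<And>n. ?F n x \<le> real m" by (auto simp: A_def not_less)
    then show ?case using sum_le_running_max[where f=f and x=x] by (meson order_trans)
  qed
qed

text \<open>The sums of \<open>f - c\<close> are bounded above for every \<open>c\<close> larger than the mean of
  \<open>f\<close>.\<close>

lemma birkhoff_upper:
  fixes f :: "'a \<Rightarrow> real"
  assumes f: "integrable M f"
  shows "AE x in M. \<forall>m. \<forall>\<^sub>F n in sequentially. (\<Sum>k<n. f ((T ^^ k) x)) / n \<le> (\<integral>x. f x \<partial>M) + 1 / real (Suc m)"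
  unfolding AE_all_countable
proof
  fix m
  define c where "c = (\<integral>x. f x \<partial>M) + 1 / (2 * real (Suc m))"
  have "(\<integral>x. f x - c \<partial>M) < 0" using f by (simp add: c_def prob_space)
  then have "AE x in M. \<exists>B. \<forall>n. (\<Sum>k<n. f ((T ^^ k) x) - c) \<le> B"
    using f by (intro birkhoff_sums_bounded_above) auto
  then show "AE x in M. \<forall>\<^sub>F n in sequentially. (\<Sum>k<n. f ((T ^^ k) x)) / n \<le> (\<integral>x. f x \<partial>M) + 1 / real (Suc m)"
  proof eventually_elim
    case (elim x)
    then obtain B where B: "(\<Sum>k<n. f ((T ^^ k) x)) - real n * c \<le> B" for n
      by (auto simp: sum_subtractf)
    have "\<forall>\<^sub>F n in sequentially. B / real n < 1 / (2 * real (Suc m))"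
      by (rule order_tendstoD[OF lim_const_over_n]) simp
    then show ?case
      using eventually_gt_at_top[of 0]
    proof eventually_elim
      case (elim n)
      have "(\<Sum>k<n. f ((T ^^ k) x)) / n \<le> (B + real n * c) / n"
        using B[of n] by (intro divide_right_mono) auto
      also have "\<dots> = B / n + c" using elim by (simp add: field_simps)
      also have "\<dots> \<le> (\<integral>x. f x \<partial>M) + (1 / (2 * real (Suc m)) + 1 / (2 * real (Suc m)))"
        using elim by (simp add: c_def)
      also have "\<dots> = (\<integral>x. f x \<partial>M) + 1 / real (Suc m)" by (simp add: field_simps)
      finally show ?case .
    qed
  qed
qed

theorem birkhoff:
  fixes f :: "'a \<Rightarrow> real"
  assumes f: "integrable M f"
  shows "AE x in M. (\<lambda>n. (\<Sum>k<n. f ((T ^^ k) x)) / n) \<longlonglongrightarrow> (\<integral>x. f x \<partial>M)"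
proof -
  have mf: "integrable M (\<lambda>x. - f x)" using f by simp
  show ?thesis
    using birkhoff_upper[OF f] birkhoff_upper[OF mf]
  proof eventually_elim
    case (elim x)
    show ?case
    proof (rule LIMSEQ_I)
      fix r :: real assume "0 < r"
      then obtain m where m: "inverse (real (Suc m)) < r" using reals_Archimedean by blast
      have "\<forall>\<^sub>F n in sequentially. norm ((\<Sum>k<n. f ((T ^^ k) x)) / n - (\<integral>x. f x \<partial>M)) < r"
        using elim(1)[rule_format, of m] elim(2)[rule_format, of m]
      proof eventually_elim
        case (elim n)
        then show ?case using m by (auto simp: sum_negf inverse_eq_divide abs_less_iff)
      qed
      then show "\<exists>no. \<forall>n\<ge>no. norm ((\<Sum>k<n. f ((T ^^ k) x)) / n - (\<integral>x. f x \<partial>M)) < r"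
        by (simp add: eventually_sequentially)
    qed
  qed
qed

end

section \<open>Weak convergence in the plane from characteristic functions\<close>

inductive trig_polynomial :: "(real \<times> real \<Rightarrow> complex) \<Rightarrow> bool" where
  monomial: "trig_polynomial (\<lambda>y. c * iexp (a * fst y + b * snd y))"
| add: "trig_polynomial f \<Longrightarrow> trig_polynomial g \<Longrightarrow> trig_polynomial (\<lambda>y. f y + g y)"

lemma trig_polynomial_mult:
  assumes "trig_polynomial f" "trig_polynomial g"
  shows "trig_polynomial (\<lambda>y. f y * g y)"
  using assms(1)
proof (induction f rule: trig_polynomial.induct)
  case (monomial c a b)
  show ?case using assms(2)
  proof (induction g rule: trig_polynomial.induct)
    case (monomial c' a' b')
    have "(\<lambda>y. (c * iexp (a * fst y + b * snd y)) * (c' * iexp (a' * fst y + b' * snd y))) =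
        (\<lambda>y. (c * c') * iexp ((a + a') * fst y + (b + b') * snd y))"
      by (auto simp: fun_eq_iff exp_add[symmetric] algebra_simps)
    then show ?case by (simp only: trig_polynomial.monomial)
  next
    case (add f g)
    from trig_polynomial.add[OF add.IH] show ?case by (simp add: distrib_left)
  qed
next
  case (add f1 f2)
  from trig_polynomial.add[OF add.IH] show ?case by (simp add: distrib_right)
qed

lemma trig_polynomial_const: "trig_polynomial (\<lambda>y. c)"
  using trig_polynomial.monomial[of c 0 0] by simp

lemma trig_polynomial_sin:
  "trig_polynomial (\<lambda>y. complex_of_real (sin (a * fst y + b * snd y)))"
proof -
  have "trig_polynomial (\<lambda>y. (- \<i> / 2) * iexp (a * fst y + b * snd y) + (\<i> / 2) * iexp ((- a) * fst y + (- b) * snd y))"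
    by (intro trig_polynomial.intros)
  moreover have "(- \<i> / 2) * iexp (a * fst y + b * snd y) + (\<i> / 2) * iexp ((- a) * fst y + (- b) * snd y) =
      complex_of_real (sin (a * fst y + b * snd y))" for y :: "real \<times> real"
  proof -
    define \<theta> where "\<theta> = a * fst y + b * snd y"
    have *: "(- a) * fst y + (- b) * snd y = - \<theta>" by (simp add: \<theta>_def)
    show ?thesis unfolding * \<theta>_def[symmetric] cis_conv_exp[symmetric] by (simp add: complex_eq_iff)
  qed
  ultimately show ?thesis by simp
qed

lemma trig_polynomial_compose_sin:
  fixes p :: "real \<times> real \<Rightarrow> real"
  assumes "real_polynomial_function p"
  shows "trig_polynomial (\<lambda>y. complex_of_real (p (sin (a * fst y), sin (a * snd y))))"
  using assms
proof (induction p rule: real_polynomial_function.induct)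
  case (linear f)
  have f: "f (u, v) = u * f (1, 0) + v * f (0, 1)" for u v
    using linear_add[OF bounded_linear.linear[OF linear], of "u *\<^sub>R (1, 0)" "v *\<^sub>R (0, 1)"]
      linear_scale[OF bounded_linear.linear[OF linear], of u "(1, 0)"]
      linear_scale[OF bounded_linear.linear[OF linear], of v "(0, 1)"] by simp
  have "trig_polynomial (\<lambda>y. complex_of_real (sin (a * fst y + 0 * snd y)) * complex_of_real (f (1, 0)) +
      complex_of_real (sin (0 * fst y + a * snd y)) * complex_of_real (f (0, 1)))"
    by (intro trig_polynomial.add trig_polynomial_mult trig_polynomial_const trig_polynomial_sin)
  then show ?case by (simp add: f[of "sin _" "sin _"])
next
  case (const c)
  then show ?case by (rule trig_polynomial_const)
next
  case (add f g)
  from trig_polynomial.add[OF add.IH] show ?case by simp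
next
  case (mult f g)
  from trig_polynomial_mult[OF mult.IH] show ?case by simp
qed

lemma trig_polynomial_continuous_bounded:
  assumes "trig_polynomial f"
  shows "continuous_on UNIV f \<and> (\<exists>B. \<forall>y. norm (f y) \<le> B)"
  using assms
proof (induction f rule: trig_polynomial.induct)
  case (monomial c a b)
  have "continuous_on UNIV (\<lambda>y::real \<times> real. c * iexp (a * fst y + b * snd y))"
    by (intro continuous_intros)
  moreover have "norm (c * iexp (a * fst y + b * snd y)) \<le> norm c" for y :: "real \<times> real"
    by (simp add: norm_mult)
  ultimately show ?case by blast
next
  case (add f g)
  then obtain A B where "\<And>y. norm (f y) \<le> A" "\<And>y. norm (g y) \<le> B" by blast
  then have "norm (f y + g y) \<le> A + B" for y by (intro norm_triangle_le add_mono)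
  with add show ?case by (blast intro: continuous_on_add)
qed

lemma integrable_continuous_bounded:
  fixes f :: "'b::topological_space \<Rightarrow> 'c::{banach, second_countable_topology}"
  assumes "prob_space M" "sets M = sets borel" "continuous_on UNIV f" "\<And>y. norm (f y) \<le> B"
  shows "integrable M (\<lambda>y. f y)"
proof -
  interpret prob_space M by fact
  have "f \<in> borel_measurable M"
    using borel_measurable_continuous_onI[OF assms(3)] by (simp add: measurable_cong_sets[OF assms(2) refl])
  then show ?thesis using assms(4) by (intro integrable_const_bound[where B=B]) auto
qed

lemma trig_polynomial_integral_tendsto:
  fixes \<nu> :: "nat \<Rightarrow> (real \<times> real) measure"
  assumes \<nu>: "\<And>n. prob_space (\<nu> n)" "\<And>n. sets (\<nu> n) = sets borel"
    and N: "prob_space N" "sets N = sets borel"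
    and char: "\<And>a b. (\<lambda>n. \<integral>y. iexp (a * fst y + b * snd y) \<partial>\<nu> n) \<longlonglongrightarrow> (\<integral>y. iexp (a * fst y + b * snd y) \<partial>N)"
    and f: "trig_polynomial f"
  shows "(\<lambda>n. \<integral>y. f y \<partial>\<nu> n) \<longlonglongrightarrow> (\<integral>y. f y \<partial>N)"
proof -
  have int: "integrable (\<nu> n) g" "integrable N g" if g: "trig_polynomial g" for g n
  proof -
    obtain B where "\<And>y. norm (g y) \<le> B" using trig_polynomial_continuous_bounded[OF g] by blast
    with trig_polynomial_continuous_bounded[OF g] show "integrable (\<nu> n) g" "integrable N g"
      by (metis integrable_continuous_bounded[OF \<nu>], metis integrable_continuous_bounded[OF N])
  qed
  show ?thesis using f
  proof (induction f rule: trig_polynomial.induct)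
    case (monomial c a b)
    show ?case using tendsto_mult_left[OF char, of c a b] by simp
  next
    case (add f g)
    show ?case using tendsto_add[OF add.IH] int[OF add.hyps(1)] int[OF add.hyps(2)] by simp
  qed
qed

definition tail_bump :: "real \<Rightarrow> real \<Rightarrow> real" where
  "tail_bump K x = min 1 (max 0 (\<bar>x\<bar> - K))"

lemma tail_bump: "0 \<le> tail_bump K x" "tail_bump K x \<le> 1" "K + 1 \<le> \<bar>x\<bar> \<Longrightarrow> tail_bump K x = 1"
    "\<bar>x\<bar> \<le> K \<Longrightarrow> tail_bump K x = 0" "continuous_on A (tail_bump K)"
  by (auto simp: tail_bump_def[abs_def] intro!: continuous_intros)

text \<open>One-dimensional projections converge weakly by Levy's continuity theorem; tightness is read off from the
  continuous bumps \<open>tail_bump K\<close>.\<close>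

lemma tight_of_char_convergence:
  fixes \<nu> :: "nat \<Rightarrow> (real \<times> real) measure" and X :: "real \<times> real \<Rightarrow> real"
  assumes \<nu>: "\<And>n. prob_space (\<nu> n)" "\<And>n. sets (\<nu> n) = sets borel"
    and N: "prob_space N" "sets N = sets borel"
    and X: "X \<in> borel_measurable borel"
    and char: "\<And>t. (\<lambda>n. \<integral>y. iexp (t * X y) \<partial>\<nu> n) \<longlonglongrightarrow> (\<integral>y. iexp (t * X y) \<partial>N)"
    and \<epsilon>: "\<epsilon> > 0"
  obtains K where "K > 0" "\<forall>\<^sub>F n in sequentially. (\<integral>y. tail_bump K (X y) \<partial>\<nu> n) < \<epsilon>" "(\<integral>y. tail_bump K (X y) \<partial>N) < \<epsilon>"
proof -
  have X\<nu>: "X \<in> borel_measurable (\<nu> n)" and XN: "X \<in> borel_measurable N" for n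
    using X by (simp_all add: measurable_cong_sets[OF \<nu>(2) refl] measurable_cong_sets[OF N(2) refl])
  have rd: "real_distribution (distr (\<nu> n) borel X)" "real_distribution (distr N borel X)" for n
    by (intro prob_space.real_distribution_distr \<nu> N X\<nu> XN)+
  have "weak_conv_m (\<lambda>n. distr (\<nu> n) borel X) (distr N borel X)"
  proof (rule levy_continuity[OF rd])
    show "(\<lambda>n. char (distr (\<nu> n) borel X) t) \<longlonglongrightarrow> char (distr N borel X) t" for t
      using char[of t] by (simp add: char_def integral_distr[OF X\<nu>] integral_distr[OF XN])
  qed
  have conv: "(\<lambda>n. \<integral>y. tail_bump K (X y) \<partial>\<nu> n) \<longlonglongrightarrow> (\<integral>y. tail_bump K (X y) \<partial>N)" for K
  proof -
    have c: "isCont (tail_bump K) x" for x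
      using tail_bump(5)[of UNIV K] by (simp add: continuous_on_eq_continuous_at)
    have m: "tail_bump K \<in> borel_measurable borel" by (rule borel_measurable_continuous_onI[OF tail_bump(5)])
    have "(\<lambda>n. integral\<^sup>L (distr (\<nu> n) borel X) (tail_bump K)) \<longlonglongrightarrow> integral\<^sup>L (distr N borel X) (tail_bump K)"
      by (rule weak_conv_imp_integral_bdd_continuous_conv[OF rd \<open>weak_conv_m _ _\<close> c, where B=1])
         (use tail_bump in auto)
    then show ?thesis by (simp add: integral_distr[OF X\<nu> m] integral_distr[OF XN m])
  qed
  interpret N: prob_space N by (rule N)
  have "(\<lambda>k. \<integral>y. tail_bump (real k) (X y) \<partial>N) \<longlonglongrightarrow> (\<integral>y. 0 \<partial>N)"
  proof (rule integral_dominated_convergence[where w="\<lambda>_. 1"])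
    show "AE y in N. (\<lambda>k. tail_bump (real k) (X y)) \<longlonglongrightarrow> 0"
    proof (rule AE_I2)
      fix y
      have "\<forall>\<^sub>F k in sequentially. \<bar>X y\<bar> \<le> real k"
        using eventually_ge_at_top[of "nat \<lceil>\<bar>X y\<bar>\<rceil>"] by eventually_elim linarith
      then have "\<forall>\<^sub>F k in sequentially. tail_bump (real k) (X y) = 0"
        by eventually_elim (rule tail_bump(4))
      then show "(\<lambda>k. tail_bump (real k) (X y)) \<longlonglongrightarrow> 0" by (rule tendsto_eventually)
    qed
    show "(\<lambda>y. tail_bump (real k) (X y)) \<in> borel_measurable N" for k
      by (rule measurable_compose[OF XN borel_measurable_continuous_onI[OF tail_bump(5)]])
    show "AE y in N. norm (tail_bump (real k) (X y)) \<le> 1" for k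
      by (rule AE_I2) (use tail_bump in auto)
  qed auto
  then have "(\<lambda>k. \<integral>y. tail_bump (real k) (X y) \<partial>N) \<longlonglongrightarrow> 0" by simp
  from order_tendstoD(2)[OF this \<epsilon>] eventually_gt_at_top[of 0]
  have "\<forall>\<^sub>F k in sequentially. (\<integral>y. tail_bump (real k) (X y) \<partial>N) < \<epsilon> \<and> k > 0"
    by (rule eventually_conj)
  then obtain k :: nat where k: "(\<integral>y. tail_bump (real k) (X y) \<partial>N) < \<epsilon>" "k > 0"
    by (auto simp: eventually_sequentially)
  show ?thesis
    by (rule that[of "real k"]) (use k order_tendstoD(2)[OF conv k(1)] in auto)
qed

lemma sin_rescaled_close:
  fixes L x R :: real
  assumes "L > 0" "\<bar>x\<bar> \<le> R"
  shows "\<bar>L * sin (x / L) - x\<bar> \<le> R\<^sup>2 / L" "\<bar>L * sin (x / L)\<bar> \<le> R"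
proof -
  have "\<bar>sin (x / L) - x / L\<bar> \<le> (x / L)\<^sup>2 / 2"
    using Maclaurin_sin_bound[of "x / L" 2] by (simp add: numeral_2_eq_2 sin_coeff_def)
  also have "\<dots> \<le> (x / L)\<^sup>2" by simp
  also have "\<dots> \<le> (R / L)\<^sup>2"
    using assms abs_le_square_iff[of x R] by (simp add: power_divide divide_right_mono)
  finally have "L * \<bar>sin (x / L) - x / L\<bar> \<le> L * (R / L)\<^sup>2" using assms by simp
  moreover have "L * \<bar>sin (x / L) - x / L\<bar> = \<bar>L * sin (x / L) - x\<bar>"
    using assms by (simp add: abs_mult_pos' right_diff_distrib)
  ultimately show "\<bar>L * sin (x / L) - x\<bar> \<le> R\<^sup>2 / L"
    using assms by (simp add: power2_eq_square)
  have "\<bar>L * sin (x / L)\<bar> \<le> L * \<bar>x / L\<bar>"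
    using abs_sin_x_le_abs_x[of "x / L"] assms by (simp add: abs_mult mult_left_mono del: times_divide_eq_right)
  then show "\<bar>L * sin (x / L)\<bar> \<le> R" using assms by simp
qed

text \<open>Replacing \<open>y\<close> by \<open>L sin (y / L)\<close> in both coordinates moves the points of a fixed
  square very little when \<open>L\<close> is large, and makes \<open>f\<close> a function of sines. By
  Weierstrass this function is uniformly close, on the whole plane, to a polynomial in the sines, which is a
  trigonometric polynomial. In contrast to a periodic extension no matching at the boundary of a square is
  needed.\<close>

lemma trig_polynomial_approximation:
  fixes f :: "real \<times> real \<Rightarrow> real"
  assumes f: "continuous_on UNIV f" and B: "\<And>y. \<bar>f y\<bar> \<le> B" and R: "R > 0" and \<epsilon>: "\<epsilon> > 0"
  obtains q where "trig_polynomial (\<lambda>y. complex_of_real (q y))" "\<And>y. \<bar>q y\<bar> \<le> B + \<epsilon>"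
    "\<And>y. \<bar>fst y\<bar> \<le> R \<Longrightarrow> \<bar>snd y\<bar> \<le> R \<Longrightarrow> \<bar>f y - q y\<bar> \<le> 2 * \<epsilon>"
proof -
  let ?C = "cbox (- R, - R) (R, R)"
  have "uniformly_continuous_on ?C f"
    using f by (intro compact_uniformly_continuous continuous_on_subset[OF f] compact_cbox) auto
  then obtain d where d: "d > 0" "\<And>x y. x \<in> ?C \<Longrightarrow> y \<in> ?C \<Longrightarrow> dist y x < d \<Longrightarrow> dist (f y) (f x) < \<epsilon>"
    using \<epsilon> unfolding uniformly_continuous_on_def by metis
  define L where "L = 4 * R\<^sup>2 / d"
  have L: "L > 0" using R d by (simp add: L_def)
  define D where "D = cbox (-1, -1) (1::real, 1::real)"
  have "continuous_on D (\<lambda>u. f (L * fst u, L * snd u))"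
    by (rule continuous_on_compose2[OF f]) (auto intro!: continuous_intros)
  moreover have "compact D" unfolding D_def by (rule compact_cbox)
  ultimately obtain p where p: "real_polynomial_function p" "\<And>u. u \<in> D \<Longrightarrow> \<bar>f (L * fst u, L * snd u) - p u\<bar> < \<epsilon>"
    using Stone_Weierstrass_real_polynomial_function \<epsilon> by blast
  define q where "q y = p (sin (1 / L * fst y), sin (1 / L * snd y))" for y
  define g where "g y = f (L * sin (fst y / L), L * sin (snd y / L))" for y
  have gq: "\<bar>g y - q y\<bar> < \<epsilon>" for y
    using p(2)[of "(sin (fst y / L), sin (snd y / L))"] by (simp add: D_def g_def q_def)
  show ?thesis
  proof (rule that)
    show "trig_polynomial (\<lambda>y. complex_of_real (q y))"
      unfolding q_def by (rule trig_polynomial_compose_sin[OF p(1)])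
    show "\<bar>q y\<bar> \<le> B + \<epsilon>" for y
      using gq[of y] B[of "(L * sin (fst y / L), L * sin (snd y / L))"] by (simp add: g_def)
    fix y :: "real \<times> real"
    assume y: "\<bar>fst y\<bar> \<le> R" "\<bar>snd y\<bar> \<le> R"
    note s = sin_rescaled_close[OF L y(1)] sin_rescaled_close[OF L y(2)]
    have "dist (L * sin (fst y / L), L * sin (snd y / L)) y \<le> dist (L * sin (fst y / L)) (fst y) + dist (L * sin (snd y / L)) (snd y)"
      by (cases y) (simp add: dist_Pair_Pair sqrt_sum_squares_le_sum)
    also have "\<dots> \<le> R\<^sup>2 / L + R\<^sup>2 / L" using s by (intro add_mono) (auto simp: dist_real_def)
    also have "\<dots> < d" using R d by (simp add: L_def)
    finally have "dist (f (L * sin (fst y / L), L * sin (snd y / L))) (f y) < \<epsilon>"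
      using s y by (intro d(2)) (cases y; auto simp: abs_le_iff)+
    then show "\<bar>f y - q y\<bar> \<le> 2 * \<epsilon>" using gq[of y] by (simp add: g_def dist_real_def)
  qed
qed

text \<open>Trigonometric polynomials pass to the limit by assumption. A bounded continuous \<open>f\<close> is
  approximated by one of them on a large square, and tightness makes the contribution of the complement
  small because both functions are bounded.\<close>

theorem weakly_converges_of_char:
  fixes \<nu> :: "nat \<Rightarrow> (real \<times> real) measure"
  assumes \<nu>: "\<And>n. prob_space (\<nu> n)" "\<And>n. sets (\<nu> n) = sets borel"
    and N: "prob_space N" "sets N = sets borel"
    and char: "\<And>a b. (\<lambda>n. \<integral>y. iexp (a * fst y + b * snd y) \<partial>\<nu> n) \<longlonglongrightarrow> (\<integral>y. iexp (a * fst y + b * snd y) \<partial>N)"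
  shows "weakly_converges \<nu> N"
  unfolding weakly_converges_def
proof (intro allI impI)
  fix f :: "real \<times> real \<Rightarrow> real"
  assume f: "continuous_on UNIV f" and "bounded (range f)"
  then obtain B where B: "\<And>y. \<bar>f y\<bar> \<le> B" by (auto simp: bounded_iff)
  have B0: "0 \<le> B" using B[of "(0, 0)"] by simp
  show "(\<lambda>n. \<integral>y. f y \<partial>\<nu> n) \<longlonglongrightarrow> (\<integral>y. f y \<partial>N)"
  proof (rule LIMSEQ_I)
    fix r :: real assume r: "0 < r"
    define \<epsilon> where "\<epsilon> = min 1 (r / (8 * B + 12))"
    have \<epsilon>: "\<epsilon> > 0" "\<epsilon> \<le> 1" and \<epsilon>r: "(8 * B + 12) * \<epsilon> \<le> r"
    proof -
      show "\<epsilon> > 0" "\<epsilon> \<le> 1" using r B0 by (auto simp: \<epsilon>_def)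
      have "(8 * B + 12) * \<epsilon> \<le> (8 * B + 12) * (r / (8 * B + 12))"
        using B0 by (intro mult_left_mono) (auto simp: \<epsilon>_def)
      then show "(8 * B + 12) * \<epsilon> \<le> r" using B0 by simp
    qed
    obtain K1 where K1: "K1 > 0" "\<forall>\<^sub>F n in sequentially. (\<integral>y. tail_bump K1 (fst y) \<partial>\<nu> n) < \<epsilon>" "(\<integral>y. tail_bump K1 (fst y) \<partial>N) < \<epsilon>"
      by (rule tight_of_char_convergence[OF \<nu> N _ _ \<epsilon>(1), of fst])
         (use char[of _ 0] in \<open>auto intro!: borel_measurable_continuous_onI continuous_on_fst continuous_on_snd continuous_on_id\<close>)
    obtain K2 where K2: "K2 > 0" "\<forall>\<^sub>F n in sequentially. (\<integral>y. tail_bump K2 (snd y) \<partial>\<nu> n) < \<epsilon>" "(\<integral>y. tail_bump K2 (snd y) \<partial>N) < \<epsilon>"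
      by (rule tight_of_char_convergence[OF \<nu> N _ _ \<epsilon>(1), of snd])
         (use char[of 0] in \<open>auto intro!: borel_measurable_continuous_onI continuous_on_fst continuous_on_snd continuous_on_id\<close>)
    define R where "R = max K1 K2 + 1"
    have R: "R > 0" using K1 by (simp add: R_def)
    obtain q where q: "trig_polynomial (\<lambda>y. complex_of_real (q y))" "\<And>y. \<bar>q y\<bar> \<le> B + \<epsilon>"
      "\<And>y. \<bar>fst y\<bar> \<le> R \<Longrightarrow> \<bar>snd y\<bar> \<le> R \<Longrightarrow> \<bar>f y - q y\<bar> \<le> 2 * \<epsilon>"
      by (rule trig_polynomial_approximation[OF f B R \<epsilon>(1)]) blast
    have qc: "continuous_on UNIV q"
    proof -
      have "continuous_on UNIV (\<lambda>y. Re (complex_of_real (q y)))"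
        using trig_polynomial_continuous_bounded[OF q(1)] by (intro continuous_on_Re) auto
      then show ?thesis by simp
    qed
    define \<psi> where "\<psi> y = tail_bump K1 (fst y) + tail_bump K2 (snd y)" for y :: "real \<times> real"
    have fq: "\<bar>f y - q y\<bar> \<le> 2 * \<epsilon> + (2 * B + 1) * \<psi> y" for y
    proof (cases "\<bar>fst y\<bar> \<le> R \<and> \<bar>snd y\<bar> \<le> R")
      case True
      moreover have "0 \<le> (2 * B + 1) * \<psi> y" using B0 by (simp add: \<psi>_def tail_bump)
      ultimately show ?thesis using q(3)[of y] by linarith
    next
      case False
      then have "tail_bump K1 (fst y) = 1 \<or> tail_bump K2 (snd y) = 1"
        using tail_bump(3)[of K1 "fst y"] tail_bump(3)[of K2 "snd y"] by (smt (verit) R_def max.cobounded1 max.cobounded2)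
      then have "1 \<le> \<psi> y" using tail_bump(1)[of K1 "fst y"] tail_bump(1)[of K2 "snd y"] by (auto simp: \<psi>_def)
      then have "(2 * B + 1) * 1 \<le> (2 * B + 1) * \<psi> y" using B0 by (intro mult_left_mono) auto
      moreover have "\<bar>f y - q y\<bar> \<le> \<bar>f y\<bar> + \<bar>q y\<bar>" by (rule abs_triangle_ineq4)
      ultimately show ?thesis using B[of y] q(2)[of y] \<epsilon> by simp
    qed
    have bnd: "\<bar>(\<integral>y. f y \<partial>M) - (\<integral>y. q y \<partial>M)\<bar> \<le> 2 * \<epsilon> + (2 * B + 1) * ((\<integral>y. tail_bump K1 (fst y) \<partial>M) + (\<integral>y. tail_bump K2 (snd y) \<partial>M))"
      if M: "prob_space M" "sets M = sets borel" for M
    proof -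
      interpret prob_space M by (rule M)
      have fi: "integrable M f" and qi: "integrable M q"
        using B q(2) by (auto intro!: integrable_continuous_bounded[OF M] f qc)
      have t1: "integrable M (\<lambda>y. tail_bump K1 (fst y))" and t2: "integrable M (\<lambda>y. tail_bump K2 (snd y))"
        using tail_bump
        by (auto intro!: integrable_continuous_bounded[OF M, where B=1] continuous_on_compose2[OF tail_bump(5)[of UNIV]] continuous_intros)
      have "\<bar>(\<integral>y. f y \<partial>M) - (\<integral>y. q y \<partial>M)\<bar> = \<bar>\<integral>y. f y - q y \<partial>M\<bar>" using fi qi by simp
      also have "\<dots> \<le> (\<integral>y. \<bar>f y - q y\<bar> \<partial>M)" by (rule integral_abs_bound)
      also have "\<dots> \<le> (\<integral>y. 2 * \<epsilon> + (2 * B + 1) * \<psi> y \<partial>M)"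
        using fi qi t1 t2 fq unfolding \<psi>_def by (intro integral_mono) auto
      also have "\<dots> = 2 * \<epsilon> + (2 * B + 1) * ((\<integral>y. tail_bump K1 (fst y) \<partial>M) + (\<integral>y. tail_bump K2 (snd y) \<partial>M))"
        unfolding \<psi>_def using t1 t2 by (simp add: prob_space)
      finally show ?thesis .
    qed
    have bndN: "\<bar>(\<integral>y. f y \<partial>N) - (\<integral>y. q y \<partial>N)\<bar> \<le> 2 * \<epsilon> + (2 * B + 1) * (\<epsilon> + \<epsilon>)"
      using bnd[OF N] K1(3) K2(3) B0 mult_left_mono[of "(\<integral>y. tail_bump K1 (fst y) \<partial>N) + (\<integral>y. tail_bump K2 (snd y) \<partial>N)" "\<epsilon> + \<epsilon>" "2 * B + 1"]
      by linarith
    have qlim: "(\<lambda>n. \<integral>y. q y \<partial>\<nu> n) \<longlonglongrightarrow> (\<integral>y. q y \<partial>N)"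
    proof -
      have "(\<lambda>n. Re (\<integral>y. complex_of_real (q y) \<partial>\<nu> n)) \<longlonglongrightarrow> Re (\<integral>y. complex_of_real (q y) \<partial>N)"
        by (intro tendsto_Re trig_polynomial_integral_tendsto[OF \<nu> N char q(1)])
      then show ?thesis by (simp only: integral_complex_of_real Re_complex_of_real)
    qed
    have "\<forall>\<^sub>F n in sequentially. norm ((\<integral>y. f y \<partial>\<nu> n) - (\<integral>y. f y \<partial>N)) < r"
      using K1(2) K2(2) tendstoD[OF qlim \<epsilon>(1)]
    proof eventually_elim
      case (elim n)
      have "(2 * B + 1) * ((\<integral>y. tail_bump K1 (fst y) \<partial>\<nu> n) + (\<integral>y. tail_bump K2 (snd y) \<partial>\<nu> n)) \<le> (2 * B + 1) * (\<epsilon> + \<epsilon>)"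
        using elim B0 by (intro mult_left_mono) auto
      then have "\<bar>(\<integral>y. f y \<partial>\<nu> n) - (\<integral>y. q y \<partial>\<nu> n)\<bar> \<le> 2 * \<epsilon> + (2 * B + 1) * (\<epsilon> + \<epsilon>)"
        using bnd[OF \<nu>, of n] by linarith
      moreover have "(2 * \<epsilon> + (2 * B + 1) * (\<epsilon> + \<epsilon>)) * 2 + \<epsilon> < (8 * B + 12) * \<epsilon>"
        using \<epsilon> by (simp add: algebra_simps)
      ultimately show ?case using bndN elim(3) \<epsilon>r by (simp add: dist_real_def)
    qed
    then show "\<exists>no. \<forall>n\<ge>no. norm ((\<integral>y. f y \<partial>\<nu> n) - (\<integral>y. f y \<partial>N)) < r"
      by (simp add: eventually_sequentially)
  qed
qed

section \<open>Averages along the stationary chain\<close>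

text \<open>With \<open>m = \<lfloor>\<surd>n\<rfloor>\<close> one has \<open>m\<^sup>2 \<le> n \<le> m\<^sup>2 + 2
  m\<close>, so between the squares \<open>s\<close> changes by at most \<open>2 m B\<close>, which is
  negligible against \<open>m\<^sup>2\<close>.\<close>

lemma average_tendsto_zero_of_squares:
  fixes s :: "nat \<Rightarrow> complex"
  assumes step: "\<And>n. cmod (s (Suc n) - s n) \<le> B"
    and squares: "(\<lambda>m. s (m\<^sup>2) / of_nat (m\<^sup>2)) \<longlonglongrightarrow> 0"
  shows "(\<lambda>n. s n / of_nat n) \<longlonglongrightarrow> 0"
proof -
  have B: "0 \<le> B" using step[of 0] norm_ge_zero order_trans by blast
  have diff: "cmod (s (n + j) - s n) \<le> real j * B" for n j
  proof (induction j)
    case (Suc j)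
    have "cmod (s (n + Suc j) - s n) \<le> cmod (s (Suc (n + j)) - s (n + j)) + cmod (s (n + j) - s n)"
      using norm_triangle_ineq[of "s (Suc (n + j)) - s (n + j)" "s (n + j) - s n"] by simp
    also have "\<dots> \<le> B + real j * B" by (intro add_mono step Suc)
    finally show ?case by (simp add: algebra_simps)
  qed simp
  have top: "filterlim floor_sqrt at_top at_top"
    unfolding filterlim_at_top
  proof
    fix N
    show "\<forall>\<^sub>F n in sequentially. N \<le> floor_sqrt n"
      using eventually_ge_at_top[of "N\<^sup>2"]
    proof eventually_elim
      case (elim n)
      have "floor_sqrt (N\<^sup>2) \<le> floor_sqrt n" using elim by (rule monoD[OF mono_floor_sqrt])
      then show ?case by simp
    qed
  qed
  let ?b = "\<lambda>m. cmod (s (m\<^sup>2) / of_nat (m\<^sup>2)) + 2 * B / real m"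
  have "?b \<longlonglongrightarrow> cmod 0 + 0"
    by (intro tendsto_add tendsto_norm squares lim_const_over_n)
  then have lim: "(\<lambda>n. ?b (floor_sqrt n)) \<longlonglongrightarrow> 0"
    using filterlim_compose[OF _ top] by fastforce
  have "\<forall>\<^sub>F n in sequentially. cmod (s n / of_nat n) \<le> ?b (floor_sqrt n)"
    using eventually_gt_at_top[of 0]
  proof eventually_elim
    case (elim n)
    define m where "m = floor_sqrt n"
    have m: "m\<^sup>2 \<le> n" "n < (Suc m)\<^sup>2" "0 < m"
      using elim by (auto simp: m_def floor_sqrt_power2_le Suc_floor_sqrt_power2_gt)
    define j where "j = n - m\<^sup>2"
    have n: "n = m\<^sup>2 + j" using m by (simp add: j_def)
    have j: "real j \<le> 2 * real m"
    proof -
      have "j \<le> 2 * m" using m(2) by (simp add: n power2_eq_square)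
      then show ?thesis by (metis of_nat_le_iff of_nat_mult of_nat_numeral)
    qed
    have "cmod (s n) \<le> cmod (s (m\<^sup>2)) + cmod (s n - s (m\<^sup>2))"
      using norm_triangle_ineq[of "s (m\<^sup>2)" "s n - s (m\<^sup>2)"] by simp
    also have "\<dots> \<le> cmod (s (m\<^sup>2)) + 2 * real m * B"
    proof -
      have "cmod (s n - s (m\<^sup>2)) \<le> real j * B" unfolding n by (rule diff)
      also have "\<dots> \<le> 2 * real m * B" using j B by (rule mult_right_mono)
      finally show ?thesis by simp
    qed
    finally have sn: "cmod (s n) \<le> cmod (s (m\<^sup>2)) + 2 * real m * B" .
    have "cmod (s n / of_nat n) = cmod (s n) / real n" by (simp add: norm_divide)
    also have "\<dots> \<le> (cmod (s (m\<^sup>2)) + 2 * real m * B) / real (m\<^sup>2)"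
      using sn m B by (intro frac_le) (auto simp del: of_nat_power)
    also have "\<dots> = cmod (s (m\<^sup>2) / of_nat (m\<^sup>2)) + 2 * B / real m"
      using m by (simp add: norm_divide norm_mult power2_eq_square add_divide_distrib)
    finally show ?case by (simp add: m_def)
  qed
  then show ?thesis by (rule Lim_null_comparison[OF _ lim])
qed

lemma increment_over_n_tendsto_zero:
  fixes A :: "nat \<Rightarrow> real"
  assumes "(\<lambda>n. A n / n) \<longlonglongrightarrow> L"
  shows "(\<lambda>n. (A (Suc n) - A n) / n) \<longlonglongrightarrow> 0"
proof -
  have "(\<lambda>n. A (Suc n) / real (Suc n) * (1 + 1 / real n) - A n / n) \<longlonglongrightarrow> L * (1 + 0) - L"
    by (intro tendsto_intros LIMSEQ_Suc[OF assms] assms lim_const_over_n)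
  moreover have "\<forall>\<^sub>F n in sequentially. A (Suc n) / real (Suc n) * (1 + 1 / real n) - A n / n = (A (Suc n) - A n) / n"
    using eventually_gt_at_top[of 0]
  proof eventually_elim
    case (elim n)
    have "1 + 1 / real n = real (Suc n) / n" using elim by (simp add: field_simps)
    then show ?case by (simp add: diff_divide_distrib)
  qed
  ultimately show ?thesis by (simp add: tendsto_cong)
qed

lemma cmod_diff_square_le: "(cmod (a - b))\<^sup>2 \<le> 2 * (cmod a)\<^sup>2 + 2 * (cmod b)\<^sup>2"
proof -
  have "(cmod (a - b))\<^sup>2 \<le> (cmod a + cmod b)\<^sup>2" by (intro power_mono norm_triangle_ineq4) simp
  also have "\<dots> \<le> 2 * (cmod a)\<^sup>2 + 2 * (cmod b)\<^sup>2"
    using sum_squares_bound[of "cmod a" "cmod b"] by (simp add: power2_sum)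
  finally show ?thesis .
qed

locale ergodic_reversible_chain = reversible_kernel +
  fixes P :: "(int \<Rightarrow> 'a) measure"
  assumes stationary: "stationary_markov_law \<mu> Q P" and ergodic: "shift_ergodic P"
begin

lemma measurable_start_law: "f \<in> path_space \<rightarrow>\<^sub>M N \<Longrightarrow> f \<in> start_law \<rightarrow>\<^sub>M N"
  by (simp add: measurable_cong_sets[OF sets_start_law refl])

lemma space_start_law: "space start_law = space path_space"
  by (rule sets_eq_imp_space_eq[OF sets_start_law])

sublocale path: ergodic_system start_law path_shift
proof (rule ergodic_system.intro[OF prob_space_start_law], unfold_locales)
  show "path_shift \<in> start_law \<rightarrow>\<^sub>M start_law"
    using path_shift_measurable by (simp add: measurable_cong_sets[OF sets_start_law sets_start_law])
  show "distr start_law start_law path_shift = start_law" by (rule path_shift_preserves[OF stationary])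
qed (rule path_shift_ergodic[OF stationary ergodic])

lemma coordinate_law: "distr start_law \<mu> (\<lambda>\<omega>. \<omega> n) = \<mu>"
proof (induction n)
  have co: "(\<lambda>\<omega>. \<omega> i) \<in> start_law \<rightarrow>\<^sub>M \<mu>" for i
    using measurable_path_coordinate[of "\<lambda>x. x" \<mu> i] by (intro measurable_start_law) simp
  {
    case 0
    show ?case
    proof (rule measure_eqI)
      fix A assume "A \<in> sets (distr start_law \<mu> (\<lambda>\<omega>. \<omega> 0))"
      then have A: "A \<in> sets \<mu>" by simp
      then have ind: "(indicator A :: 'a \<Rightarrow> ennreal) \<in> borel_measurable \<mu>" by simp
      have "emeasure (distr start_law \<mu> (\<lambda>\<omega>. \<omega> 0)) A = (\<integral>\<^sup>+x. indicator A x \<partial>distr start_law \<mu> (\<lambda>\<omega>. \<omega> 0))"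
        using A by simp
      also have "\<dots> = (\<integral>\<^sup>+\<omega>. indicator A (\<omega> 0) \<partial>start_law)"
        by (rule nn_integral_distr[OF co]) (simp add: ind)
      also have "\<dots> = (\<integral>\<^sup>+x. indicator A x \<partial>\<mu>)"
        unfolding nn_integral_start_law[OF measurable_path_coordinate[OF ind]]
        by (intro nn_integral_cong chain_from_start ind)
      also have "\<dots> = emeasure \<mu> A" using A by simp
      finally show "emeasure (distr start_law \<mu> (\<lambda>\<omega>. \<omega> 0)) A = emeasure \<mu> A" .
    qed simp
  next
    case (Suc n)
    have "distr start_law \<mu> (\<lambda>\<omega>. \<omega> (Suc n)) = distr start_law \<mu> ((\<lambda>\<omega>. \<omega> n) \<circ> path_shift)"
      by (simp add: path_shift_def comp_def)
    also have "\<dots> = distr (distr start_law start_law path_shift) \<mu> (\<lambda>\<omega>. \<omega> n)"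
      by (rule distr_distr[symmetric, OF co path.T_measurable])
    also have "\<dots> = \<mu>" by (simp add: path.T_preserves Suc)
    finally show ?case .
  }
qed

lemma coordinate_measurable: "(\<lambda>\<omega>. \<omega> i) \<in> start_law \<rightarrow>\<^sub>M \<mu>"
  using measurable_path_coordinate[of "\<lambda>x. x" \<mu> i] by (intro measurable_start_law) simp

lemma
  fixes f :: "'a \<Rightarrow> 'c::{banach, second_countable_topology}"
  assumes "integrable \<mu> f"
  shows integrable_coordinate: "integrable start_law (\<lambda>\<omega>. f (\<omega> n))"
    and integral_coordinate: "(\<integral>\<omega>. f (\<omega> n) \<partial>start_law) = (\<integral>x. f x \<partial>\<mu>)"
proof -
  show "integrable start_law (\<lambda>\<omega>. f (\<omega> n))"
    by (rule integrable_distr[OF coordinate_measurable]) (simp add: coordinate_law assms)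
  have "(\<integral>x. f x \<partial>distr start_law \<mu> (\<lambda>\<omega>. \<omega> n)) = (\<integral>\<omega>. f (\<omega> n) \<partial>start_law)"
    by (rule integral_distr[OF coordinate_measurable borel_measurable_integrable[OF assms]])
  then show "(\<integral>\<omega>. f (\<omega> n) \<partial>start_law) = (\<integral>x. f x \<partial>\<mu>)" by (simp add: coordinate_law)
qed

lemma AE_coordinate:
  assumes "AE x in \<mu>. R x"
  shows "AE \<omega> in start_law. \<forall>n. R (\<omega> n)"
  unfolding AE_all_countable
proof
  fix n
  have "AE x in distr start_law \<mu> (\<lambda>\<omega>. \<omega> n). R x" unfolding coordinate_law by (rule assms)
  then show "AE \<omega> in start_law. R (\<omega> n)" by (rule AE_distrD[OF coordinate_measurable])
qed

lemma ergodic_average: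
  fixes v :: "'a \<Rightarrow> real"
  assumes "integrable \<mu> v"
  shows "AE \<omega> in start_law. (\<lambda>n. (\<Sum>k<n. v (\<omega> k)) / n) \<longlonglongrightarrow> (\<integral>x. v x \<partial>\<mu>)"
  using path.birkhoff[OF integrable_coordinate[OF assms, of 0]]
  by (simp add: path_shift_funpow integral_coordinate[OF assms])

section \<open>Martingale approximation of the Fourier sums\<close>

definition centred :: "('a \<Rightarrow> complex) \<Rightarrow> 'a \<Rightarrow> 'a \<Rightarrow> complex" where
  "centred G s s' = G s' - (\<integral>r. G r \<partial>Q s)"

definition fourier_mart :: "('a \<Rightarrow> complex) \<Rightarrow> real \<Rightarrow> nat \<Rightarrow> (nat \<Rightarrow> 'a) \<Rightarrow> complex" where
  "fourier_mart G \<tau> n \<omega> = (\<Sum>k<n. cis (real (Suc k) * \<tau>) * centred G (\<omega> k) (\<omega> (Suc k)))"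

definition innovation_var :: "('a \<Rightarrow> complex) \<Rightarrow> 'a \<Rightarrow> real" where
  "innovation_var G s = (\<integral>s'. (cmod (centred G s s'))\<^sup>2 \<partial>Q s)"

text \<open>Summation by parts in \<open>e\<^bsup>ik\<tau>\<^esup> h (\<omega> k) = e\<^bsup>ik\<tau>\<^esup> G
  (\<omega> k) - e\<^bsup>i(k+1)\<tau>\<^esup> (Q G) (\<omega> k)\<close>.\<close>

lemma fourier_sum_decomposition:
  assumes "AE x in \<mu>. complex_of_real (h x) = G x - cis \<tau> * (\<integral>r. G r \<partial>Q x)"
  shows "AE \<omega> in start_law. \<forall>n. fourier_sum (\<lambda>k. h (\<omega> k)) n \<tau> =
    fourier_mart G \<tau> n \<omega> + cis \<tau> * (\<integral>r. G r \<partial>Q (\<omega> 0)) - cis (real (Suc n) * \<tau>) * (\<integral>r. G r \<partial>Q (\<omega> n))"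
  using AE_coordinate[OF assms]
proof eventually_elim
  case (elim \<omega>)
  show ?case
  proof
    fix n
    show "fourier_sum (\<lambda>k. h (\<omega> k)) n \<tau> =
      fourier_mart G \<tau> n \<omega> + cis \<tau> * (\<integral>r. G r \<partial>Q (\<omega> 0)) - cis (real (Suc n) * \<tau>) * (\<integral>r. G r \<partial>Q (\<omega> n))"
    proof (induction n)
      case 0 show ?case by (simp add: fourier_sum_def fourier_mart_def)
    next
      case (Suc n)
      have "fourier_sum (\<lambda>k. h (\<omega> k)) (Suc n) \<tau> = fourier_sum (\<lambda>k. h (\<omega> k)) n \<tau> + cis (real (Suc n) * \<tau>) * complex_of_real (h (\<omega> (Suc n)))"
        by (simp add: fourier_sum_def cis_conv_exp)
      moreover have "cis (real (Suc (Suc n)) * \<tau>) = cis (real (Suc n) * \<tau>) * cis \<tau>"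
        by (simp add: cis_mult algebra_simps)
      moreover have "fourier_mart G \<tau> (Suc n) \<omega> = fourier_mart G \<tau> n \<omega> + cis (real (Suc n) * \<tau>) * (G (\<omega> (Suc n)) - (\<integral>r. G r \<partial>Q (\<omega> n)))"
        by (simp add: fourier_mart_def centred_def)
      ultimately show ?case
        using Suc elim[rule_format, of "Suc n"] by (simp only:) (simp add: algebra_simps)
    qed
  qed
qed

text \<open>Without absolute values the square of the increment has a complex conditional mean. It carries the
  dependence of the conditional variances on the direction and on \<open>k\<close>.\<close>

definition innovation_pseudo_var :: "('a \<Rightarrow> complex) \<Rightarrow> 'a \<Rightarrow> complex" where
  "innovation_pseudo_var G s = (\<integral>s'. (centred G s s')\<^sup>2 \<partial>Q s)"

definition innovation_tail :: "('a \<Rightarrow> complex) \<Rightarrow> nat \<Rightarrow> 'a \<Rightarrow> real" where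
  "innovation_tail G K s = (\<integral>s'. (cmod (centred G s s'))\<^sup>2 * of_bool (real K < cmod (centred G s s')) \<partial>Q s)"

text \<open>For \<open>\<alpha> = a + i b\<close> the number \<open>Re (cnj \<alpha> * z)\<close> is the inner product
  of \<open>(a, b)\<close> and \<open>z\<close>, so these are the increments of the martingale in the
  direction \<open>\<alpha>\<close>. Step \<open>k\<close> of the array, which leads from \<open>\<omega>
  k\<close> to \<open>\<omega> (k + 1)\<close>, carries the phase of \<open>k + 1\<close>.\<close>

definition projected_increment :: "('a \<Rightarrow> complex) \<Rightarrow> real \<Rightarrow> complex \<Rightarrow> nat \<Rightarrow> nat \<Rightarrow> 'a \<Rightarrow> 'a \<Rightarrow> real" where
  "projected_increment G t \<alpha> n k s s' = Re (cnj \<alpha> * (cis (real (Suc k) * t) * centred G s s')) / sqrt (real n)"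

context
  fixes G :: "'a \<Rightarrow> complex"
  assumes G_measurable: "G \<in> borel_measurable \<mu>" and G_square: "integrable \<mu> (\<lambda>x. (cmod (G x))\<^sup>2)"
begin

lemma G_integrable: "integrable \<mu> G"
proof (rule Bochner_Integration.integrable_bound[where f="\<lambda>x. 1 + (cmod (G x))\<^sup>2"])
  have "r \<le> 1 + r\<^sup>2" for r :: real using sum_squares_bound[of r 1] zero_le_power2[of r] by (simp, linarith)
  then show "AE x in \<mu>. norm (G x) \<le> norm (1 + (cmod (G x))\<^sup>2)" by (auto intro!: AE_I2)
qed (use G_measurable G_square in auto)

lemma AE_G_integrable_Q: "AE s in \<mu>. integrable (Q s) G \<and> integrable (Q s) (\<lambda>s'. (cmod (G s'))\<^sup>2)"
  using AE_integrable_Q[OF G_integrable] AE_integrable_Q[OF G_square] by eventually_elim simp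

lemma QG_measurable: "(\<lambda>s. \<integral>r. G r \<partial>Q s) \<in> borel_measurable \<mu>"
  by (rule measurable_integral_Q[OF G_measurable])

lemma QG_square: "integrable \<mu> (\<lambda>s. (cmod (\<integral>r. G r \<partial>Q s))\<^sup>2)"
proof (rule Bochner_Integration.integrable_bound[OF integrable_Q[OF G_square]])
  show "AE s in \<mu>. norm ((cmod (\<integral>r. G r \<partial>Q s))\<^sup>2) \<le> norm (\<integral>s'. (cmod (G s'))\<^sup>2 \<partial>Q s)"
    using AE_G_integrable_Q AE_space
  proof eventually_elim
    case (elim s)
    interpret Qs: prob_space "Q s" by (rule prob_space_Q[OF elim(2)])
    have "(cmod (\<integral>r. G r \<partial>Q s))\<^sup>2 \<le> (\<integral>r. cmod (G r) \<partial>Q s)\<^sup>2"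
      by (intro power_mono integral_norm_bound) simp
    also have "\<dots> \<le> (\<integral>r. (cmod (G r))\<^sup>2 \<partial>Q s)"
      using Qs.variance_positive[of "\<lambda>r. cmod (G r)"] elim(1) by (simp add: Qs.variance_eq)
    finally show ?case by simp
  qed
qed (use QG_measurable in auto)

lemma centred_measurable: "case_prod (centred G) \<in> borel_measurable (\<mu> \<Otimes>\<^sub>M \<mu>)"
  unfolding centred_def[abs_def] split_beta'
  by (intro borel_measurable_diff measurable_compose[OF measurable_snd G_measurable] measurable_compose[OF measurable_fst QG_measurable])

lemma integrable_centred_Q:
  assumes s: "s \<in> space \<mu>" and "integrable (Q s) G" "integrable (Q s) (\<lambda>s'. (cmod (G s'))\<^sup>2)"
  shows "integrable (Q s) (centred G s)" "(\<integral>s'. centred G s s' \<partial>Q s) = 0"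
    "integrable (Q s) (\<lambda>s'. (cmod (centred G s s'))\<^sup>2)"
proof -
  interpret Qs: prob_space "Q s" by (rule prob_space_Q[OF s])
  show "integrable (Q s) (centred G s)" "(\<integral>s'. centred G s s' \<partial>Q s) = 0"
    unfolding centred_def using assms by (simp_all add: Qs.prob_space)
  show "integrable (Q s) (\<lambda>s'. (cmod (centred G s s'))\<^sup>2)"
  proof (rule Bochner_Integration.integrable_bound)
    show "integrable (Q s) (\<lambda>s'. 2 * (cmod (G s'))\<^sup>2 + 2 * (cmod (\<integral>r. G r \<partial>Q s))\<^sup>2)" using assms by simp
    show "AE s' in Q s. norm ((cmod (centred G s s'))\<^sup>2) \<le> norm (2 * (cmod (G s'))\<^sup>2 + 2 * (cmod (\<integral>r. G r \<partial>Q s))\<^sup>2)"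
      unfolding centred_def using cmod_diff_square_le by (auto intro!: AE_I2)
    show "(\<lambda>s'. (cmod (centred G s s'))\<^sup>2) \<in> borel_measurable (Q s)"
      unfolding centred_def using borel_measurable_integrable[OF assms(2)] by simp
  qed
qed

lemma centred_path_square:
  "integrable start_law (\<lambda>\<omega>. (cmod (centred G (\<omega> k) (\<omega> (Suc k))))\<^sup>2)"
proof (rule Bochner_Integration.integrable_bound)
  show "integrable start_law (\<lambda>\<omega>. 2 * (cmod (G (\<omega> (Suc k))))\<^sup>2 + 2 * (cmod (\<integral>r. G r \<partial>Q (\<omega> k)))\<^sup>2)"
    using integrable_coordinate[OF G_square, of "Suc k"] integrable_coordinate[OF QG_square, of k] by simp
  show "AE \<omega> in start_law. norm ((cmod (centred G (\<omega> k) (\<omega> (Suc k))))\<^sup>2) \<le> norm (2 * (cmod (G (\<omega> (Suc k))))\<^sup>2 + 2 * (cmod (\<integral>r. G r \<partial>Q (\<omega> k)))\<^sup>2)"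
    unfolding centred_def using cmod_diff_square_le by (auto intro!: AE_I2)
  have "(\<lambda>\<omega>. centred G (\<omega> k) (\<omega> (Suc k))) \<in> borel_measurable start_law"
    by (intro measurable_start_law measurable_path_transition centred_measurable)
  then show "(\<lambda>\<omega>. (cmod (centred G (\<omega> k) (\<omega> (Suc k))))\<^sup>2) \<in> borel_measurable start_law" by simp
qed

lemma innovation_var_integrable: "integrable \<mu> (innovation_var G)"
proof (rule Bochner_Integration.integrable_bound)
  show "integrable \<mu> (\<lambda>s. 2 * (\<integral>r. (cmod (G r))\<^sup>2 \<partial>Q s) + 2 * (cmod (\<integral>r. G r \<partial>Q s))\<^sup>2)"
    using integrable_Q[OF G_square] QG_square by simp
  show "innovation_var G \<in> borel_measurable \<mu>"
    unfolding innovation_var_def[abs_def]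
  proof (rule measurable_integral_Q_dependent)
    show "(\<lambda>(s, s'). (cmod (centred G s s'))\<^sup>2) \<in> borel_measurable (\<mu> \<Otimes>\<^sub>M \<mu>)"
      using centred_measurable by (simp add: split_beta')
  qed
  show "AE s in \<mu>. norm (innovation_var G s) \<le> norm (2 * (\<integral>r. (cmod (G r))\<^sup>2 \<partial>Q s) + 2 * (cmod (\<integral>r. G r \<partial>Q s))\<^sup>2)"
    using AE_G_integrable_Q AE_space
  proof eventually_elim
    case (elim s)
    interpret Qs: prob_space "Q s" by (rule prob_space_Q[OF elim(2)])
    have "innovation_var G s \<le> (\<integral>s'. 2 * (cmod (G s'))\<^sup>2 + 2 * (cmod (\<integral>r. G r \<partial>Q s))\<^sup>2 \<partial>Q s)"
      unfolding innovation_var_def using elim integrable_centred_Q(3)[OF elim(2)]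
      by (intro integral_mono) (auto simp: centred_def cmod_diff_square_le)
    also have "\<dots> = 2 * (\<integral>r. (cmod (G r))\<^sup>2 \<partial>Q s) + 2 * (cmod (\<integral>r. G r \<partial>Q s))\<^sup>2"
      using elim by (simp add: Qs.prob_space)
    finally show ?case by (simp add: innovation_var_def)
  qed
qed

lemma fourier_mart_measurable: "fourier_mart G \<tau> n \<in> borel_measurable path_space"
  unfolding fourier_mart_def[abs_def]
  by (intro borel_measurable_sum borel_measurable_times borel_measurable_const measurable_path_transition centred_measurable)

lemma centred_path_second_moment:
  "(\<integral>\<omega>. (cmod (centred G (\<omega> k) (\<omega> (Suc k))))\<^sup>2 \<partial>start_law) = (\<integral>s. innovation_var G s \<partial>\<mu>)"
proof -
  have "(\<integral>\<omega>. (cmod (centred G (\<omega> k) (\<omega> (Suc k))))\<^sup>2 \<partial>start_law) =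
      (\<integral>\<omega>. \<integral>s. (cmod (centred G (fun_upd \<omega> (Suc k) s k) (fun_upd \<omega> (Suc k) s (Suc k))))\<^sup>2 \<partial>Q (\<omega> k) \<partial>start_law)"
    by (rule markov_law_integral[OF markov_law_start_law centred_path_square]) (simp add: stopped_path_def)
  also have "\<dots> = (\<integral>\<omega>. innovation_var G (\<omega> k) \<partial>start_law)" by (simp add: innovation_var_def)
  also have "\<dots> = (\<integral>s. innovation_var G s \<partial>\<mu>)" by (rule integral_coordinate[OF innovation_var_integrable])
  finally show ?thesis .
qed

text \<open>Increments are orthogonal: given the past up to \<open>n\<close>, the next one has mean zero.\<close>

lemma fourier_mart_second_moment:
  "integrable start_law (\<lambda>\<omega>. (cmod (fourier_mart G \<tau> n \<omega>))\<^sup>2) \<and>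
   (\<integral>\<omega>. (cmod (fourier_mart G \<tau> n \<omega>))\<^sup>2 \<partial>start_law) = real n * (\<integral>s. innovation_var G s \<partial>\<mu>)"
proof (induction n)
  case 0 show ?case by (simp add: fourier_mart_def)
next
  case (Suc n)
  let ?M = "fourier_mart G \<tau> n" and ?D = "\<lambda>\<omega>. centred G (\<omega> n) (\<omega> (Suc n))"
  define c where "c = cis (real (Suc n) * \<tau>)"
  have c: "cmod c = 1" by (simp add: c_def)
  define F where "F \<omega> = cnj (?M \<omega>) * c * ?D \<omega>" for \<omega>
  have Mm: "?M \<in> borel_measurable start_law" by (intro measurable_start_law fourier_mart_measurable)
  have Dm: "?D \<in> borel_measurable start_law"
    by (intro measurable_start_law measurable_path_transition centred_measurable)
  have Fi: "integrable start_law F"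
  proof (rule Bochner_Integration.integrable_bound)
    show "integrable start_law (\<lambda>\<omega>. (cmod (?M \<omega>))\<^sup>2 + (cmod (?D \<omega>))\<^sup>2)"
      using Suc centred_path_square by auto
    show "F \<in> borel_measurable start_law"
      unfolding F_def[abs_def] using Mm Dm by (intro borel_measurable_times borel_measurable_const)
        (auto intro: borel_measurable_continuous_on[where f=cnj] continuous_intros)
    have "x * y \<le> x\<^sup>2 + y\<^sup>2" if "0 \<le> x" "0 \<le> y" for x y :: real
      using sum_squares_bound[of x y] mult_nonneg_nonneg[OF that] by linarith
    then show "AE \<omega> in start_law. norm (F \<omega>) \<le> norm ((cmod (?M \<omega>))\<^sup>2 + (cmod (?D \<omega>))\<^sup>2)"
      by (intro AE_I2) (simp add: F_def norm_mult c)
  qed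
  have "(\<integral>\<omega>. F \<omega> \<partial>start_law) = (\<integral>\<omega>. \<integral>s. F (fun_upd \<omega> (Suc n) s) \<partial>Q (\<omega> n) \<partial>start_law)"
  proof (rule markov_law_integral[OF markov_law_start_law Fi])
    fix \<omega> :: "nat \<Rightarrow> 'a"
    have "fourier_mart G \<tau> n (stopped_path (Suc n) \<omega>) = fourier_mart G \<tau> n \<omega>"
      unfolding fourier_mart_def by (intro sum.cong) (auto simp: stopped_path_def min_def)
    then show "F (stopped_path (Suc n) \<omega>) = F \<omega>" by (simp add: F_def stopped_path_def)
  qed
  also have "\<dots> = 0"
  proof (rule integral_eq_zero_AE)
    show "AE \<omega> in start_law. (\<integral>s. F (fun_upd \<omega> (Suc n) s) \<partial>Q (\<omega> n)) = 0"
      using AE_coordinate[OF AE_G_integrable_Q] AE_space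
    proof eventually_elim
      case (elim \<omega>)
      have s: "\<omega> n \<in> space \<mu>" using elim(2) space_start_law path_component_space by auto
      have "F (fun_upd \<omega> (Suc n) s) = cnj (?M \<omega>) * c * centred G (\<omega> n) s" for s
      proof -
        have "fourier_mart G \<tau> n (fun_upd \<omega> (Suc n) s) = fourier_mart G \<tau> n \<omega>"
          unfolding fourier_mart_def by (intro sum.cong) auto
        then show ?thesis by (simp add: F_def)
      qed
      then show ?case using integrable_centred_Q(2)[OF s] elim(1) by simp
    qed
  qed
  finally have F0: "(\<integral>\<omega>. F \<omega> \<partial>start_law) = 0" .
  have sq: "(cmod (fourier_mart G \<tau> (Suc n) \<omega>))\<^sup>2 = (cmod (?M \<omega>))\<^sup>2 + (cmod (?D \<omega>))\<^sup>2 + 2 * Re (F \<omega>)" for \<omega>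
  proof -
    have "(cmod (m + c * d))\<^sup>2 = (cmod m)\<^sup>2 + (cmod d)\<^sup>2 + 2 * Re (cnj m * c * d)" for m d
    proof -
      have "(cmod (m + c * d))\<^sup>2 = (cmod m)\<^sup>2 + (cmod (c * d))\<^sup>2 + 2 * Re (cnj m * (c * d))"
        unfolding cmod_power2 by (simp add: power2_eq_square algebra_simps)
      then show ?thesis by (simp add: norm_mult c mult.assoc)
    qed
    moreover have "fourier_mart G \<tau> (Suc n) \<omega> = ?M \<omega> + c * ?D \<omega>"
      by (simp add: fourier_mart_def c_def)
    ultimately show ?thesis by (simp only: F_def)
  qed
  have ReF: "integrable start_law (\<lambda>\<omega>. Re (F \<omega>))" "(\<integral>\<omega>. Re (F \<omega>) \<partial>start_law) = 0"
    using Fi F0 by (auto simp: integral_Re)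
  show ?case
    unfolding sq using Suc centred_path_square[of n] ReF by (simp add: centred_path_second_moment algebra_simps)
qed

text \<open>The boundary terms \<open>R\<close> have bounded second moments. The mixed term is split by \<open>2 |M R|
  \<le> |M|\<^sup>2 / w + w |R|\<^sup>2\<close> with \<open>w = \<surd>n\<close>, which makes the error of
  order \<open>\<surd>n\<close>.\<close>

proposition fourier_variance_limit:
  assumes eq: "AE x in \<mu>. complex_of_real (h x) = G x - cis \<tau> * (\<integral>r. G r \<partial>Q x)"
    and h: "h \<in> borel_measurable \<mu>"
  shows "(\<lambda>n. 1 / real n * (\<integral>\<omega>. (cmod (fourier_sum (\<lambda>k. h (\<omega> k)) n \<tau>))\<^sup>2 \<partial>start_law)) \<longlonglongrightarrow> (\<integral>s. innovation_var G s \<partial>\<mu>)"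
    and "integrable start_law (\<lambda>\<omega>. (cmod (fourier_sum (\<lambda>k. h (\<omega> k)) n \<tau>))\<^sup>2)"
proof -
  define \<sigma>2 where "\<sigma>2 = (\<integral>s. innovation_var G s \<partial>\<mu>)"
  define K where "K = (\<integral>s. (cmod (\<integral>r. G r \<partial>Q s))\<^sup>2 \<partial>\<mu>)"
  define S where "S n \<omega> = fourier_sum (\<lambda>k. h (\<omega> k)) n \<tau>" for n \<omega>
  define M where "M = fourier_mart G \<tau>"
  define R where "R n \<omega> = S n \<omega> - M n \<omega>" for n \<omega>
  have K0: "0 \<le> K" and \<sigma>0: "0 \<le> \<sigma>2" by (simp_all add: K_def \<sigma>2_def innovation_var_def)
  have Sm: "S n \<in> borel_measurable start_law" for n
    unfolding S_def[abs_def] by (rule measurable_start_law[OF fourier_sum_measurable[OF h]])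
  have Mm: "M n \<in> borel_measurable start_law" for n
    unfolding M_def by (intro measurable_start_law fourier_mart_measurable)
  have Rm: "R n \<in> borel_measurable start_law" for n
    unfolding R_def[abs_def] by (intro borel_measurable_diff Sm Mm)
  have Mi: "integrable start_law (\<lambda>\<omega>. (cmod (M n \<omega>))\<^sup>2)" and EM: "(\<integral>\<omega>. (cmod (M n \<omega>))\<^sup>2 \<partial>start_law) = real n * \<sigma>2" for n
    using fourier_mart_second_moment[of \<tau> n] by (simp_all add: M_def \<sigma>2_def)
  have Rle: "AE \<omega> in start_law. (cmod (R n \<omega>))\<^sup>2 \<le> 2 * (cmod (\<integral>r. G r \<partial>Q (\<omega> 0)))\<^sup>2 + 2 * (cmod (\<integral>r. G r \<partial>Q (\<omega> n)))\<^sup>2" for n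
    using fourier_sum_decomposition[OF eq]
  proof eventually_elim
    case (elim \<omega>)
    have "R n \<omega> = cis \<tau> * (\<integral>r. G r \<partial>Q (\<omega> 0)) - cis (real (Suc n) * \<tau>) * (\<integral>r. G r \<partial>Q (\<omega> n))"
      using elim[rule_format, of n] by (simp only: R_def S_def M_def) simp
    then show ?case
      using cmod_diff_square_le[of "cis \<tau> * (\<integral>r. G r \<partial>Q (\<omega> 0))" "cis (real (Suc n) * \<tau>) * (\<integral>r. G r \<partial>Q (\<omega> n))"]
      by (simp only: norm_mult norm_cis mult_1)
  qed
  have Bi: "integrable start_law (\<lambda>\<omega>. 2 * (cmod (\<integral>r. G r \<partial>Q (\<omega> 0)))\<^sup>2 + 2 * (cmod (\<integral>r. G r \<partial>Q (\<omega> n)))\<^sup>2)" for n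
    using integrable_coordinate[OF QG_square] by auto
  have Ri: "integrable start_law (\<lambda>\<omega>. (cmod (R n \<omega>))\<^sup>2)" for n
  proof (rule Bochner_Integration.integrable_bound[OF Bi])
    show "AE \<omega> in start_law. norm ((cmod (R n \<omega>))\<^sup>2) \<le> norm (2 * (cmod (\<integral>r. G r \<partial>Q (\<omega> 0)))\<^sup>2 + 2 * (cmod (\<integral>r. G r \<partial>Q (\<omega> n)))\<^sup>2)"
      using Rle by eventually_elim simp
  qed (use Rm in simp)
  have ER: "(\<integral>\<omega>. (cmod (R n \<omega>))\<^sup>2 \<partial>start_law) \<le> 4 * K" for n
  proof -
    have "(\<integral>\<omega>. (cmod (R n \<omega>))\<^sup>2 \<partial>start_law) \<le> (\<integral>\<omega>. 2 * (cmod (\<integral>r. G r \<partial>Q (\<omega> 0)))\<^sup>2 + 2 * (cmod (\<integral>r. G r \<partial>Q (\<omega> n)))\<^sup>2 \<partial>start_law)"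
      by (rule integral_mono_AE[OF Ri Bi Rle])
    also have "\<dots> = 4 * K"
      using integrable_coordinate[OF QG_square] integral_coordinate[OF QG_square] by (simp add: K_def)
    finally show ?thesis .
  qed
  have Si: "integrable start_law (\<lambda>\<omega>. (cmod (S n \<omega>))\<^sup>2)" for n
  proof (rule Bochner_Integration.integrable_bound)
    show "integrable start_law (\<lambda>\<omega>. 2 * (cmod (M n \<omega>))\<^sup>2 + 2 * (cmod (R n \<omega>))\<^sup>2)"
      using Mi Ri by simp
    have "(cmod (S n \<omega>))\<^sup>2 \<le> 2 * (cmod (M n \<omega>))\<^sup>2 + 2 * (cmod (R n \<omega>))\<^sup>2" for \<omega>
      using cmod_diff_square_le[of "M n \<omega>" "- R n \<omega>"] by (simp add: R_def norm_minus_commute)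
    then show "AE \<omega> in start_law. norm ((cmod (S n \<omega>))\<^sup>2) \<le> norm (2 * (cmod (M n \<omega>))\<^sup>2 + 2 * (cmod (R n \<omega>))\<^sup>2)"
      by (intro AE_I2) simp
  qed (use Sm in simp)
  then show "integrable start_law (\<lambda>\<omega>. (cmod (fourier_sum (\<lambda>k. h (\<omega> k)) n \<tau>))\<^sup>2)" by (simp add: S_def)
  have close: "\<bar>1 / real n * (\<integral>\<omega>. (cmod (S n \<omega>))\<^sup>2 \<partial>start_law) - \<sigma>2\<bar> \<le> (\<sigma>2 + 8 * K) / sqrt (real n)" if n: "0 < n" for n
  proof -
    define w where "w = sqrt (real n)"
    have w: "1 \<le> w" "w * w = real n" using n by (simp_all add: w_def)
    have ineq: "\<bar>(cmod (m + r))\<^sup>2 - (cmod m)\<^sup>2\<bar> \<le> (cmod m)\<^sup>2 / w + 2 * w * (cmod r)\<^sup>2" for m r :: complex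
    proof -
      have *: "(cmod (m + r))\<^sup>2 - (cmod m)\<^sup>2 = 2 * Re (cnj m * r) + (cmod r)\<^sup>2"
        unfolding cmod_power2 by (simp add: power2_eq_square algebra_simps)
      have "2 * \<bar>Re (cnj m * r)\<bar> \<le> 2 * (cmod m * cmod r)"
        using abs_Re_le_cmod[of "cnj m * r"] by (simp add: norm_mult)
      also have "\<dots> \<le> (cmod m)\<^sup>2 / w + w * (cmod r)\<^sup>2"
      proof -
        have "0 \<le> (cmod m - w * cmod r)\<^sup>2 / w" using w by simp
        also have "\<dots> = (cmod m)\<^sup>2 / w + w * (cmod r)\<^sup>2 - 2 * (cmod m * cmod r)"
          using w by (simp add: power2_eq_square field_simps)
        finally show ?thesis by simp
      qed
      finally have "\<bar>2 * Re (cnj m * r)\<bar> \<le> (cmod m)\<^sup>2 / w + w * (cmod r)\<^sup>2"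
        by (simp only: abs_mult abs_numeral)
      moreover have "(cmod r)\<^sup>2 \<le> w * (cmod r)\<^sup>2" using w by (simp add: mult_le_cancel_right1)
      moreover have "2 * w * (cmod r)\<^sup>2 = w * (cmod r)\<^sup>2 + w * (cmod r)\<^sup>2" by simp
      ultimately show ?thesis unfolding * using zero_le_power2[of "cmod r"] by linarith
    qed
    have "\<bar>(\<integral>\<omega>. (cmod (S n \<omega>))\<^sup>2 \<partial>start_law) - real n * \<sigma>2\<bar> = \<bar>\<integral>\<omega>. (cmod (S n \<omega>))\<^sup>2 - (cmod (M n \<omega>))\<^sup>2 \<partial>start_law\<bar>"
      using Si Mi EM by simp
    also have "\<dots> \<le> (\<integral>\<omega>. \<bar>(cmod (S n \<omega>))\<^sup>2 - (cmod (M n \<omega>))\<^sup>2\<bar> \<partial>start_law)" by (rule integral_abs_bound)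
    also have "\<dots> \<le> (\<integral>\<omega>. (cmod (M n \<omega>))\<^sup>2 / w + 2 * w * (cmod (R n \<omega>))\<^sup>2 \<partial>start_law)"
    proof (rule integral_mono)
      show "\<bar>(cmod (S n \<omega>))\<^sup>2 - (cmod (M n \<omega>))\<^sup>2\<bar> \<le> (cmod (M n \<omega>))\<^sup>2 / w + 2 * w * (cmod (R n \<omega>))\<^sup>2" for \<omega>
        using ineq[of "M n \<omega>" "R n \<omega>"] by (simp add: R_def)
    qed (use Si Mi Ri in auto)
    also have "\<dots> = real n * \<sigma>2 / w + 2 * w * (\<integral>\<omega>. (cmod (R n \<omega>))\<^sup>2 \<partial>start_law)"
      using Mi Ri EM by simp
    also have "\<dots> \<le> real n * \<sigma>2 / w + 2 * w * (4 * K)"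
      using ER[of n] w by (intro add_mono mult_left_mono) auto
    also have "\<dots> = w * (\<sigma>2 + 8 * K)" using w by (simp add: field_simps flip: w(2))
    finally have "\<bar>(\<integral>\<omega>. (cmod (S n \<omega>))\<^sup>2 \<partial>start_law) - real n * \<sigma>2\<bar> \<le> w * (\<sigma>2 + 8 * K)" .
    then have "\<bar>(\<integral>\<omega>. (cmod (S n \<omega>))\<^sup>2 \<partial>start_law) - real n * \<sigma>2\<bar> / real n \<le> w * (\<sigma>2 + 8 * K) / real n"
      by (rule divide_right_mono) simp
    also have "\<dots> = (\<sigma>2 + 8 * K) / w" using w(1) unfolding w(2)[symmetric] by simp
    finally have "\<bar>(\<integral>\<omega>. (cmod (S n \<omega>))\<^sup>2 \<partial>start_law) - real n * \<sigma>2\<bar> / real n \<le> (\<sigma>2 + 8 * K) / w" .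
    moreover have "1 / real n * I - \<sigma>2 = (I - real n * \<sigma>2) / real n" for I
      using n by (simp add: field_simps)
    ultimately show ?thesis by (simp add: w_def abs_divide)
  qed
  have "(\<lambda>n. (\<sigma>2 + 8 * K) / sqrt (real n)) \<longlonglongrightarrow> 0"
    by (intro tendsto_divide_0[OF tendsto_const] filterlim_at_top_imp_at_infinity
      filterlim_compose[OF sqrt_at_top] filterlim_real_sequentially)
  then have "(\<lambda>n. 1 / real n * (\<integral>\<omega>. (cmod (S n \<omega>))\<^sup>2 \<partial>start_law) - \<sigma>2) \<longlonglongrightarrow> 0"
    by (rule Lim_null_comparison[rotated])
       (use close in \<open>auto intro!: eventually_mono[OF eventually_gt_at_top[of 0]]\<close>)
  then show "(\<lambda>n. 1 / real n * (\<integral>\<omega>. (cmod (fourier_sum (\<lambda>k. h (\<omega> k)) n \<tau>))\<^sup>2 \<partial>start_law)) \<longlonglongrightarrow> (\<integral>s. innovation_var G s \<partial>\<mu>)"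
    unfolding S_def[symmetric] \<sigma>2_def[symmetric] by (subst LIM_zero_iff[symmetric])
qed

lemma innovation_tail_transition_measurable:
  "(\<lambda>(s, s'). (cmod (centred G s s'))\<^sup>2 * of_bool (real K < cmod (centred G s s'))) \<in> borel_measurable (\<mu> \<Otimes>\<^sub>M \<mu>)"
proof -
  have "(\<lambda>z. (cmod z)\<^sup>2 * of_bool (real K < cmod z) :: real) \<in> borel_measurable borel" by measurable
  from measurable_compose[OF centred_measurable this]
  show ?thesis by (simp add: split_beta')
qed

lemma centred_measurable_Q: "s \<in> space \<mu> \<Longrightarrow> centred G s \<in> borel_measurable (Q s)"
  using measurable_compose[OF measurable_Pair1' centred_measurable, of s]
  by (intro measurable_Q) simp_all

lemma innovation_pseudo_var_integrable: "integrable \<mu> (innovation_pseudo_var G)"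
proof (rule Bochner_Integration.integrable_bound[OF innovation_var_integrable])
  show "innovation_pseudo_var G \<in> borel_measurable \<mu>"
    unfolding innovation_pseudo_var_def[abs_def]
  proof (rule measurable_integral_Q_dependent)
    show "(\<lambda>(s, s'). (centred G s s')\<^sup>2) \<in> borel_measurable (\<mu> \<Otimes>\<^sub>M \<mu>)"
      using borel_measurable_power[OF centred_measurable, of 2] by (simp add: split_beta')
  qed
  have "cmod (innovation_pseudo_var G s) \<le> innovation_var G s" for s
    unfolding innovation_pseudo_var_def innovation_var_def
    using integral_norm_bound[of "Q s" "\<lambda>s'. (centred G s s')\<^sup>2"] by (simp add: norm_power)
  then show "AE s in \<mu>. norm (innovation_pseudo_var G s) \<le> norm (innovation_var G s)"
    by (intro AE_I2) (simp add: order_trans[OF _ abs_ge_self])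
qed

lemma
  shows innovation_tail_integrable: "integrable \<mu> (innovation_tail G K)"
    and innovation_tail_vanishes: "(\<lambda>K. \<integral>s. innovation_tail G K s \<partial>\<mu>) \<longlonglongrightarrow> 0"
proof -
  have m: "innovation_tail G K \<in> borel_measurable \<mu>" for K
    unfolding innovation_tail_def[abs_def] by (rule measurable_integral_Q_dependent[OF innovation_tail_transition_measurable])
  have facts: "AE s in \<mu>. (\<forall>K. \<bar>innovation_tail G K s\<bar> \<le> innovation_var G s) \<and> (\<lambda>K. innovation_tail G K s) \<longlonglongrightarrow> 0"
    using AE_G_integrable_Q AE_space
  proof eventually_elim
    case (elim s)
    have D2: "integrable (Q s) (\<lambda>s'. (cmod (centred G s s'))\<^sup>2)"
      using integrable_centred_Q(3)[OF elim(2)] elim(1) by simp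
    note [measurable] = centred_measurable_Q[OF elim(2)]
    have Ti: "integrable (Q s) (\<lambda>s'. (cmod (centred G s s'))\<^sup>2 * of_bool (real K < cmod (centred G s s')))" for K
      by (rule Bochner_Integration.integrable_bound[OF D2]) (auto intro!: AE_I2)
    have "\<bar>innovation_tail G K s\<bar> \<le> innovation_var G s" for K
    proof -
      have "0 \<le> innovation_tail G K s" unfolding innovation_tail_def by (intro integral_nonneg_AE AE_I2) simp
      moreover have "innovation_tail G K s \<le> innovation_var G s"
        unfolding innovation_tail_def innovation_var_def by (intro integral_mono Ti D2) auto
      ultimately show ?thesis by simp
    qed
    moreover have "(\<lambda>K. innovation_tail G K s) \<longlonglongrightarrow> (\<integral>s'. 0 \<partial>Q s)"
      unfolding innovation_tail_def
    proof (rule integral_dominated_convergence[where w="\<lambda>s'. (cmod (centred G s s'))\<^sup>2"])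
      show "AE s' in Q s. (\<lambda>K. (cmod (centred G s s'))\<^sup>2 * of_bool (real K < cmod (centred G s s'))) \<longlonglongrightarrow> 0"
      proof (rule AE_I2)
        fix s'
        have "\<forall>\<^sub>F K in sequentially. (cmod (centred G s s'))\<^sup>2 * of_bool (real K < cmod (centred G s s')) = 0"
          using eventually_ge_at_top[of "nat \<lceil>cmod (centred G s s')\<rceil>"]
        proof eventually_elim
          case (elim K)
          then have "cmod (centred G s s') \<le> real K" by linarith
          then show ?case by simp
        qed
        then show "(\<lambda>K. (cmod (centred G s s'))\<^sup>2 * of_bool (real K < cmod (centred G s s'))) \<longlonglongrightarrow> 0"
          by (rule tendsto_eventually)
      qed
    qed (use D2 Ti in \<open>auto intro!: AE_I2\<close>)
    ultimately show ?case by simp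
  qed
  show "integrable \<mu> (innovation_tail G K)"
  proof (rule Bochner_Integration.integrable_bound[OF innovation_var_integrable m])
    show "AE s in \<mu>. norm (innovation_tail G K s) \<le> norm (innovation_var G s)"
      using facts by eventually_elim (simp add: order_trans[OF _ abs_ge_self])
  qed
  have "(\<lambda>K. \<integral>s. innovation_tail G K s \<partial>\<mu>) \<longlonglongrightarrow> (\<integral>s. 0 \<partial>\<mu>)"
  proof (rule integral_dominated_convergence[where w="innovation_var G"])
    show "AE s in \<mu>. (\<lambda>K. innovation_tail G K s) \<longlonglongrightarrow> 0" using facts by eventually_elim simp
    show "AE s in \<mu>. norm (innovation_tail G K s) \<le> innovation_var G s" for K using facts by eventually_elim simp
  qed (use m innovation_var_integrable in auto)
  then show "(\<lambda>K. \<integral>s. innovation_tail G K s \<partial>\<mu>) \<longlonglongrightarrow> 0" by simp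
qed

lemma projected_increment_measurable:
  "case_prod (projected_increment G t \<alpha> n k) \<in> borel_measurable (\<mu> \<Otimes>\<^sub>M \<mu>)"
proof -
  have "(\<lambda>z. Re (cnj \<alpha> * (cis (real (Suc k) * t) * z)) / sqrt (real n)) \<in> borel_measurable borel" by measurable
  from measurable_compose[OF centred_measurable this]
  show ?thesis by (simp add: projected_increment_def[abs_def] split_beta')
qed

lemma projected_increment_sum:
  "(\<Sum>k<n. projected_increment G t \<alpha> n k (\<omega> k) (\<omega> (Suc k))) = Re (cnj \<alpha> * fourier_mart G t n \<omega>) / sqrt (real n)"
  unfolding projected_increment_def fourier_mart_def
  by (simp only: sum_divide_distrib[symmetric] Re_sum[symmetric] sum_distrib_left)

text \<open>The variance formula is \<open>(Re z)\<^sup>2 = (|z|\<^sup>2 + Re (z\<^sup>2)) / 2\<close> applied to the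
  rotated increment. For the tail, an increment can exceed \<open>\<epsilon>\<close> only if the modulus of
  its unscaled version exceeds \<open>\<epsilon> \<surd>n / |\<alpha>|\<close>, which for large
  \<open>n\<close> is above any fixed level \<open>K\<close>.\<close>

lemma projected_increment_moments:
  assumes s: "s \<in> space \<mu>" and int: "integrable (Q s) G" "integrable (Q s) (\<lambda>s'. (cmod (G s'))\<^sup>2)"
  shows "cond_centred (projected_increment G t \<alpha> n) k s"
    and "cond_var (projected_increment G t \<alpha> n) k s =
      ((cmod \<alpha>)\<^sup>2 * innovation_var G s + Re ((cnj \<alpha>)\<^sup>2 * cis (2 * t) * (cis (real k * (2 * t)) * innovation_pseudo_var G s))) / (2 * real n)"
    and "0 < \<epsilon> \<Longrightarrow> 0 < n \<Longrightarrow> cmod \<alpha> * real K \<le> \<epsilon> * sqrt (real n) \<Longrightarrow>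
      cond_tail \<epsilon> (projected_increment G t \<alpha> n) k s \<le> (cmod \<alpha>)\<^sup>2 * innovation_tail G K s / real n"
proof -
  let ?y = "projected_increment G t \<alpha> n k s" and ?D = "centred G s"
  note D = integrable_centred_Q[OF s int]
  note [measurable] = centred_measurable_Q[OF s]
  have D2: "integrable (Q s) (\<lambda>s'. (?D s')\<^sup>2)"
    by (rule Bochner_Integration.integrable_bound[OF D(3)]) (auto intro!: AE_I2 simp: norm_power)
  have ym[measurable]: "?y \<in> borel_measurable (Q s)"
    unfolding projected_increment_def[abs_def] by measurable
  define c where "c = cnj \<alpha> * cis (real (Suc k) * t)"
  have cn: "cmod c = cmod \<alpha>" by (simp add: c_def norm_mult)
  have y: "?y s' = Re (c * ?D s') / sqrt (real n)" for s'
    by (simp add: projected_increment_def c_def mult.assoc)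
  have y_le: "\<bar>?y s'\<bar> \<le> cmod \<alpha> * cmod (?D s') / sqrt (real n)" for s'
    unfolding y using abs_Re_le_cmod[of "c * ?D s'"] by (simp add: norm_mult cn divide_right_mono del: times_complex.simps)
  have Re_sq: "(Re z)\<^sup>2 = ((cmod z)\<^sup>2 + Re (z\<^sup>2)) / 2" for z
    unfolding cmod_power2 by (simp add: power2_eq_square)
  have c2: "c\<^sup>2 = (cnj \<alpha>)\<^sup>2 * cis (2 * t) * cis (real k * (2 * t))"
  proof -
    have "(cis (real (Suc k) * t))\<^sup>2 = cis (2 * t) * cis (real k * (2 * t))"
      by (simp add: power2_eq_square cis_mult algebra_simps)
    then show ?thesis by (simp add: c_def power_mult_distrib mult.assoc)
  qed
  have y2: "(?y s')\<^sup>2 = ((cmod \<alpha>)\<^sup>2 * (cmod (?D s'))\<^sup>2 + Re (c\<^sup>2 * (?D s')\<^sup>2)) / (2 * real n)" for s'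
  proof -
    have "(?y s')\<^sup>2 = (Re (c * ?D s'))\<^sup>2 / real n" unfolding y by (simp only: power_divide real_sqrt_pow2 of_nat_0_le_iff)
    then show ?thesis unfolding Re_sq by (simp only: norm_mult cn power_mult_distrib divide_divide_eq_left)
  qed
  have y2i: "integrable (Q s) (\<lambda>s'. (?y s')\<^sup>2)"
    unfolding y2 using D(3) D2 by (intro integrable_divide Bochner_Integration.integrable_add integrable_mult_right integrable_Re) auto
  show "cond_centred (projected_increment G t \<alpha> n) k s"
    unfolding cond_centred_def
  proof (intro conjI y2i)
    show "integrable (Q s) ?y"
      unfolding y[abs_def] using D(1) by (intro integrable_divide integrable_Re integrable_mult_right)
    show "(\<integral>s'. ?y s' \<partial>Q s) = 0"
    proof -
      have "(\<integral>s'. ?y s' \<partial>Q s) = Re (\<integral>s'. c * ?D s' \<partial>Q s) / sqrt (real n)"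
        unfolding y using D(1) by (simp only: integral_divide_zero integral_Re[OF integrable_mult_right])
      then show ?thesis using D by simp
    qed
  qed
  show "cond_var (projected_increment G t \<alpha> n) k s =
      ((cmod \<alpha>)\<^sup>2 * innovation_var G s + Re ((cnj \<alpha>)\<^sup>2 * cis (2 * t) * (cis (real k * (2 * t)) * innovation_pseudo_var G s))) / (2 * real n)"
  proof -
    have i1: "integrable (Q s) (\<lambda>s'. (cmod \<alpha>)\<^sup>2 * (cmod (?D s'))\<^sup>2)" using D(3) by simp
    have i2: "integrable (Q s) (\<lambda>s'. c\<^sup>2 * (?D s')\<^sup>2)" using D2 by simp
    have "cond_var (projected_increment G t \<alpha> n) k s =
        ((\<integral>s'. (cmod \<alpha>)\<^sup>2 * (cmod (?D s'))\<^sup>2 \<partial>Q s) + Re (\<integral>s'. c\<^sup>2 * (?D s')\<^sup>2 \<partial>Q s)) / (2 * real n)"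
      unfolding cond_var_def y2 integral_divide_zero
      by (simp only: Bochner_Integration.integral_add[OF i1 integrable_Re[OF i2]] integral_Re[OF i2])
    then show ?thesis unfolding innovation_var_def innovation_pseudo_var_def c2 by (simp add: mult.assoc)
  qed
  assume \<epsilon>: "0 < \<epsilon>" and n: "0 < n" and K: "cmod \<alpha> * real K \<le> \<epsilon> * sqrt (real n)"
  have "cond_tail \<epsilon> (projected_increment G t \<alpha> n) k s \<le>
      (\<integral>s'. (cmod \<alpha>)\<^sup>2 / real n * ((cmod (?D s'))\<^sup>2 * of_bool (real K < cmod (?D s'))) \<partial>Q s)"
    unfolding cond_tail_def
  proof (rule integral_mono)
    have [measurable]: "{r::real. \<epsilon> < \<bar>r\<bar>} \<in> sets borel" by measurable
    show "integrable (Q s) (\<lambda>s'. (?y s')\<^sup>2 * indicat_real {r. \<epsilon> < \<bar>r\<bar>} (?y s'))"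
      by (rule Bochner_Integration.integrable_bound[OF y2i]) (auto intro!: AE_I2 simp: indicator_def)
    have "integrable (Q s) (\<lambda>s'. (cmod (?D s'))\<^sup>2 * of_bool (real K < cmod (?D s')))"
      by (rule Bochner_Integration.integrable_bound[OF D(3)]) (auto intro!: AE_I2)
    then show "integrable (Q s) (\<lambda>s'. (cmod \<alpha>)\<^sup>2 / real n * ((cmod (?D s'))\<^sup>2 * of_bool (real K < cmod (?D s'))))"
      by (rule integrable_mult_right)
    fix s'
    show "(?y s')\<^sup>2 * indicat_real {r. \<epsilon> < \<bar>r\<bar>} (?y s') \<le> (cmod \<alpha>)\<^sup>2 / real n * ((cmod (?D s'))\<^sup>2 * of_bool (real K < cmod (?D s')))"
    proof (cases "\<epsilon> < \<bar>?y s'\<bar>")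
      case True
      have sn: "0 < sqrt (real n)" using n by simp
      have "\<epsilon> * sqrt (real n) < cmod \<alpha> * cmod (?D s')"
        using True y_le[of s'] sn by (simp add: less_le_trans pos_less_divide_eq[symmetric])
      with K have "cmod \<alpha> * real K < cmod \<alpha> * cmod (?D s')" by simp
      then have "real K < cmod (?D s')" by (rule mult_left_less_imp_less) simp
      moreover have "(?y s')\<^sup>2 \<le> (cmod \<alpha>)\<^sup>2 / real n * (cmod (?D s'))\<^sup>2"
        using power_mono[OF y_le[of s'], of 2] by (simp add: power_divide power_mult_distrib)
      ultimately show ?thesis using True by simp
    qed simp
  qed
  also have "\<dots> = (cmod \<alpha>)\<^sup>2 * innovation_tail G K s / real n"
    by (simp add: innovation_tail_def)
  finally show "cond_tail \<epsilon> (projected_increment G t \<alpha> n) k s \<le> (cmod \<alpha>)\<^sup>2 * innovation_tail G K s / real n" .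
qed

text \<open>The hypotheses are limits of averages along one path that do not mention \<open>\<alpha>\<close>, so that
  a single null set can serve all directions.\<close>

lemma projected_mart_char_limit:
  assumes M: "markov_law M"
    and good: "AE \<omega> in M. \<forall>k. integrable (Q (\<omega> k)) G \<and> integrable (Q (\<omega> k)) (\<lambda>s'. (cmod (G s'))\<^sup>2)"
    and var: "AE \<omega> in M. (\<lambda>n. (\<Sum>k<n. innovation_var G (\<omega> k)) / n) \<longlonglongrightarrow> \<sigma>2"
    and rot: "AE \<omega> in M. (\<lambda>n. (\<Sum>k<n. cis (real k * (2 * t)) * innovation_pseudo_var G (\<omega> k)) / of_nat n) \<longlonglongrightarrow> 0"
    and tail: "AE \<omega> in M. \<forall>K. (\<lambda>n. (\<Sum>k<n. innovation_tail G K (\<omega> k)) / n) \<longlonglongrightarrow> (\<integral>s. innovation_tail G K s \<partial>\<mu>)"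
  shows "(\<lambda>n. \<integral>\<omega>. iexp (Re (cnj \<alpha> * fourier_mart G t n \<omega>) / sqrt (real n)) \<partial>M) \<longlonglongrightarrow> exp (- ((cmod \<alpha>)\<^sup>2 * \<sigma>2 / 4))"
proof -
  note d = markov_lawD[OF M]
  let ?y = "projected_increment G t \<alpha>"
  have space: "AE \<omega> in M. \<forall>k. \<omega> k \<in> space \<mu>"
    using AE_space by eventually_elim (use d(3) path_component_space in auto)
  have "(\<lambda>n. \<integral>\<omega>. iexp (\<Sum>k<n. ?y n k (\<omega> k) (\<omega> (Suc k))) \<partial>M) \<longlonglongrightarrow> exp (- (((cmod \<alpha>)\<^sup>2 * \<sigma>2 / 2) / 2))"
  proof (rule markov_martingale_clt[OF M projected_increment_measurable])
    show "AE \<omega> in M. \<forall>n k. cond_centred (?y n) k (\<omega> k)"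
      using good space by eventually_elim (simp add: projected_increment_moments(1))
    show "AE \<omega> in M. (\<lambda>n. \<Sum>k<n. cond_var (?y n) k (\<omega> k)) \<longlonglongrightarrow> (cmod \<alpha>)\<^sup>2 * \<sigma>2 / 2"
      using good space var rot
    proof eventually_elim
      case (elim \<omega>)
      let ?V = "\<lambda>n. (\<Sum>k<n. innovation_var G (\<omega> k)) / n"
      let ?W = "\<lambda>n. (\<Sum>k<n. cis (real k * (2 * t)) * innovation_pseudo_var G (\<omega> k)) / of_nat n"
      have "(\<Sum>k<n. cond_var (?y n) k (\<omega> k)) = (cmod \<alpha>)\<^sup>2 / 2 * ?V n + Re ((cnj \<alpha>)\<^sup>2 * cis (2 * t) * ?W n) / 2" for n
      proof -
        let ?w = "\<lambda>k. (cnj \<alpha>)\<^sup>2 * cis (2 * t) * (cis (real k * (2 * t)) * innovation_pseudo_var G (\<omega> k))"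
        have "(\<Sum>k<n. cond_var (?y n) k (\<omega> k)) = (\<Sum>k<n. ((cmod \<alpha>)\<^sup>2 * innovation_var G (\<omega> k) + Re (?w k)) / (2 * real n))"
          using elim(1,2) by (intro sum.cong refl projected_increment_moments(2)) auto
        also have "\<dots> = ((cmod \<alpha>)\<^sup>2 * (\<Sum>k<n. innovation_var G (\<omega> k)) + Re (\<Sum>k<n. ?w k)) / (2 * real n)"
          by (simp only: sum_divide_distrib[symmetric] sum.distrib sum_distrib_left Re_sum)
        also have "Re (\<Sum>k<n. ?w k) = real n * Re ((cnj \<alpha>)\<^sup>2 * cis (2 * t) * ?W n)"
        proof (cases "n = 0")
          case False
          then have "(\<Sum>k<n. ?w k) = complex_of_real (real n) * ((cnj \<alpha>)\<^sup>2 * cis (2 * t) * ?W n)"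
            by (simp add: sum_distrib_left[symmetric])
          moreover have "Re (complex_of_real r * z) = r * Re z" for r z by simp
          ultimately show ?thesis by (simp only:)
        qed simp
        finally show ?thesis by (cases "n = 0") (simp_all add: add_divide_distrib)
      qed
      moreover have "(\<lambda>n. (cmod \<alpha>)\<^sup>2 / 2 * ?V n + Re ((cnj \<alpha>)\<^sup>2 * cis (2 * t) * ?W n) / 2) \<longlonglongrightarrow>
          (cmod \<alpha>)\<^sup>2 / 2 * \<sigma>2 + Re ((cnj \<alpha>)\<^sup>2 * cis (2 * t) * 0) / 2"
        by (intro tendsto_intros elim) simp
      ultimately show ?case by simp
    qed
    fix \<epsilon> :: real assume \<epsilon>: "0 < \<epsilon>"
    show "AE \<omega> in M. (\<lambda>n. \<Sum>k<n. cond_tail \<epsilon> (?y n) k (\<omega> k)) \<longlonglongrightarrow> 0"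
      using good space tail
    proof eventually_elim
      case (elim \<omega>)
      show ?case
      proof (rule LIMSEQ_I)
        fix r :: real assume r: "0 < r"
        have "(\<lambda>K. (cmod \<alpha>)\<^sup>2 * (\<integral>s. innovation_tail G K s \<partial>\<mu>)) \<longlonglongrightarrow> (cmod \<alpha>)\<^sup>2 * 0"
          by (intro tendsto_intros innovation_tail_vanishes)
        then have "\<forall>\<^sub>F K in sequentially. (cmod \<alpha>)\<^sup>2 * (\<integral>s. innovation_tail G K s \<partial>\<mu>) < r"
          using r by (intro order_tendstoD(2)) auto
        then obtain K where K: "(cmod \<alpha>)\<^sup>2 * (\<integral>s. innovation_tail G K s \<partial>\<mu>) < r"
          by (auto simp: eventually_sequentially)
        have "(\<lambda>n. (cmod \<alpha>)\<^sup>2 * ((\<Sum>k<n. innovation_tail G K (\<omega> k)) / n)) \<longlonglongrightarrow> (cmod \<alpha>)\<^sup>2 * (\<integral>s. innovation_tail G K s \<partial>\<mu>)"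
          by (intro tendsto_intros elim(3)[rule_format])
        from order_tendstoD(2)[OF this K]
        have ev: "\<forall>\<^sub>F n in sequentially. (cmod \<alpha>)\<^sup>2 * ((\<Sum>k<n. innovation_tail G K (\<omega> k)) / n) < r" .
        have "filterlim (\<lambda>n. \<epsilon> * sqrt (real n)) at_top sequentially"
          by (intro filterlim_tendsto_pos_mult_at_top[OF tendsto_const \<epsilon>] filterlim_compose[OF sqrt_at_top] filterlim_real_sequentially)
        then have "\<forall>\<^sub>F n in sequentially. cmod \<alpha> * real K \<le> \<epsilon> * sqrt (real n)"
          by (simp add: filterlim_at_top)
        with ev eventually_gt_at_top[of 0]
        have "\<forall>\<^sub>F n in sequentially. norm ((\<Sum>k<n. cond_tail \<epsilon> (?y n) k (\<omega> k)) - 0) < r"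
        proof eventually_elim
          case n: (elim n)
          have "(\<Sum>k<n. cond_tail \<epsilon> (?y n) k (\<omega> k)) \<le> (\<Sum>k<n. (cmod \<alpha>)\<^sup>2 * innovation_tail G K (\<omega> k) / real n)"
            using elim(1,2) n by (intro sum_mono projected_increment_moments(3)[OF _ _ _ \<epsilon>]) auto
          also have "\<dots> = (cmod \<alpha>)\<^sup>2 * ((\<Sum>k<n. innovation_tail G K (\<omega> k)) / n)"
            by (simp add: sum_distrib_left sum_divide_distrib)
          also have "\<dots> < r" by (rule n(1))
          finally show ?case by (simp add: sum_nonneg cond_tail_nonneg)
        qed
        then show "\<exists>no. \<forall>n\<ge>no. norm ((\<Sum>k<n. cond_tail \<epsilon> (?y n) k (\<omega> k)) - 0) < r"
          by (simp add: eventually_sequentially)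
      qed
    qed
  qed
  then show ?thesis by (simp add: projected_increment_sum)
qed

text \<open>If the averages of \<open>v (\<omega> k)\<close> converge, then \<open>v (\<omega> n) / n\<close> tends to
  zero; this is applied to \<open>v = |Q G|\<^sup>2\<close>.\<close>

lemma coboundary_negligible:
  "AE \<omega> in start_law. (\<lambda>n. cmod (\<integral>r. G r \<partial>Q (\<omega> n)) / sqrt (real n)) \<longlonglongrightarrow> 0"
  using ergodic_average[OF QG_square]
proof eventually_elim
  case (elim \<omega>)
  have "(\<lambda>n. (cmod (\<integral>r. G r \<partial>Q (\<omega> n)))\<^sup>2 / real n) \<longlonglongrightarrow> 0"
    using increment_over_n_tendsto_zero[OF elim] by simp
  then have "(\<lambda>n. sqrt ((cmod (\<integral>r. G r \<partial>Q (\<omega> n)))\<^sup>2 / real n)) \<longlonglongrightarrow> sqrt 0" by (rule tendsto_real_sqrt)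
  then show ?case by (simp add: real_sqrt_divide)
qed

end

section \<open>Rotated ergodic averages\<close>

text \<open>The resolvent equation at the frequency \<open>\<tau>\<close> gives second moments of order
  \<open>n\<close> for the rotated sums. These are summable after division by \<open>n\<^sup>2\<close> along
  the squares \<open>n = m\<^sup>2\<close>, and boundedness fills the gaps between squares.\<close>

lemma rotated_average_bounded:
  assumes v: "v \<in> borel_measurable \<mu>" and B: "\<And>x. \<bar>v x\<bar> \<le> B" and \<tau>: "sin \<tau> \<noteq> 0"
  shows "AE \<omega> in start_law. (\<lambda>n. (\<Sum>k<n. cis (real k * \<tau>) * complex_of_real (v (\<omega> k))) / of_nat n) \<longlonglongrightarrow> 0"
proof -
  have B0: "0 \<le> B" using B[of undefined] by simp
  have "square_integrable \<mu> v"
    unfolding square_integrable_def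
  proof
    have "(v x)\<^sup>2 \<le> B\<^sup>2" for x using B[of x] B0 abs_le_square_iff[of "v x" B] by simp
    then show "integrable \<mu> (\<lambda>x. (v x)\<^sup>2)"
      using v by (intro integrable_const_bound[where B="B\<^sup>2"]) auto
  qed (rule v)
  then obtain G where G: "G \<in> borel_measurable \<mu>" "integrable \<mu> (\<lambda>x. (cmod (G x))\<^sup>2)"
    "AE x in \<mu>. complex_of_real (v x) = G x - cis \<tau> * (\<integral>y. G y \<partial>Q x)"
    by (rule resolvent_equation[OF _ \<tau>])
  define S where "S n \<omega> = fourier_sum (\<lambda>k. v (\<omega> k)) n \<tau>" for n \<omega>
  note var = fourier_variance_limit[OF G v, folded S_def]
  obtain C where C: "\<And>n. \<bar>1 / real n * (\<integral>\<omega>. (cmod (S n \<omega>))\<^sup>2 \<partial>start_law)\<bar> \<le> C"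
    using convergent_imp_Bseq[OF convergentI[OF var(1)]] unfolding Bseq_def real_norm_def by blast
  have Si: "integrable start_law (\<lambda>\<omega>. (cmod (S n \<omega>))\<^sup>2)" for n using var(2) by simp
  define a where "a m \<omega> = (cmod (S (m\<^sup>2) \<omega> / of_nat (m\<^sup>2)))\<^sup>2" for m \<omega>
  have a_eq: "a m \<omega> = (cmod (S (m\<^sup>2) \<omega>))\<^sup>2 / (real (m\<^sup>2))\<^sup>2" for m \<omega>
    by (simp add: a_def norm_divide norm_power power_divide)
  have "AE \<omega> in start_law. summable (\<lambda>m. a m \<omega>)"
  proof (rule AE_summable_of_integrals)
    show "integrable start_law (a m)" for m unfolding a_eq[abs_def] using Si by simp
    show "0 \<le> a m \<omega>" for m \<omega> by (simp add: a_def)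
    show "summable (\<lambda>m. \<integral>\<omega>. a m \<omega> \<partial>start_law)"
    proof (rule summable_comparison_test[OF exI, rule_format])
      show "summable (\<lambda>m. C * (1 / (real m)\<^sup>2))"
        using inverse_power_summable[of 2, where 'a=real] by (intro summable_mult) (simp add: divide_inverse)
      fix m :: nat
      have "(\<integral>\<omega>. a m \<omega> \<partial>start_law) = (\<integral>\<omega>. (cmod (S (m\<^sup>2) \<omega>))\<^sup>2 \<partial>start_law) / (real (m\<^sup>2))\<^sup>2"
        unfolding a_eq by simp
      also have "\<dots> = (1 / real (m\<^sup>2) * (\<integral>\<omega>. (cmod (S (m\<^sup>2) \<omega>))\<^sup>2 \<partial>start_law)) * (1 / (real m)\<^sup>2)"
        by (simp add: power2_eq_square)
      also have "\<dots> \<le> C * (1 / (real m)\<^sup>2)"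
        using C[of "m\<^sup>2"] by (intro mult_right_mono) auto
      finally show "norm (\<integral>\<omega>. a m \<omega> \<partial>start_law) \<le> C * (1 / (real m)\<^sup>2)"
        by (simp add: a_def)
    qed
  qed
  then show ?thesis
  proof eventually_elim
    case (elim \<omega>)
    have "(\<lambda>m. sqrt (a m \<omega>)) \<longlonglongrightarrow> sqrt 0" by (intro tendsto_real_sqrt summable_LIMSEQ_zero elim)
    then have "(\<lambda>m. cmod (S (m\<^sup>2) \<omega> / of_nat (m\<^sup>2))) \<longlonglongrightarrow> 0" by (simp add: a_def)
    then have sq: "(\<lambda>m. S (m\<^sup>2) \<omega> / of_nat (m\<^sup>2)) \<longlonglongrightarrow> 0" by (rule tendsto_norm_zero_cancel)
    have "cmod (S (Suc n) \<omega> - S n \<omega>) \<le> B" for n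
      using B by (simp add: S_def fourier_sum_def norm_mult)
    from average_tendsto_zero_of_squares[OF this sq] have S0: "(\<lambda>n. S n \<omega> / of_nat n) \<longlonglongrightarrow> 0" .
    let ?R = "\<lambda>n. \<Sum>k<n. cis (real k * \<tau>) * complex_of_real (v (\<omega> k))"
    have R: "?R n = S n \<omega> + complex_of_real (v (\<omega> 0)) - cis (real n * \<tau>) * complex_of_real (v (\<omega> n))" for n
    proof (induction n)
      case (Suc n)
      have "S (Suc n) \<omega> = S n \<omega> + cis (real (Suc n) * \<tau>) * complex_of_real (v (\<omega> (Suc n)))"
        by (simp add: S_def fourier_sum_def cis_conv_exp)
      then show ?case using Suc by (simp only: sum.lessThan_Suc) simp
    qed (simp add: S_def fourier_sum_def)
    have "(\<lambda>n. (?R n - S n \<omega>) / of_nat n) \<longlonglongrightarrow> 0"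
    proof (rule Lim_null_comparison)
      show "(\<lambda>n. 2 * B / real n) \<longlonglongrightarrow> 0" by (rule lim_const_over_n)
      show "\<forall>\<^sub>F n in sequentially. norm ((?R n - S n \<omega>) / of_nat n) \<le> 2 * B / real n"
      proof (rule always_eventually, rule allI)
        fix n
        have "norm (?R n - S n \<omega>) \<le> cmod (complex_of_real (v (\<omega> 0))) + cmod (cis (real n * \<tau>) * complex_of_real (v (\<omega> n)))"
          unfolding R using norm_triangle_ineq4[of "complex_of_real (v (\<omega> 0))" "cis (real n * \<tau>) * complex_of_real (v (\<omega> n))"]
          by simp
        also have "\<dots> \<le> 2 * B" using B[of "\<omega> 0"] B[of "\<omega> n"] by (simp add: norm_mult)
        finally show "norm ((?R n - S n \<omega>) / of_nat n) \<le> 2 * B / real n"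
          by (simp add: norm_divide divide_right_mono)
      qed
    qed
    from tendsto_add[OF this S0] show ?case by (simp add: add_divide_distrib[symmetric])
  qed
qed

text \<open>Truncation at level \<open>j\<close> changes the average by at most the ergodic average of \<open>|v -
  u\<^sub>j|\<close>, which converges to a small number.\<close>

lemma rotated_average:
  fixes v :: "'a \<Rightarrow> real"
  assumes v: "integrable \<mu> v" and \<tau>: "sin \<tau> \<noteq> 0"
  shows "AE \<omega> in start_law. (\<lambda>n. (\<Sum>k<n. cis (real k * \<tau>) * complex_of_real (v (\<omega> k))) / of_nat n) \<longlonglongrightarrow> 0"
proof -
  have vm: "v \<in> borel_measurable \<mu>" using v by simp
  define u where "u j x = (if \<bar>v x\<bar> \<le> real j then v x else 0)" for j :: nat and x
  have um: "u j \<in> borel_measurable \<mu>" for j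
    unfolding u_def[abs_def] using vm by (intro measurable_If) auto
  have ub: "\<bar>u j x\<bar> \<le> real j" for j x by (simp add: u_def)
  have d_le: "\<bar>v x - u j x\<bar> \<le> \<bar>v x\<bar>" for j x by (simp add: u_def)
  have di: "integrable \<mu> (\<lambda>x. \<bar>v x - u j x\<bar>)" for j
    by (rule Bochner_Integration.integrable_bound[OF v]) (use um vm d_le in auto)
  define e where "e j = (\<integral>x. \<bar>v x - u j x\<bar> \<partial>\<mu>)" for j
  have "(\<lambda>j. e j) \<longlonglongrightarrow> (\<integral>x. 0 \<partial>\<mu>)"
    unfolding e_def
  proof (rule integral_dominated_convergence[where w="\<lambda>x. \<bar>v x\<bar>"])
    show "AE x in \<mu>. (\<lambda>j. \<bar>v x - u j x\<bar>) \<longlonglongrightarrow> 0"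
    proof (rule AE_I2)
      fix x
      have "\<forall>\<^sub>F j in sequentially. \<bar>v x - u j x\<bar> = 0"
        using eventually_ge_at_top[of "nat \<lceil>\<bar>v x\<bar>\<rceil>"]
      proof eventually_elim
        case (elim j)
        then have "\<bar>v x\<bar> \<le> real j" by linarith
        then show ?case by (simp add: u_def)
      qed
      then show "(\<lambda>j. \<bar>v x - u j x\<bar>) \<longlonglongrightarrow> 0" by (rule tendsto_eventually)
    qed
    show "AE x in \<mu>. norm \<bar>v x - u j x\<bar> \<le> \<bar>v x\<bar>" for j using d_le by auto
  qed (use v vm um in auto)
  then have e0: "e \<longlonglongrightarrow> 0" by simp
  have "AE \<omega> in start_law. \<forall>j. (\<lambda>n. (\<Sum>k<n. cis (real k * \<tau>) * complex_of_real (u j (\<omega> k))) / of_nat n) \<longlonglongrightarrow> 0"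
    unfolding AE_all_countable using rotated_average_bounded[OF um ub \<tau>] by blast
  moreover have "AE \<omega> in start_law. \<forall>j. (\<lambda>n. (\<Sum>k<n. \<bar>v (\<omega> k) - u j (\<omega> k)\<bar>) / n) \<longlonglongrightarrow> e j"
    unfolding AE_all_countable e_def using ergodic_average[OF di] by blast
  ultimately show ?thesis
  proof eventually_elim
    case (elim \<omega>)
    show ?case
    proof (rule LIMSEQ_I)
      fix r :: real assume r: "0 < r"
      then obtain j where j: "e j < r / 2"
        using order_tendstoD(2)[OF e0, of "r / 2"] by (auto simp: eventually_sequentially)
      have "\<forall>\<^sub>F n in sequentially. norm ((\<Sum>k<n. cis (real k * \<tau>) * complex_of_real (v (\<omega> k))) / of_nat n - 0) < r"
        using tendstoD[OF elim(1)[rule_format, of j] half_gt_zero[OF r]] order_tendstoD(2)[OF elim(2)[rule_format, of j] j]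
      proof eventually_elim
        case (elim n)
        let ?V = "\<Sum>k<n. cis (real k * \<tau>) * complex_of_real (v (\<omega> k))" and ?U = "\<Sum>k<n. cis (real k * \<tau>) * complex_of_real (u j (\<omega> k))"
        have "cmod (?V - ?U) = cmod (\<Sum>k<n. cis (real k * \<tau>) * complex_of_real (v (\<omega> k) - u j (\<omega> k)))"
          by (simp add: sum_subtractf[symmetric] algebra_simps)
        also have "\<dots> \<le> (\<Sum>k<n. cmod (cis (real k * \<tau>) * complex_of_real (v (\<omega> k) - u j (\<omega> k))))"
          by (rule norm_sum)
        also have "\<dots> = (\<Sum>k<n. \<bar>v (\<omega> k) - u j (\<omega> k)\<bar>)"
          by (simp only: norm_mult norm_cis norm_of_real mult_1)
        finally have VU: "cmod (?V - ?U) / real n \<le> (\<Sum>k<n. \<bar>v (\<omega> k) - u j (\<omega> k)\<bar>) / real n"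
          by (rule divide_right_mono) simp
        have "cmod (?V / of_nat n) \<le> cmod (?U / of_nat n) + cmod ((?V - ?U) / of_nat n)"
          using norm_triangle_ineq[of "?U / of_nat n" "(?V - ?U) / of_nat n"] by (simp add: add_divide_distrib[symmetric])
        also have "\<dots> < r / 2 + r / 2"
        proof (rule add_strict_mono)
          show "cmod (?U / of_nat n) < r / 2" using elim(1) by (simp only: dist_norm diff_zero)
          have "cmod ((?V - ?U) / of_nat n) = cmod (?V - ?U) / real n" by (simp only: norm_divide norm_of_nat)
          also have "\<dots> < r / 2" using VU elim(2) by (rule le_less_trans)
          finally show "cmod ((?V - ?U) / of_nat n) < r / 2" .
        qed
        finally show ?case by simp
      qed
      then show "\<exists>no. \<forall>n\<ge>no. norm ((\<Sum>k<n. cis (real k * \<tau>) * complex_of_real (v (\<omega> k))) / of_nat n - 0) < r"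
        by (simp add: eventually_sequentially)
    qed
  qed
qed

lemma rotated_average_complex:
  fixes v :: "'a \<Rightarrow> complex"
  assumes v: "integrable \<mu> v" and \<tau>: "sin \<tau> \<noteq> 0"
  shows "AE \<omega> in start_law. (\<lambda>n. (\<Sum>k<n. cis (real k * \<tau>) * v (\<omega> k)) / of_nat n) \<longlonglongrightarrow> 0"
  using rotated_average[OF integrable_Re[OF v] \<tau>] rotated_average[OF integrable_Im[OF v] \<tau>]
proof eventually_elim
  case (elim \<omega>)
  have "(\<lambda>n. (\<Sum>k<n. cis (real k * \<tau>) * complex_of_real (Re (v (\<omega> k)))) / of_nat n +
      \<i> * ((\<Sum>k<n. cis (real k * \<tau>) * complex_of_real (Im (v (\<omega> k)))) / of_nat n)) \<longlonglongrightarrow> 0 + \<i> * 0"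
    by (intro tendsto_add tendsto_mult tendsto_const elim)
  moreover have "(\<Sum>k<n. cis (real k * \<tau>) * complex_of_real (Re (v (\<omega> k)))) / of_nat n +
      \<i> * ((\<Sum>k<n. cis (real k * \<tau>) * complex_of_real (Im (v (\<omega> k)))) / of_nat n) =
      (\<Sum>k<n. cis (real k * \<tau>) * v (\<omega> k)) / of_nat n" for n
  proof -
    have "cis (real k * \<tau>) * v (\<omega> k) = cis (real k * \<tau>) * complex_of_real (Re (v (\<omega> k))) + \<i> * (cis (real k * \<tau>) * complex_of_real (Im (v (\<omega> k))))" for k
      by (simp add: complex_eq_iff)
    then show ?thesis by (simp only: sum.distrib sum_distrib_left[symmetric] add_divide_distrib times_divide_eq_right)
  qed
  ultimately show ?case by simp
qed

end

section \<open>The quenched central limit theorem\<close>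

lemma normal_law_borel: "sets (normal_law m v) = sets borel"
  by (simp add: normal_law_def)

lemma prob_space_normal_law: "0 \<le> v \<Longrightarrow> prob_space (normal_law m v)"
  by (simp add: normal_law_def prob_space_return prob_space_normal_density)

text \<open>Scaling of the standard normal law; the point mass \<open>v = 0\<close> obeys the same formula.\<close>

lemma char_normal_law:
  assumes v: "0 \<le> v"
  shows "(\<integral>x. iexp (t * x) \<partial>normal_law 0 v) = complex_of_real (exp (- (v * t\<^sup>2 / 2)))"
proof (cases "v = 0")
  case True
  then show ?thesis by (simp add: normal_law_def integral_return)
next
  case False
  define \<sigma> where "\<sigma> = sqrt v"
  have \<sigma>: "0 < \<sigma>" "\<sigma>\<^sup>2 = v" using v False by (simp_all add: \<sigma>_def)
  interpret std: prob_space std_normal_distribution by (rule prob_space_normal_density) simp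
  have "distributed std_normal_distribution lborel (\<lambda>x. x) std_normal_density"
    unfolding distributed_def by (auto simp: distr_id2)
  then have "distributed std_normal_distribution lborel (\<lambda>x. 0 + \<sigma> * x) (normal_density (0 + \<sigma> * 0) (\<bar>\<sigma>\<bar> * 1))"
    using \<sigma> by (intro std.normal_density_affine) auto
  then have eq: "distr std_normal_distribution lborel (\<lambda>x. \<sigma> * x) = density lborel (normal_density 0 \<sigma>)"
    using \<sigma> by (simp add: distributed_def)
  have "(\<integral>x. iexp (t * x) \<partial>normal_law 0 v) = (\<integral>x. iexp (t * x) \<partial>distr std_normal_distribution lborel (\<lambda>x. \<sigma> * x))"
    unfolding normal_law_def eq using False by (simp add: \<sigma>_def)
  also have "\<dots> = (\<integral>x. iexp (t * (\<sigma> * x)) \<partial>std_normal_distribution)"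
    by (rule integral_distr) auto
  also have "\<dots> = char std_normal_distribution (t * \<sigma>)"
    by (simp add: char_def mult.assoc)
  also have "\<dots> = complex_of_real (exp (- (v * t\<^sup>2 / 2)))"
    by (simp add: char_std_normal_distribution power_mult_distrib \<sigma>(2) mult.commute)
  finally show ?thesis .
qed

lemma char_normal_law_pair:
  assumes v: "0 \<le> v"
  defines "N \<equiv> normal_law 0 v \<Otimes>\<^sub>M normal_law 0 v"
  shows "prob_space N" "sets N = sets borel"
    "(\<integral>y. iexp (a * fst y + b * snd y) \<partial>N) = complex_of_real (exp (- (v * (a\<^sup>2 + b\<^sup>2) / 2)))"
proof -
  interpret N1: prob_space "normal_law 0 v" by (rule prob_space_normal_law[OF v])
  interpret N2: pair_prob_space "normal_law 0 v" "normal_law 0 v" ..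
  show "prob_space N" unfolding N_def by unfold_locales
  show sN: "sets N = sets borel"
  proof -
    have "sets N = sets (borel \<Otimes>\<^sub>M borel)"
      unfolding N_def by (intro sets_pair_measure_cong normal_law_borel)
    then show ?thesis by (simp only: borel_prod)
  qed
  have "(\<lambda>y::real \<times> real. iexp (a * fst y + b * snd y)) \<in> borel_measurable borel"
    by (intro borel_measurable_continuous_onI continuous_intros)
  then have m: "(\<lambda>y. iexp (a * fst y + b * snd y)) \<in> borel_measurable N"
    by (simp add: measurable_cong_sets[OF sN refl])
  have "integrable N (\<lambda>y. iexp (a * fst y + b * snd y))"
    using m unfolding N_def by (intro N2.integrable_const_bound[where B=1]) auto
  then have "(\<integral>y. iexp (a * fst y + b * snd y) \<partial>N) = (\<integral>u. \<integral>w. iexp (a * u + b * w) \<partial>normal_law 0 v \<partial>normal_law 0 v)"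
    unfolding N_def by (subst N2.integral_fst'[symmetric]) auto
  also have "\<dots> = (\<integral>u. \<integral>w. iexp (a * u) * iexp (b * w) \<partial>normal_law 0 v \<partial>normal_law 0 v)"
    by (simp add: exp_add[symmetric] distrib_left)
  also have "\<dots> = (\<integral>u. iexp (a * u) \<partial>normal_law 0 v) * (\<integral>w. iexp (b * w) \<partial>normal_law 0 v)"
    by simp
  also have "\<dots> = complex_of_real (exp (- (v * (a\<^sup>2 + b\<^sup>2) / 2)))"
    unfolding char_normal_law[OF v] by (simp add: mult_exp_exp algebra_simps add_divide_distrib flip: exp_of_real)
  finally show "(\<integral>y. iexp (a * fst y + b * snd y) \<partial>N) = complex_of_real (exp (- (v * (a\<^sup>2 + b\<^sup>2) / 2)))" .
qed

lemma iexp_lipschitz: "cmod (iexp u - iexp w) \<le> \<bar>u - w\<bar>"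
proof -
  have "cmod (iexp (u - w) - 1) \<le> \<bar>u - w\<bar>" using iexp_approx1[of "u - w" 0] by simp
  moreover have "iexp u - iexp w = iexp w * (iexp (u - w) - 1)"
    by (simp add: algebra_simps exp_add[symmetric])
  ultimately show ?thesis by (simp add: norm_mult)
qed

text \<open>Symmetry tested on an indicator and the constant \<open>1\<close>, which \<open>Q\<close> fixes.\<close>

lemma (in markov_kernel) reversible_imp_invariant:
  assumes rev: "reversible \<mu> Q"
  shows "\<mu> \<bind> Q = \<mu>"
proof (rule measure_eqI)
  show s: "sets (\<mu> \<bind> Q) = sets \<mu>" by (rule sets_bind_measurable[OF kernel_subprob not_empty])
  fix A assume "A \<in> sets (\<mu> \<bind> Q)"
  then have A: "A \<in> sets \<mu>" by (simp add: s)
  interpret b: prob_space "\<mu> \<bind> Q"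
    using prob_space_Q by (intro prob_space_bind[OF _ kernel_subprob]) auto
  have sq: "square_integrable \<mu> (indicator A)" "square_integrable \<mu> (\<lambda>_. 1)"
    using A by (auto simp: square_integrable_def intro!: integrable_const_bound[where B=1] simp: indicator_def)
  have "(\<integral>x. measure (Q x) A \<partial>\<mu>) = (\<integral>x. markov_operator Q (indicator A) x * 1 \<partial>\<mu>)"
    using A sets_Q by (intro Bochner_Integration.integral_cong refl) (auto simp: markov_operator_def)
  also have "\<dots> = (\<integral>x. indicator A x * markov_operator Q (\<lambda>_. 1) x \<partial>\<mu>)"
    using rev sq unfolding reversible_def by blast
  also have "\<dots> = (\<integral>x. indicator A x \<partial>\<mu>)"
    using prob_space.prob_space[OF prob_space_Q]
    by (intro Bochner_Integration.integral_cong refl) (auto simp: markov_operator_def)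
  also have "\<dots> = measure \<mu> A" using A by simp
  finally have "measure (\<mu> \<bind> Q) A = measure \<mu> A"
    by (subst measure_bind[OF kernel_subprob A])
  then show "emeasure (\<mu> \<bind> Q) A = emeasure \<mu> A"
    by (simp add: b.emeasure_eq_measure emeasure_eq_measure)
qed

context ergodic_reversible_chain begin

text \<open>The Fourier sum differs from the martingale by terms that are almost surely \<open>o(\<surd>n)\<close>
  under almost every \<open>P\<^sup>x\<close>, so the characteristic functions of the two have the same
  limit. The condition on \<open>2 t\<close> implies \<open>sin t \<noteq> 0\<close>, since \<open>sin 2 t =
  2 sin t cos t\<close>.\<close>

theorem quenched_fourier_clt:
  assumes h: "square_integrable \<mu> h" and t: "sin (2 * t) \<noteq> 0"
  obtains \<sigma>2 where
    "(\<lambda>n. 1 / real n * (\<integral>\<omega>. (cmod (fourier_sum (\<lambda>k. h (\<omega> k)) n t))\<^sup>2 \<partial>start_law)) \<longlonglongrightarrow> \<sigma>2"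
    "AE x in \<mu>. weakly_converges (\<lambda>n. distr (chain_from \<mu> Q x) borel (\<lambda>\<omega>. fourier_vec (\<lambda>k. h (\<omega> k)) n t))
         (normal_law 0 (\<sigma>2 / 2) \<Otimes>\<^sub>M normal_law 0 (\<sigma>2 / 2))"
proof -
  have "sin t \<noteq> 0" using t by (auto simp: sin_double)
  then obtain G where Gm: "G \<in> borel_measurable \<mu>" and G2: "integrable \<mu> (\<lambda>x. (cmod (G x))\<^sup>2)"
    and eq: "AE x in \<mu>. complex_of_real (h x) = G x - cis t * (\<integral>y. G y \<partial>Q x)"
    by (rule resolvent_equation[OF h])
  have hm: "h \<in> borel_measurable \<mu>" by (rule square_integrableD(1)[OF h])
  define \<sigma>2 where "\<sigma>2 = (\<integral>s. innovation_var G s \<partial>\<mu>)"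
  have \<sigma>0: "0 \<le> \<sigma>2 / 2" by (simp add: \<sigma>2_def innovation_var_def)
  note var = ergodic_average[OF innovation_var_integrable[OF Gm G2], folded \<sigma>2_def]
  note rot = rotated_average_complex[OF innovation_pseudo_var_integrable[OF Gm G2] t]
  have tail: "AE \<omega> in start_law. \<forall>K. (\<lambda>n. (\<Sum>k<n. innovation_tail G K (\<omega> k)) / n) \<longlonglongrightarrow> (\<integral>s. innovation_tail G K s \<partial>\<mu>)"
    unfolding AE_all_countable using ergodic_average[OF innovation_tail_integrable[OF Gm G2]] by blast
  have "AE x in \<mu>. weakly_converges (\<lambda>n. distr (chain_from \<mu> Q x) borel (\<lambda>\<omega>. fourier_vec (\<lambda>k. h (\<omega> k)) n t))
         (normal_law 0 (\<sigma>2 / 2) \<Otimes>\<^sub>M normal_law 0 (\<sigma>2 / 2))"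
    using AE_start_law[OF var] AE_start_law[OF rot] AE_start_law[OF tail]
      AE_start_law[OF AE_coordinate[OF AE_G_integrable_Q[OF Gm G2]]]
      AE_start_law[OF coboundary_negligible[OF Gm G2]] AE_start_law[OF fourier_sum_decomposition[OF eq]] AE_space
  proof eventually_elim
    case (elim x)
    let ?M = "chain_from \<mu> Q x" and ?V = "\<lambda>n \<omega>. fourier_vec (\<lambda>k. h (\<omega> k)) n t"
    note M = chain_from_markov[OF elim(7)]
    note d = markov_lawD[OF M]
    interpret M: prob_space ?M by (rule d)
  note toM = markov_law_measurable[OF M]
    have Sm[measurable]: "(\<lambda>\<omega>. fourier_sum (\<lambda>k. h (\<omega> k)) n t) \<in> borel_measurable ?M" for n
      by (rule toM[OF fourier_sum_measurable[OF hm]])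
    have Fm[measurable]: "fourier_mart G t n \<in> borel_measurable ?M" for n
      by (rule toM[OF fourier_mart_measurable[OF Gm G2]])
    have Vm: "?V n \<in> borel_measurable ?M" for n
      unfolding fourier_vec_def by measurable
    note N = char_normal_law_pair[OF \<sigma>0]
    show ?case
    proof (rule weakly_converges_of_char[OF _ _ N(1,2)])
      show "prob_space (distr ?M borel (?V n))" "sets (distr ?M borel (?V n)) = sets borel" for n
        by (simp_all add: M.prob_space_distr Vm)
      fix a b :: real
      define \<alpha> where "\<alpha> = Complex a b"
      let ?S = "\<lambda>n \<omega>. iexp (Re (cnj \<alpha> * fourier_sum (\<lambda>k. h (\<omega> k)) n t) / sqrt (real n))"
      let ?T = "\<lambda>n \<omega>. iexp (Re (cnj \<alpha> * fourier_mart G t n \<omega>) / sqrt (real n))"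
      have \<alpha>2: "(cmod \<alpha>)\<^sup>2 = a\<^sup>2 + b\<^sup>2" by (simp add: \<alpha>_def cmod_power2)
      have Tlim: "(\<lambda>n. \<integral>\<omega>. ?T n \<omega> \<partial>?M) \<longlonglongrightarrow> complex_of_real (exp (- (\<sigma>2 / 2 * (a\<^sup>2 + b\<^sup>2) / 2)))"
        using projected_mart_char_limit[OF Gm G2 M elim(4) elim(1) elim(2) elim(3), of \<alpha>]
        by (simp add: \<alpha>2 mult.commute flip: exp_of_real)
      have Si: "integrable ?M (?S n)" and Ti: "integrable ?M (?T n)" for n
        by (intro M.integrable_const_bound[where B=1]; simp)+
      have "(\<lambda>n. \<integral>\<omega>. ?S n \<omega> - ?T n \<omega> \<partial>?M) \<longlonglongrightarrow> (\<integral>\<omega>. 0 \<partial>?M)"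
      proof (rule integral_dominated_convergence[where w="\<lambda>_. 2"])
        show "AE \<omega> in ?M. (\<lambda>n. ?S n \<omega> - ?T n \<omega>) \<longlonglongrightarrow> 0"
          using elim(5,6)
        proof eventually_elim
          case (elim \<omega>)
          let ?q = "\<lambda>n. cmod (\<integral>r. G r \<partial>Q (\<omega> n))"
          have bound: "cmod (?S n \<omega> - ?T n \<omega>) \<le> cmod \<alpha> * (?q 0 / sqrt (real n) + ?q n / sqrt (real n))" for n
          proof -
            define R where "R = cis t * (\<integral>r. G r \<partial>Q (\<omega> 0)) - cis (real (Suc n) * t) * (\<integral>r. G r \<partial>Q (\<omega> n))"
            have S: "fourier_sum (\<lambda>k. h (\<omega> k)) n t = fourier_mart G t n \<omega> + R"
              using elim(2)[rule_format, of n] by (simp only: R_def) simp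
            have "cmod R \<le> cmod (cis t * (\<integral>r. G r \<partial>Q (\<omega> 0))) + cmod (cis (real (Suc n) * t) * (\<integral>r. G r \<partial>Q (\<omega> n)))"
              unfolding R_def by (rule norm_triangle_ineq4)
            then have R: "cmod R \<le> ?q 0 + ?q n" by (simp only: norm_mult norm_cis mult_1)
            have "cmod (?S n \<omega> - ?T n \<omega>) \<le> \<bar>Re (cnj \<alpha> * fourier_sum (\<lambda>k. h (\<omega> k)) n t) / sqrt (real n) - Re (cnj \<alpha> * fourier_mart G t n \<omega>) / sqrt (real n)\<bar>"
              by (rule iexp_lipschitz)
            also have "\<dots> = \<bar>Re (cnj \<alpha> * R)\<bar> / sqrt (real n)"
              unfolding S by (simp only: distrib_left plus_complex.sel diff_divide_distrib[symmetric] add_diff_cancel_left' abs_divide) simp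
            also have "\<dots> \<le> cmod (cnj \<alpha> * R) / sqrt (real n)"
              by (intro divide_right_mono abs_Re_le_cmod) simp
            also have "\<dots> \<le> cmod \<alpha> * (?q 0 + ?q n) / sqrt (real n)"
              unfolding norm_mult complex_mod_cnj by (intro divide_right_mono mult_left_mono R) simp_all
            also have "\<dots> = cmod \<alpha> * (?q 0 / sqrt (real n) + ?q n / sqrt (real n))"
              by (simp only: add_divide_distrib[symmetric] times_divide_eq_right)
            finally show ?thesis .
          qed
          have lim: "(\<lambda>n. cmod \<alpha> * (?q 0 / sqrt (real n) + ?q n / sqrt (real n))) \<longlonglongrightarrow> cmod \<alpha> * (0 + 0)"
          proof (intro tendsto_mult tendsto_const tendsto_add elim)
            show "(\<lambda>n. ?q 0 / sqrt (real n)) \<longlonglongrightarrow> 0"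
              by (intro tendsto_divide_0[OF tendsto_const] filterlim_at_top_imp_at_infinity
                filterlim_compose[OF sqrt_at_top] filterlim_real_sequentially)
          qed
          show ?case
          proof (rule Lim_null_comparison)
            show "\<forall>\<^sub>F n in sequentially. cmod (?S n \<omega> - ?T n \<omega>) \<le> cmod \<alpha> * (?q 0 / sqrt (real n) + ?q n / sqrt (real n))"
              by (rule always_eventually, rule allI, rule bound)
            show "(\<lambda>n. cmod \<alpha> * (?q 0 / sqrt (real n) + ?q n / sqrt (real n))) \<longlonglongrightarrow> 0"
              using lim by (simp only: add_0 mult_zero_right)
          qed
        qed
        show "AE \<omega> in ?M. norm (?S n \<omega> - ?T n \<omega>) \<le> 2" for n
        proof (rule AE_I2)
          fix \<omega>
          show "norm (?S n \<omega> - ?T n \<omega>) \<le> 2"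
            using norm_triangle_ineq4[of "?S n \<omega>" "?T n \<omega>"] by simp
        qed
      qed (use borel_measurable_integrable[OF Si] borel_measurable_integrable[OF Ti] in auto)
      then have "(\<lambda>n. (\<integral>\<omega>. ?S n \<omega> \<partial>?M) - (\<integral>\<omega>. ?T n \<omega> \<partial>?M)) \<longlonglongrightarrow> 0"
        using Si Ti by simp
      from tendsto_add[OF this Tlim]
      have Slim: "(\<lambda>n. \<integral>\<omega>. ?S n \<omega> \<partial>?M) \<longlonglongrightarrow> complex_of_real (exp (- (\<sigma>2 / 2 * (a\<^sup>2 + b\<^sup>2) / 2)))" by simp
      have "(\<integral>y. iexp (a * fst y + b * snd y) \<partial>distr ?M borel (?V n)) = (\<integral>\<omega>. ?S n \<omega> \<partial>?M)" for n
      proof -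
        have "(\<integral>y. iexp (a * fst y + b * snd y) \<partial>distr ?M borel (?V n)) = (\<integral>\<omega>. iexp (a * fst (?V n \<omega>) + b * snd (?V n \<omega>)) \<partial>?M)"
          by (rule integral_distr[OF Vm borel_measurable_continuous_onI]) (intro continuous_intros)
        moreover have "a * fst (?V n \<omega>) + b * snd (?V n \<omega>) = Re (cnj \<alpha> * fourier_sum (\<lambda>k. h (\<omega> k)) n t) / sqrt (real n)" for \<omega>
          by (simp add: fourier_vec_def \<alpha>_def add_divide_distrib)
        ultimately show ?thesis by simp
      qed
      then show "(\<lambda>n. \<integral>y. iexp (a * fst y + b * snd y) \<partial>distr ?M borel (?V n)) \<longlonglongrightarrow>
          (\<integral>y. iexp (a * fst y + b * snd y) \<partial>normal_law 0 (\<sigma>2 / 2) \<Otimes>\<^sub>M normal_law 0 (\<sigma>2 / 2))"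
        using Slim by (simp only: N(3))
    qed
  qed
  moreover have "(\<lambda>n. 1 / real n * (\<integral>\<omega>. (cmod (fourier_sum (\<lambda>k. h (\<omega> k)) n t))\<^sup>2 \<partial>start_law)) \<longlonglongrightarrow> \<sigma>2"
    unfolding \<sigma>2_def by (rule fourier_variance_limit(1)[OF Gm G2 eq hm])
  ultimately show ?thesis by (intro that)
qed

end

text \<open>In \<open>]0, 2\<pi>[\<close> the zeros of \<open>sin 2 t\<close> are the three excluded points.\<close>

theorem corollary7:
  fixes \<mu> :: "'a measure" and Q :: "'a \<Rightarrow> 'a measure" and P :: "(int \<Rightarrow> 'a) measure"
    and h :: "'a \<Rightarrow> real" and t :: real
  assumes "prob_space \<mu>"
    and "countably_generated_sigma \<mu>"
    and "Q \<in> \<mu> \<rightarrow>\<^sub>M prob_algebra \<mu>"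
    and "stationary_markov_law \<mu> Q P"
    and "shift_ergodic P"
    and "reversible \<mu> Q"
    and "h \<in> borel_measurable \<mu>"
    and "integrable \<mu> (\<lambda>x. (h x)\<^sup>2)"
    and "(\<integral>x. h x \<partial>\<mu>) = 0"
    and "t \<in> {0<..<2 * pi} - {pi, pi / 2, 3 * pi / 2}"
  shows "\<exists>\<sigma>2::real.
    (\<lambda>n. 1 / real n * (\<integral>\<omega>. (cmod (fourier_sum (\<lambda>k. h (\<omega> (int k))) n t))\<^sup>2 \<partial>P)) \<longlonglongrightarrow> \<sigma>2 \<and>
    (\<exists>S'\<in>sets \<mu>. measure \<mu> S' = 1 \<and>
      (\<forall>x\<in>S'. weakly_converges
         (\<lambda>n. distr (chain_from \<mu> Q x) borel (\<lambda>\<omega>. fourier_vec (\<lambda>k. h (\<omega> k)) n t))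
         (normal_law 0 (\<sigma>2 / 2) \<Otimes>\<^sub>M normal_law 0 (\<sigma>2 / 2))))"
proof -
  interpret markov_kernel \<mu> Q
    using assms(1,3) by (intro markov_kernel.intro markov_kernel_axioms.intro)
  interpret ergodic_reversible_chain \<mu> Q P
    by unfold_locales (use reversible_imp_invariant assms(4-6) in auto)
  have h: "square_integrable \<mu> h" using assms(7,8) by (simp add: square_integrable_def)
  have t: "sin (2 * t) \<noteq> 0"
  proof
    assume "sin (2 * t) = 0"
    then obtain i :: int where i: "2 * t = of_int i * pi" by (auto simp: sin_zero_iff_int2)
    have "0 < of_int i * pi" "of_int i * pi < 4 * pi" using assms(10) by (auto simp flip: i)
    then have "0 < i" "i < 4" by (simp_all add: zero_less_mult_iff)
    then have "i = 1 \<or> i = 2 \<or> i = 3" by auto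
    then show False using i assms(10) by auto
  qed
  obtain \<sigma>2 where lim: "(\<lambda>n. 1 / real n * (\<integral>\<omega>. (cmod (fourier_sum (\<lambda>k. h (\<omega> k)) n t))\<^sup>2 \<partial>start_law)) \<longlonglongrightarrow> \<sigma>2"
    and AE: "AE x in \<mu>. weakly_converges (\<lambda>n. distr (chain_from \<mu> Q x) borel (\<lambda>\<omega>. fourier_vec (\<lambda>k. h (\<omega> k)) n t))
         (normal_law 0 (\<sigma>2 / 2) \<Otimes>\<^sub>M normal_law 0 (\<sigma>2 / 2))" (is "AE x in \<mu>. ?C x")
    by (rule quenched_fourier_clt[OF h t])
  have "(\<integral>\<omega>. (cmod (fourier_sum (\<lambda>k. h (\<omega> k)) n t))\<^sup>2 \<partial>start_law) =
      (\<integral>\<omega>. (cmod (fourier_sum (\<lambda>k. h (\<omega> (int k))) n t))\<^sup>2 \<partial>P)" for n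
  proof -
    have "(\<lambda>\<omega>. (cmod (fourier_sum (\<lambda>k. h (\<omega> k)) n t))\<^sup>2) \<in> borel_measurable path_space"
      using fourier_sum_measurable[OF assms(7)] by simp
    from integral_distr[OF measurable_P[OF stationary forward_path_measurable] this]
    show ?thesis by (simp add: forward_law[OF stationary] forward_path_def)
  qed
  with lim have "(\<lambda>n. 1 / real n * (\<integral>\<omega>. (cmod (fourier_sum (\<lambda>k. h (\<omega> (int k))) n t))\<^sup>2 \<partial>P)) \<longlonglongrightarrow> \<sigma>2" by simp
  moreover have "\<exists>S'\<in>sets \<mu>. measure \<mu> S' = 1 \<and> (\<forall>x\<in>S'. ?C x)"
  proof -
    obtain N where N: "{x\<in>space \<mu>. \<not> ?C x} \<subseteq> N" "emeasure \<mu> N = 0" "N \<in> sets \<mu>"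
      using AE by (rule AE_E)
    have "measure \<mu> (space \<mu> - N) = 1"
      using N prob_compl[OF N(3)] by (simp add: measure_def)
    then show ?thesis
      using N by (intro bexI[of _ "space \<mu> - N"]) auto
  qed
  ultimately show ?thesis by blast
qed

end
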